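(* Let $K\subseteq\mathbb{R}^n$ be a bounded star-shaped set with diameter $d=\sup_{x,y\in K}\|x-y\|$, let $\sigma>0$, and let $\varepsilon\in(0,\tfrac{1}{32})$. For a constant $c>0$ define $$\delta^*=\sup\Big\{\delta\ge 0:\ N\frac{\delta^2}{\sigma^2}\le \log M^{\mathrm{loc}}(\delta,c)\Big\}.$$ Then, for $c$ a sufficiently large absolute constant and under the assumption $N\gtrsim \sup_{\delta>0}\log M^{\mathrm{loc}}(\delta,c)$ (i.e. $N\ge A\sup_{\delta>0}\log M^{\mathrm{loc}}(\delta,c)$ for a suitable absolute constant $A$), the minimax risk satisfies $$\mathfrak{M}\asymp \max\big(\delta^{*2},\ \varepsilon\sigma^2\big)\wedge d^2 .$$
   Context: Model: fix integers $n,N\ge 1$, $\sigma>0$ and a contamination level $\varepsilon$. The unknown mean $\mu$ lies in a known set $K\subseteq\mathbb{R}^n$. The uncorrupted sample is $\tilde X_i=\mu+\xi_i$, $i=1,\dots,N$, where the $\xi_i$ are i.i.d. copies of a random vector $\xi$ whose distribution belongs to $\Xi_{\sigma^2}$, the family of all distributions on $\mathbb{R}^n$ with mean zero and covariance matrix $\Sigma\preceq\sigma^2 I$ (so only second moments are assumed). An adversary $\mathcal{C}$, which may inspect the entire uncorrupted sample and knows the model and the estimator, replaces at most a fraction $\varepsilon$ of the $N$ points by arbitrary points; the statistician observes $X=\mathcal{C}(\tilde X)$. The minimax risk is $$\mathfrak{M}=\inf_{\hat\mu}\sup_{\mu\in K}\sup_{\xi\in\Xi_{\sigma^2}}\sup_{\mathcal{C}}\mathbb{E}_\mu\big\|\hat\mu(\mathcal{C}(\tilde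 X))-\mu\big\|^2,$$ the infimum being over all estimators (functions of the observed data), $\|\cdot\|$ the Euclidean norm. Star-shaped: $K$ is star-shaped if there is $k^*\in K$ with $(1-t)k^*+tk\in K$ for all $k\in K$, $t\in[0,1]$. Local metric entropy: for $A\subseteq\mathbb{R}^n$, the $\eta$-packing number $M(\eta,A)$ is the maximal cardinality of a set $\{\nu_1,\dots,\nu_M\}\subset A$ with $\|\nu_i-\nu_j\|>\eta$ for $i\ne j$. For $c>0$, $M^{\mathrm{loc}}(\eta,c)=M^{\mathrm{loc}}_K(\eta,c):=\sup_{\nu\in K}M\big(\eta/c,\ B(\nu,\eta)\cap K\big)$, where $B(\nu,\eta)$ is the closed Euclidean ball; $\log M^{\mathrm{loc}}(\eta,c)$ is the local metric entropy. Notation: $a\wedge b=\min(a,b)$; $\asymp$ and $\gtrsim$ hold up to multiplicative constants not depending on $n,N,\sigma,\varepsilon,K$. *)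

theory Defs
  imports "HOL-Probability.Probability"
begin

text \<open>Euclidean space R^n is represented explicitly (so that the dimension n can be
quantified inside the statement): a vector is an extensional function
nat => real on the index set {..<n}, and the measurable space of R^n is the
finite product of Borel sets.\<close>

definition Rn :: "nat \<Rightarrow> (nat \<Rightarrow> real) measure" where
  "Rn n = PiM {..<n} (\<lambda>_. borel)"

definition vnorm :: "nat \<Rightarrow> (nat \<Rightarrow> real) \<Rightarrow> real" where
  "vnorm n x = sqrt (\<Sum>i<n. (x i)^2)"

definition vdist :: "nat \<Rightarrow> (nat \<Rightarrow> real) \<Rightarrow> (nat \<Rightarrow> real) \<Rightarrow> real" where
  "vdist n x y = vnorm n (\<lambda>i. x i - y i)"

definition vinner :: "nat \<Rightarrow> (nat \<Rightarrow> real) \<Rightarrow> (nat \<Rightarrow> real) \<Rightarrow> real" where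
  "vinner n u v = (\<Sum>i<n. u i * v i)"

definition vadd :: "nat \<Rightarrow> (nat \<Rightarrow> real) \<Rightarrow> (nat \<Rightarrow> real) \<Rightarrow> (nat \<Rightarrow> real)" where
  "vadd n x y = (\<lambda>i\<in>{..<n}. x i + y i)"

definition star_shaped_Rn :: "nat \<Rightarrow> (nat \<Rightarrow> real) set \<Rightarrow> bool" where
  "star_shaped_Rn n K \<longleftrightarrow> (\<exists>k\<in>K. \<forall>x\<in>K. \<forall>t\<in>{0..1::real}.
      (\<lambda>i\<in>{..<n}. (1 - t) * k i + t * x i) \<in> K)"

definition bounded_Rn :: "nat \<Rightarrow> (nat \<Rightarrow> real) set \<Rightarrow> bool" where
  "bounded_Rn n K \<longleftrightarrow> (\<exists>B. \<forall>x\<in>K. vnorm n x \<le> B)"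

definition diam_Rn :: "nat \<Rightarrow> (nat \<Rightarrow> real) set \<Rightarrow> real" where
  "diam_Rn n K = Sup {vdist n x y | x y. x \<in> K \<and> y \<in> K}"

definition packing_number :: "nat \<Rightarrow> real \<Rightarrow> (nat \<Rightarrow> real) set \<Rightarrow> enat" where
  "packing_number n \<eta> A = Sup {enat (card S) | S. finite S \<and> S \<subseteq> A \<and>
      (\<forall>x\<in>S. \<forall>y\<in>S. x \<noteq> y \<longrightarrow> vdist n x y > \<eta>)}"

definition local_packing :: "nat \<Rightarrow> (nat \<Rightarrow> real) set \<Rightarrow> real \<Rightarrow> real \<Rightarrow> enat" where
  "local_packing n K \<eta> c = (SUP \<nu>\<in>K. packing_number n (\<eta> / c) ({x. vdist n x \<nu> \<le> \<eta>} \<inter> K))"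

definition local_entropy :: "nat \<Rightarrow> (nat \<Rightarrow> real) set \<Rightarrow> real \<Rightarrow> real \<Rightarrow> ereal" where
  "local_entropy n K \<eta> c = (case local_packing n K \<eta> c of
      enat m \<Rightarrow> ereal (ln (real m)) | \<infinity> \<Rightarrow> \<infinity>)"

definition delta_star :: "nat \<Rightarrow> (nat \<Rightarrow> real) set \<Rightarrow> real \<Rightarrow> nat \<Rightarrow> real \<Rightarrow> real" where
  "delta_star n K \<sigma> N c = Sup {\<delta>. \<delta> \<ge> 0 \<and>
      ereal (real N * \<delta>^2 / \<sigma>^2) \<le> local_entropy n K \<delta> c}"

definition noise_class :: "nat \<Rightarrow> real \<Rightarrow> (nat \<Rightarrow> real) measure set" where
  "noise_class n s2 = {D. prob_space D \<and> sets D = sets (Rn n) \<and>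
      (\<forall>i<n. integrable D (\<lambda>x. x i) \<and> integrable D (\<lambda>x. (x i)^2)) \<and>
      (\<forall>i<n. (\<integral>x. x i \<partial>D) = 0) \<and>
      (\<forall>v. (\<integral>x. (vinner n v x)^2 \<partial>D) \<le> s2 * vinner n v v)}"

definition sample_space :: "nat \<Rightarrow> nat \<Rightarrow> (nat \<Rightarrow> nat \<Rightarrow> real) measure" where
  "sample_space n N = PiM {..<N} (\<lambda>_. Rn n)"

definition estimators :: "nat \<Rightarrow> nat \<Rightarrow> ((nat \<Rightarrow> nat \<Rightarrow> real) \<Rightarrow> (nat \<Rightarrow> real)) set" where
  "estimators n N = measurable (sample_space n N) (Rn n)"

definition adversaries :: "nat \<Rightarrow> nat \<Rightarrow> real \<Rightarrow>
    ((nat \<Rightarrow> nat \<Rightarrow> real) \<Rightarrow> (nat \<Rightarrow> nat \<Rightarrow> real)) set" where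
  "adversaries n N \<epsilon> = {C \<in> measurable (sample_space n N) (sample_space n N).
      \<forall>X\<in>space (sample_space n N). real (card {i\<in>{..<N}. C X i \<noteq> X i}) \<le> \<epsilon> * real N}"

definition minimax_risk :: "nat \<Rightarrow> (nat \<Rightarrow> real) set \<Rightarrow> real \<Rightarrow> real \<Rightarrow> nat \<Rightarrow> ennreal" where
  "minimax_risk n K \<sigma> \<epsilon> N =
     (INF est\<in>estimators n N. SUP \<mu>\<in>K. SUP D\<in>noise_class n (\<sigma>^2). SUP C\<in>adversaries n N \<epsilon>.
        \<integral>\<^sup>+ \<xi>. ennreal ((vdist n (est (C (\<lambda>j\<in>{..<N}. vadd n \<mu> (\<xi> j)))) \<mu>)^2)
          \<partial>(PiM {..<N} (\<lambda>_. D)))"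

end

theory Submission
  imports Defs
begin

text \<open>Upper bound. Take a maximal \<open>\<eta>\<close>-separated net of \<open>K\<close> with \<open>\<eta>\<^sup>2\<close> a large multiple of
  \<open>max (\<delta>*\<^sup>2) (\<epsilon> \<sigma>\<^sup>2)\<close>, compare its points pairwise by a bounded antisymmetric score, and output the
  point whose farthest unbeaten competitor is nearest. A bounded score changes little under
  corruption, and at distance \<open>T\<close> a test fails with probability at most \<open>(1 + T\<^sup>2/\<sigma>\<^sup>2) powr (-\<kappa> N)\<close>.
  Iterating the local entropy bound from radius \<open>t\<close> to \<open>t/c\<close> shows that at most
  \<open>(1 + t\<^sup>2/\<sigma>\<^sup>2) powr m\<close> net points lie within \<open>t\<close>, with \<open>m\<close> much smaller than \<open>\<kappa> N\<close>; here the
  hypothesis on \<open>N\<close> controls the radii beyond \<open>\<sigma>\<close>. The expected squared error is then a convergent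
  sum over geometric shells.

  Lower bound. The term \<open>\<epsilon> \<sigma>\<^sup>2\<close> (and \<open>\<sigma>\<^sup>2/N\<close>) comes from a two-atom law whose rare atom the adversary
  deletes. The term \<open>\<delta>*\<^sup>2\<close> comes from a local packing, shrunk by \<open>1/2\<close> towards the star centre, with
  independent coordinates on the two points \<open>y\<^sub>i \<plusminus> \<sigma>\<close> biased to have the prescribed mean: the
  likelihood ratios have second moment at most \<open>exp (N \<delta>\<^sup>2/(4\<sigma>\<^sup>2))\<close>, a small fraction of the
  number of hypotheses, so no estimator identifies the hypothesis with probability above \<open>1/2\<close>.\<close>

section \<open>Vectors, packings and star-shaped sets\<close>

text \<open>The risk is an expectation and the diameter of \<open>K\<close> is not tied to \<sigma>,
  so rare failures at very large distances have to be paid for with second moments only. Beyond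
  \<sigma> the entropy budget no longer grows with the radius, and the net grows there like a power
  of the radius of degree proportional to \<open>N\<close>. A score of fixed size would leave the
  exponential moment bounded away from 0 as T grows; the weight ln (T / (4 \<sigma>)) makes it
  decay, but it also lets each corrupted point do more damage, which is affordable for \<epsilon>
  below a fixed constant. Powers of 1 + t^2/\<sigma>^2 behave like exponentials of t^2/\<sigma>^2
  below \<sigma> and like polynomials beyond, so counts and failure probabilities can be compared
  through their exponents in both regimes at once. In the lower bound, two-point noise keeps
  likelihood ratios explicit but allows only shifts up to \<sigma>; the budget on \<open>N\<close>
  keeps critical radii in that range. A packing with fewer than 16 points is too small for the
  testing bound; its critical radius then has order \<sigma>/sqrt N, and the two-atom bound takes
  over.\<close>

lemma vnorm_L2: "vnorm n x = L2_set x {..<n}"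
  by (simp add: vnorm_def L2_set_def)

lemma vnorm_nonneg [simp]: "0 \<le> vnorm n x"
  by (simp add: vnorm_L2)

lemma vdist_nonneg [simp]: "0 \<le> vdist n x y"
  by (simp add: vdist_def)

lemma vdist_self [simp]: "vdist n x x = 0"
  by (simp add: vdist_def vnorm_def)

lemma vdist_commute: "vdist n x y = vdist n y x"
  by (simp add: vdist_def vnorm_def power2_commute)

lemma vdist_triangle: "vdist n x z \<le> vdist n x y + vdist n y z"
  using L2_set_triangle_ineq[of "\<lambda>i. x i - y i" "\<lambda>i. y i - z i" "{..<n}"]
  by (simp add: vdist_def vnorm_L2)

lemma vdist_square: "(vdist n x y)\<^sup>2 = (\<Sum>i<n. (x i - y i)\<^sup>2)"
  by (simp add: vdist_def vnorm_def sum_nonneg)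

lemma vdist_eq_0_D:
  assumes "x \<in> space (Rn n)" "y \<in> space (Rn n)" "vdist n x y = 0"
  shows "x = y"
proof -
  have "\<forall>i<n. x i = y i"
    using assms(3) by (simp add: vdist_def vnorm_L2 L2_set_eq_0_iff)
  then show ?thesis
    using assms(1,2) by (intro PiE_ext[of x "{..<n}" _ y]) (auto simp: Rn_def space_PiM)
qed

lemma vinner_vnorm_le: "\<bar>vinner n u v\<bar> \<le> vnorm n u * vnorm n v"
proof -
  have "\<bar>\<Sum>i<n. u i * v i\<bar> \<le> (\<Sum>i<n. \<bar>u i\<bar> * \<bar>v i\<bar>)"
    by (rule order_trans[OF sum_abs]) (simp add: abs_mult)
  also have "\<dots> \<le> L2_set u {..<n} * L2_set v {..<n}"
    by (rule L2_set_mult_ineq)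
  finally show ?thesis
    by (simp add: vinner_def vnorm_L2)
qed

definition segment_point :: "nat \<Rightarrow> (nat \<Rightarrow> real) \<Rightarrow> real \<Rightarrow> (nat \<Rightarrow> real) \<Rightarrow> (nat \<Rightarrow> real)" where
  "segment_point n k t x = (\<lambda>i\<in>{..<n}. (1 - t) * k i + t * x i)"

lemma vdist_segment_point:
  assumes "0 \<le> t"
  shows "vdist n (segment_point n k t x) (segment_point n k t y) = t * vdist n x y"
proof -
  have "(\<Sum>i<n. (segment_point n k t x i - segment_point n k t y i)\<^sup>2) = (\<Sum>i<n. t\<^sup>2 * (x i - y i)\<^sup>2)"
    by (intro sum.cong) (auto simp: segment_point_def power2_eq_square algebra_simps)
  then show ?thesis
    using assms by (simp add: vdist_def vnorm_def sum_distrib_left[symmetric] real_sqrt_mult)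
qed

lemma segment_point_self:
  assumes "k \<in> space (Rn n)"
  shows "segment_point n k t k = k"
  using assms by (auto simp: segment_point_def Rn_def space_PiM algebra_simps fun_eq_iff PiE_def extensional_def)

definition separated :: "nat \<Rightarrow> real \<Rightarrow> (nat \<Rightarrow> real) set \<Rightarrow> bool" where
  "separated n \<eta> S \<longleftrightarrow> (\<forall>x\<in>S. \<forall>y\<in>S. x \<noteq> y \<longrightarrow> vdist n x y > \<eta>)"

lemma separated_subset: "separated n \<eta> S \<Longrightarrow> T \<subseteq> S \<Longrightarrow> separated n \<eta> T"
  by (auto simp: separated_def)

lemma less_packing_number_D:
  assumes "enat m < packing_number n \<eta> A"
  obtains S where "finite S" "S \<subseteq> A" "separated n \<eta> S" "m < card S"
proof -
  have "\<exists>e\<in>{enat (card S) | S. finite S \<and> S \<subseteq> A \<and> separated n \<eta> S}. enat m < e"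
    using assms unfolding packing_number_def separated_def less_Sup_iff .
  then obtain S where "finite S" "S \<subseteq> A" "separated n \<eta> S" "enat m < enat (card S)"
    by (elim bexE CollectE exE conjE) simp
  then show ?thesis by (intro that) simp_all
qed

lemma local_packing_ge:
  assumes "\<nu> \<in> K" "finite S" "S \<subseteq> {x. vdist n x \<nu> \<le> \<eta>} \<inter> K" "separated n (\<eta> / c) S"
  shows "enat (card S) \<le> local_packing n K \<eta> c"
  unfolding local_packing_def
proof (rule SUP_upper2[OF assms(1)])
  show "enat (card S) \<le> packing_number n (\<eta> / c) ({x. vdist n x \<nu> \<le> \<eta>} \<inter> K)"
    unfolding packing_number_def using assms by (intro Sup_upper) (auto simp: separated_def)
qed

lemma ln_card_le_local_entropy:
  assumes "\<nu> \<in> K" "finite S" "S \<noteq> {}" "S \<subseteq> {x. vdist n x \<nu> \<le> \<eta>} \<inter> K" "separated n (\<eta> / c) S"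
  shows "ereal (ln (card S)) \<le> local_entropy n K \<eta> c"
proof (cases "local_packing n K \<eta> c")
  case (enat m)
  then have "card S \<le> m"
    using local_packing_ge[OF assms(1,2,4,5)] by simp
  moreover have "0 < card S" using assms by (simp add: card_gt_0_iff)
  ultimately show ?thesis using enat by (simp add: local_entropy_def)
qed (simp add: local_entropy_def)

text \<open>A finite supremum of cardinalities is attained, and an infinite one is exceeded by
  packings of any size, so a lower bound on the entropy always yields one actual packing. The strict
  form \<open>enat m < local_packing n K \<eta> c\<close> is what passes through both nested
  suprema.\<close>

lemma local_entropy_attained:
  assumes "ereal x \<le> local_entropy n K \<eta> c" "K \<noteq> {}" "0 \<le> \<eta>"
  obtains \<nu> S where "\<nu> \<in> K" "finite S" "S \<noteq> {}" "S \<subseteq> {x. vdist n x \<nu> \<le> \<eta>} \<inter> K"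
    "separated n (\<eta> / c) S" "x \<le> ln (card S)"
proof -
  obtain m where m: "x \<le> ln (real (Suc m))" "enat m < local_packing n K \<eta> c"
  proof (cases "local_packing n K \<eta> c")
    case (enat M)
    obtain k where k: "k \<in> K" using assms by auto
    \<comment> \<open>One point is a packing, so the \<open>M - 1\<close> below is not
      truncated.\<close>
    have "enat 1 \<le> local_packing n K \<eta> c"
      using local_packing_ge[of k K "{k}" n \<eta> c] k assms by (auto simp: separated_def)
    then have "M \<ge> 1" using enat by (simp add: one_enat_def[symmetric])
    then show ?thesis
      using enat assms(1) by (intro that[of "M - 1"]) (auto simp: local_entropy_def)
  next
    case infinity
    obtain m where "exp x \<le> real m" using real_arch_simple by blast
    then have "x \<le> ln (real (Suc m))" by (subst ln_ge_iff) auto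
    then show ?thesis using infinity by (intro that[of m]) auto
  qed
  then obtain \<nu> where \<nu>: "\<nu> \<in> K" "enat m < packing_number n (\<eta> / c) ({x. vdist n x \<nu> \<le> \<eta>} \<inter> K)"
    unfolding local_packing_def by (auto simp: less_SUP_iff)
  from \<nu>(2) obtain S where S: "finite S" "S \<subseteq> {x. vdist n x \<nu> \<le> \<eta>} \<inter> K" "separated n (\<eta> / c) S" "m < card S"
    by (rule less_packing_number_D)
  have "ln (real (Suc m)) \<le> ln (card S)" using S(4) by (subst ln_le_cancel_iff) auto
  then have "x \<le> ln (card S)" using m(1) by (rule order_trans[rotated])
  moreover have "S \<noteq> {}" using S(4) by auto
  ultimately show ?thesis by (intro that[OF \<nu>(1) S(1) _ S(2,3)])
qed

section \<open>Homotheties towards the star centre\<close>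

locale star_set =
  fixes n :: nat and K :: "(nat \<Rightarrow> real) set" and k :: "nat \<Rightarrow> real"
  assumes space: "K \<subseteq> space (Rn n)" and centre: "k \<in> K"
    and star: "\<And>x t. x \<in> K \<Longrightarrow> 0 \<le> t \<Longrightarrow> t \<le> 1 \<Longrightarrow> segment_point n k t x \<in> K"
    and bounded: "bounded_Rn n K"
begin

lemma inj_on_segment_point:
  assumes "0 < t" shows "inj_on (segment_point n k t) K"
proof (rule inj_onI)
  fix x y assume *: "x \<in> K" "y \<in> K" "segment_point n k t x = segment_point n k t y"
  then have "t * vdist n x y = 0"
    using vdist_segment_point[of t n k x y] assms by simp
  then show "x = y"
    using assms * space by (intro vdist_eq_0_D[of x n y]) auto
qed

text \<open>A homothety scales radius and separation alike, so the ratio \<open>c\<close> is kept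
  and the local entropy cannot increase with the radius. Both bounds rest on this: large radii are
  brought down near \<delta>*, and packings are halved to weaken the signal.\<close>

lemma shrink_packing:
  assumes "0 < t" "t \<le> 1" "\<nu> \<in> K" "S \<subseteq> {x. vdist n x \<nu> \<le> \<delta>} \<inter> K" "separated n \<eta> S"
  defines "S' \<equiv> segment_point n k t ` S" and "\<nu>' \<equiv> segment_point n k t \<nu>"
  shows "\<nu>' \<in> K" "S' \<subseteq> {x. vdist n x \<nu>' \<le> t * \<delta>} \<inter> K" "separated n (t * \<eta>) S'" "card S' = card S"
proof -
  show "\<nu>' \<in> K" using assms star by auto
  show "S' \<subseteq> {x. vdist n x \<nu>' \<le> t * \<delta>} \<inter> K"
    using assms star by (auto simp: vdist_segment_point)
  show "separated n (t * \<eta>) S'"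
    using assms by (auto simp: separated_def vdist_segment_point)
  show "card S' = card S"
    unfolding S'_def using assms(4) inj_on_subset[OF inj_on_segment_point[OF assms(1)], of S]
    by (intro card_image) auto
qed

lemma bdd_above_dist: "bdd_above {vdist n x y | x y. x \<in> K \<and> y \<in> K}"
proof -
  obtain B where B: "\<And>x. x \<in> K \<Longrightarrow> vnorm n x \<le> B" using bounded by (auto simp: bounded_Rn_def)
  have "vdist n x y \<le> 2 * B" if "x \<in> K" "y \<in> K" for x y
  proof -
    have "vdist n x y \<le> vdist n x (\<lambda>_. 0) + vdist n (\<lambda>_. 0) y" by (rule vdist_triangle)
    also have "vdist n (\<lambda>_. 0) y = vdist n y (\<lambda>_. 0)" by (rule vdist_commute)
    finally show ?thesis using B[OF that(1)] B[OF that(2)] by (simp add: vdist_def)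
  qed
  then show ?thesis by (intro bdd_aboveI[of _ "2 * B"]) auto
qed

lemma vdist_le_diam: "x \<in> K \<Longrightarrow> y \<in> K \<Longrightarrow> vdist n x y \<le> diam_Rn n K"
  unfolding diam_Rn_def by (rule cSup_upper[OF _ bdd_above_dist]) auto

lemma diam_nonneg: "0 \<le> diam_Rn n K"
  using vdist_le_diam[OF centre centre] by simp

lemma diam_less_D:
  assumes "r < diam_Rn n K"
  obtains x y where "x \<in> K" "y \<in> K" "r < vdist n x y"
  using assms less_cSup_iff[OF _ bdd_above_dist, of r] centre by (auto simp: diam_Rn_def)

text \<open>One end of a nearly diametral pair is farther than \<open>r\<close> from the centre, and
  the homothety moves it to distance exactly \<open>r\<close>.\<close>

lemma point_at_distance:
  assumes "0 \<le> r" "r < diam_Rn n K / 2"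
  obtains x where "x \<in> K" "vdist n x k = r"
proof -
  obtain x y where xy: "x \<in> K" "y \<in> K" "2 * r < vdist n x y"
    using diam_less_D[of "2 * r"] assms by auto
  have "vdist n x y \<le> vdist n x k + vdist n y k"
    using vdist_triangle[of n x y k] by (simp add: vdist_commute)
  then have "r < vdist n x k \<or> r < vdist n y k" using xy by linarith
  then obtain z where z: "z \<in> K" "r < vdist n z k" using xy by blast
  have k: "segment_point n k t k = k" for t using centre space by (auto intro: segment_point_self)
  have "vdist n (segment_point n k (r / vdist n z k) z) k = r"
    using vdist_segment_point[of "r / vdist n z k" n k z k] z assms by (simp add: k)
  moreover have "segment_point n k (r / vdist n z k) z \<in> K"
    using z assms by (intro star) auto
  ultimately show ?thesis using that by blast
qed

end

lemma star_set_exists: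
  assumes "K \<subseteq> space (Rn n)" "star_shaped_Rn n K" "bounded_Rn n K"
  obtains k where "star_set n K k"
proof -
  obtain k where "k \<in> K" "\<forall>x\<in>K. \<forall>t\<in>{0..1}. segment_point n k t x \<in> K"
    using assms(2) unfolding star_shaped_Rn_def segment_point_def by blast
  then show ?thesis using assms by (intro that[of k]) (unfold_locales, auto)
qed

section \<open>Counting separated points\<close>

text \<open>The uniform bound \<open>b\<close> provides a packing of largest cardinality; a point it
  failed to cover could be added to it.\<close>

lemma maximal_separated_exists:
  assumes "\<And>P. finite P \<Longrightarrow> P \<subseteq> A \<Longrightarrow> separated n \<eta> P \<Longrightarrow> card P \<le> b" "0 \<le> \<eta>"
  obtains P where "finite P" "P \<subseteq> A" "separated n \<eta> P" "\<And>x. x \<in> A \<Longrightarrow> \<exists>p\<in>P. vdist n x p \<le> \<eta>"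
proof -
  define Q where "Q P \<longleftrightarrow> finite P \<and> P \<subseteq> A \<and> separated n \<eta> P" for P
  have "Q {}" by (simp add: Q_def separated_def)
  moreover have "\<forall>P. Q P \<longrightarrow> card P < Suc b" using assms(1) by (auto simp: Q_def less_Suc_eq_le)
  ultimately have "\<exists>P. Q P \<and> (\<forall>P'. Q P' \<longrightarrow> card P' \<le> card P)"
    by (rule Lattices_Big.ex_has_greatest_nat)
  then obtain P where P: "Q P" "\<And>P'. Q P' \<Longrightarrow> card P' \<le> card P" by blast
  have "\<exists>p\<in>P. vdist n x p \<le> \<eta>" if "x \<in> A" for x
  proof (rule ccontr)
    assume *: "\<not> ?thesis"
    then have far: "\<forall>p\<in>P. \<eta> < vdist n x p \<and> \<eta> < vdist n p x" by (auto simp: not_le vdist_commute)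
    then have "x \<notin> P" using assms(2) by auto
    moreover have "Q (insert x P)"
      using P(1) far that by (auto simp: Q_def separated_def)
    ultimately show False using P(2)[of "insert x P"] P(1) by (simp add: Q_def)
  qed
  then show ?thesis using P(1) by (intro that[of P]) (auto simp: Q_def)
qed

lemma exp_le_quadratic:
  fixes y :: real
  assumes "\<bar>y\<bar> \<le> 1"
  shows "exp y \<le> 1 + y + y\<^sup>2"
proof (cases "0 \<le> y")
  case True
  then show ?thesis using assms exp_bound[of y] by simp
next
  case False
  \<comment> \<open>For negative arguments the claim becomes a lower bound on the reciprocal:
    \<open>exp z\<close> dominates its quadratic Taylor polynomial, whose product with 1 - z + z^2
    is at least 1.\<close>
  define z where "z = - y"
  have z: "0 \<le> z" "z \<le> 1" using False assms by (auto simp: z_def)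
  have "1 \<le> (1 - z + z\<^sup>2) * (1 + z + z\<^sup>2 / 2)"
  proof -
    have "(1 - z + z\<^sup>2) * (1 + z + z\<^sup>2 / 2) = 1 + z\<^sup>2 / 2 * (1 + z + z\<^sup>2)"
      by (simp add: field_simps power2_eq_square)
    then show ?thesis using z by simp
  qed
  also have "\<dots> \<le> (1 - z + z\<^sup>2) * exp z"
    using z exp_lower_Taylor_quadratic[of z] by (intro mult_left_mono) (auto simp: power2_eq_square)
  finally have "exp (- z) \<le> 1 - z + z\<^sup>2"
    by (simp add: exp_minus field_simps)
  then show ?thesis by (simp add: z_def)
qed

text \<open>One scale of the entropy recursion with x = t^2/\<sigma>^2: the factor gained by
  covering at radius t/c is paid by the drop from 1 + x to 1 + x/c^2. The \<open>min\<close>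
  combines the bound proportional to x near 0 with the flat budget beyond \<sigma>.\<close>

lemma geometric_step:
  fixes c x :: real
  assumes "2 \<le> c" "0 \<le> x"
  shows "exp (min x 1 / 8) * (1 + x / c\<^sup>2) \<le> 1 + x"
proof -
  define m where "m = min x 1"
  have m: "0 \<le> m" "m \<le> 1" "m \<le> x" using assms by (auto simp: m_def)
  have c: "2\<^sup>2 \<le> c\<^sup>2" using assms by (intro power_mono) auto
  have "(m / 8)\<^sup>2 \<le> m / 8 * 1" unfolding power2_eq_square using m by (intro mult_left_mono) auto
  then have "exp (m / 8) \<le> 1 + m / 4" using exp_le_quadratic[of "m / 8"] m by simp
  moreover have "x / c\<^sup>2 \<le> x / 4" using c assms by (intro divide_left_mono) auto
  ultimately have "exp (m / 8) * (1 + x / c\<^sup>2) \<le> (1 + m / 4) * (1 + x / 4)"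
    using assms m by (intro mult_mono) auto
  also have "\<dots> = 1 + m / 4 + x / 4 + x * m / 16" by (simp add: field_simps)
  also have "\<dots> \<le> 1 + x"
    using mult_left_mono[of m 1 x] m assms by simp
  finally show ?thesis by (simp add: m_def)
qed

text \<open>Below radius \<eta>/2 a ball holds at most one separated point, which is why
  \<open>entropy\<close> is asked only above it. The factor 1/8 is the share that
  \<open>geometric_step\<close> can pay for, so the contributions of all scales telescope to m ln (1
  + t^2/\<sigma>^2).\<close>

lemma card_separated_le:
  fixes \<sigma> \<eta> c m t :: real
  assumes "0 < \<sigma>" "0 < \<eta>" "2 \<le> c" "0 \<le> m"
    and entropy: "\<And>t \<nu> S. \<eta> / 2 < t \<Longrightarrow> \<nu> \<in> K \<Longrightarrow> finite S \<Longrightarrow> S \<noteq> {} \<Longrightarrow>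
      S \<subseteq> {x. vdist n x \<nu> \<le> t} \<inter> K \<Longrightarrow> separated n (t / c) S \<Longrightarrow> ln (card S) \<le> m * min (t\<^sup>2 / \<sigma>\<^sup>2) 1 / 8"
    and "\<nu> \<in> K" "finite S" "S \<subseteq> {x. vdist n x \<nu> \<le> t} \<inter> K" "separated n \<eta> S" "0 \<le> t"
  shows "real (card S) \<le> (1 + t\<^sup>2 / \<sigma>\<^sup>2) powr m"
proof -
  have base: "real (card S) \<le> (1 + t\<^sup>2 / \<sigma>\<^sup>2) powr m"
    if "t \<le> \<eta> / 2" "\<nu> \<in> K" "finite S" "S \<subseteq> {x. vdist n x \<nu> \<le> t} \<inter> K" "separated n \<eta> S" for \<nu> S and t :: real
  proof -
    have "x = y" if xy: "x \<in> S" "y \<in> S" for x y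
    proof (rule ccontr)
      assume "x \<noteq> y"
      have "vdist n x \<nu> \<le> t" "vdist n y \<nu> \<le> t" using xy \<open>S \<subseteq> _\<close> by auto
      then have "vdist n x y \<le> \<eta>"
        using vdist_triangle[of n x y \<nu>] \<open>t \<le> \<eta> / 2\<close> by (simp add: vdist_commute[of n \<nu> y])
      moreover have "vdist n x y > \<eta>"
        using \<open>separated n \<eta> S\<close> xy \<open>x \<noteq> y\<close> unfolding separated_def by blast
      ultimately show False by simp
    qed
    then have "card S \<le> 1" using \<open>finite S\<close> by (auto intro!: card_le_Suc0_iff_eq[THEN iffD2])
    moreover have "1 \<le> (1 + t\<^sup>2 / \<sigma>\<^sup>2) powr m" using assms by (intro ge_one_powr_ge_zero) auto
    ultimately show ?thesis by linarith
  qed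
  \<comment> \<open>Here \<open>j\<close> bounds the number of divisions by \<open>c\<close> that
    bring \<open>t\<close> down to \<eta>/2.\<close>
  have "real (card S) \<le> (1 + t\<^sup>2 / \<sigma>\<^sup>2) powr m"
    if "t \<le> c ^ j * (\<eta> / 2)" "\<nu> \<in> K" "finite S" "S \<subseteq> {x. vdist n x \<nu> \<le> t} \<inter> K" "separated n \<eta> S" for j \<nu> S t
    using that
  proof (induction j arbitrary: \<nu> S t)
    case 0
    then show ?case using base by simp
  next
    case (Suc j)
    show ?case
    proof (cases "t \<le> \<eta> / 2 \<or> S = {}")
      case True
      then show ?thesis using base Suc.prems by auto
    next
      case False
      then have t: "\<eta> / 2 < t" "0 < t" and S: "S \<noteq> {}" using assms by auto
      \<comment> \<open>The covering centres are taken inside \<open>S\<close>, hence inside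
        \<open>K\<close>, so that the induction hypothesis applies around each of them.\<close>
      obtain P where P: "finite P" "P \<subseteq> S" "separated n (t / c) P" "\<And>x. x \<in> S \<Longrightarrow> \<exists>p\<in>P. vdist n x p \<le> t / c"
        by (rule maximal_separated_exists[of S n "t / c" "card S"])
          (use Suc.prems t assms in \<open>auto intro: card_mono\<close>)
      have "P \<noteq> {}" using P(4) S by blast
      define B where "B p = {x. vdist n x p \<le> t / c} \<inter> S" for p
      have "S \<subseteq> (\<Union>p\<in>P. B p)" using P(4) unfolding B_def by blast
      then have "card S \<le> card (\<Union>p\<in>P. B p)"
        using P(1) Suc.prems by (intro card_mono) (auto simp: B_def)
      also have "\<dots> \<le> (\<Sum>p\<in>P. card (B p))" by (rule card_UN_le[OF P(1)])
      finally have "real (card S) \<le> (\<Sum>p\<in>P. real (card (B p)))"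
        by (simp flip: of_nat_sum)
      also have "\<dots> \<le> (\<Sum>p\<in>P. (1 + (t / c)\<^sup>2 / \<sigma>\<^sup>2) powr m)"
      proof (intro sum_mono Suc.IH)
        fix p assume p: "p \<in> P"
        show "t / c \<le> c ^ j * (\<eta> / 2)" using Suc.prems assms by (simp add: field_simps)
        show "p \<in> K" using p P Suc.prems by auto
        show "finite (B p)" "B p \<subseteq> {x. vdist n x p \<le> t / c} \<inter> K" "separated n \<eta> (B p)"
          using Suc.prems by (auto simp: B_def separated_def)
      qed
      also have "\<dots> = real (card P) * (1 + t\<^sup>2 / \<sigma>\<^sup>2 / c\<^sup>2) powr m"
        by (simp add: power_divide mult.commute)
      also have "\<dots> \<le> exp (min (t\<^sup>2 / \<sigma>\<^sup>2) 1 / 8) powr m * (1 + t\<^sup>2 / \<sigma>\<^sup>2 / c\<^sup>2) powr m"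
      proof (intro mult_right_mono)
        have "ln (real (card P)) \<le> m * min (t\<^sup>2 / \<sigma>\<^sup>2) 1 / 8"
          by (rule entropy[OF t(1) Suc.prems(2) P(1) \<open>P \<noteq> {}\<close> _ P(3)]) (use P(2) Suc.prems(4) in blast)
        then have "exp (ln (real (card P))) \<le> exp (m * min (t\<^sup>2 / \<sigma>\<^sup>2) 1 / 8)" by (subst exp_le_cancel_iff)
        moreover have "0 < card P" using P \<open>P \<noteq> {}\<close> by (simp add: card_gt_0_iff)
        ultimately show "real (card P) \<le> exp (min (t\<^sup>2 / \<sigma>\<^sup>2) 1 / 8) powr m"
          by (simp add: powr_def)
      qed simp
      also have "\<dots> = (exp (min (t\<^sup>2 / \<sigma>\<^sup>2) 1 / 8) * (1 + t\<^sup>2 / \<sigma>\<^sup>2 / c\<^sup>2)) powr m"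
        by (subst powr_mult) auto
      also have "\<dots> \<le> (1 + t\<^sup>2 / \<sigma>\<^sup>2) powr m"
        using assms by (intro powr_mono2 geometric_step mult_nonneg_nonneg) auto
      finally show ?thesis .
    qed
  qed
  moreover obtain j where "t / (\<eta> / 2) < c ^ j"
    using real_arch_pow[of c "t / (\<eta> / 2)"] assms by auto
  then have "t \<le> c ^ j * (\<eta> / 2)" using assms by (simp add: field_simps)
  ultimately show ?thesis using assms by blast
qed

section \<open>Summation over geometric shells\<close>

lemma Bernoulli_powr:
  fixes x a :: real
  assumes "0 \<le> x" "1 \<le> a"
  shows "1 + a * x \<le> (1 + x) powr a"
proof -
  \<comment> \<open>Concavity of \<open>ln\<close> on the segment from 1 to 1 + a x, where 1 + x is
    the mean with weight 1/a on the far end.\<close>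
  have "(1 / a) * ln (1 + a * x) + (1 - 1 / a) * ln 1 \<le> ln ((1 / a) *\<^sub>R (1 + a * x) + (1 - 1 / a) *\<^sub>R 1)"
    by (rule ln_concave[unfolded concave_on_iff, THEN conjunct2, rule_format])
      (use assms in \<open>auto intro: add_pos_nonneg\<close>)
  also have "(1 / a) *\<^sub>R (1 + a * x) + (1 - 1 / a) *\<^sub>R 1 = 1 + x"
    using assms by (simp add: field_simps)
  finally have "ln (1 + a * x) \<le> a * ln (1 + x)"
    using assms by (simp add: field_simps)
  then have "exp (ln (1 + a * x)) \<le> exp (a * ln (1 + x))" by (subst exp_le_cancel_iff)
  moreover have "0 < 1 + a * x" using assms by (auto intro: add_pos_nonneg)
  ultimately show ?thesis
    using assms by (simp add: powr_def)
qed

lemma sum_UN_le: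
  fixes w :: "'a \<Rightarrow> real"
  assumes "finite I" "\<And>i. i \<in> I \<Longrightarrow> finite (H i)" "\<And>x. 0 \<le> w x"
  shows "(\<Sum>x\<in>(\<Union>i\<in>I. H i). w x) \<le> (\<Sum>i\<in>I. \<Sum>x\<in>H i. w x)"
  using assms
proof (induction I rule: finite_induct)
  case (insert i I)
  have "(\<Sum>x\<in>(\<Union>i\<in>insert i I. H i). w x)
      = (\<Sum>x\<in>H i. w x) + (\<Sum>x\<in>(\<Union>i\<in>I. H i). w x) - (\<Sum>x\<in>H i \<inter> (\<Union>i\<in>I. H i). w x)"
    using insert by (simp add: sum_Un)
  moreover have "0 \<le> (\<Sum>x\<in>H i \<inter> (\<Union>i\<in>I. H i). w x)"
    using insert by (intro sum_nonneg)
  ultimately show ?case using insert by simp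
qed simp

text \<open>The sum is cut into the shells \<open>c ^ j * \<eta> \<le> T < c ^ (j + 1) * \<eta>\<close>; on a shell, Bernoulli's
  inequality turns the count at the outer radius into a power at the inner one.\<close>

lemma shell_sum_le:
  fixes \<sigma> \<eta> c m \<kappa> :: real
  assumes "0 < \<sigma>" "0 < \<eta>" "2 \<le> c" "0 \<le> m" "finite G" "\<nu> \<in> G" "4 \<le> \<kappa>" "2 * c\<^sup>2 * m \<le> \<kappa>" "\<sigma>\<^sup>2 / \<kappa> \<le> J * \<eta>\<^sup>2"
    and count: "\<And>t. 0 \<le> t \<Longrightarrow> real (card {x\<in>G. vdist n x \<nu> \<le> t}) \<le> (1 + t\<^sup>2 / \<sigma>\<^sup>2) powr m"
  shows "(\<Sum>x\<in>{x\<in>G. c * \<eta> \<le> vdist n x \<nu>}. (vdist n x \<nu>)\<^sup>2 * (1 + (vdist n x \<nu>)\<^sup>2 / \<sigma>\<^sup>2) powr (-\<kappa>))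
    \<le> 32 * c\<^sup>2 * J\<^sup>2 * \<eta>\<^sup>2"
proof -
  define T where "T x = vdist n x \<nu>" for x
  define w where "w x = (T x)\<^sup>2 * (1 + (T x)\<^sup>2 / \<sigma>\<^sup>2) powr (-\<kappa>)" for x
  define t where "t j = c ^ j * \<eta>" for j :: nat
  define H where "H j = {x\<in>G. t j \<le> T x \<and> T x < t (Suc j)}" for j
  have t0: "0 < t j" for j using assms by (simp add: t_def)
  have shell: "(\<Sum>x\<in>H j. w x) \<le> 16 * c\<^sup>2 * J\<^sup>2 * \<eta>\<^sup>2 * (1 / 2) ^ j" for j
  proof -
    define u where "u = (t j)\<^sup>2 / \<sigma>\<^sup>2"
    have u: "0 < u" using t0[of j] assms(1) unfolding u_def by (intro divide_pos_pos zero_less_power)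
    have w: "w x \<le> (c * t j)\<^sup>2 * (1 + u) powr (-\<kappa>)" if "x \<in> H j" for x
      unfolding w_def
    proof (intro mult_mono power_mono)
      have "(t j)\<^sup>2 \<le> (T x)\<^sup>2" using that t0[of j] by (intro power_mono) (auto simp: H_def)
      then have "u \<le> (T x)\<^sup>2 / \<sigma>\<^sup>2" unfolding u_def using assms by (intro divide_right_mono) auto
      then show "(1 + (T x)\<^sup>2 / \<sigma>\<^sup>2) powr (-\<kappa>) \<le> (1 + u) powr (-\<kappa>)"
        using u assms by (intro powr_mono2') auto
    qed (use that t0[of j] in \<open>auto simp: H_def t_def T_def\<close>)
    have "H j \<subseteq> {x\<in>G. vdist n x \<nu> \<le> t (Suc j)}" by (auto simp: H_def T_def)
    then have "card (H j) \<le> card {x\<in>G. vdist n x \<nu> \<le> t (Suc j)}"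
      using assms by (intro card_mono) auto
    then have "real (card (H j)) \<le> real (card {x\<in>G. vdist n x \<nu> \<le> t (Suc j)})"
      by (rule of_nat_mono)
    also have "\<dots> \<le> (1 + (t (Suc j))\<^sup>2 / \<sigma>\<^sup>2) powr m"
      using t0[of "Suc j"] by (intro count) auto
    also have "1 + (t (Suc j))\<^sup>2 / \<sigma>\<^sup>2 = 1 + c\<^sup>2 * u"
      by (simp add: t_def u_def power_mult_distrib)
    \<comment> \<open>The count costs the exponent c^2 m, at most \<kappa>/2; the other half of the
      failure exponent is left for summability.\<close>
    also have "(1 + c\<^sup>2 * u) powr m \<le> ((1 + u) powr c\<^sup>2) powr m"
    proof (intro powr_mono2)
      have "1 \<le> c\<^sup>2" using assms by (intro one_le_power) auto
      then show "1 + c\<^sup>2 * u \<le> (1 + u) powr c\<^sup>2"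
        using Bernoulli_powr[of u "c\<^sup>2"] u by (simp add: algebra_simps)
    qed (use assms u in auto)
    also have "\<dots> \<le> (1 + u) powr (\<kappa> / 2)"
      unfolding powr_powr using u assms by (intro powr_mono) auto
    finally have card: "real (card (H j)) \<le> (1 + u) powr (\<kappa> / 2)" .
    have "(\<Sum>x\<in>H j. w x) \<le> real (card (H j)) * ((c * t j)\<^sup>2 * (1 + u) powr (-\<kappa>))"
      using w by (rule sum_bounded_above)
    also have "\<dots> \<le> (1 + u) powr (\<kappa> / 2) * ((c * t j)\<^sup>2 * (1 + u) powr (-\<kappa>))"
      using card by (intro mult_right_mono) auto
    also have "\<dots> = (c * t j)\<^sup>2 * (1 + u) powr (- (\<kappa> / 2))"
      by (simp add: powr_add[symmetric])
    \<comment> \<open>Bernoulli with exponent \<kappa>/4, hence the hypothesis 4 \<le> \<kappa>,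
      then squared: the decay of order u^(-2), that is t^(-4), beats the factor t^2 and leaves a
      geometric series in \<open>j\<close>.\<close>
    also have "\<dots> \<le> (c * t j)\<^sup>2 * (16 / (\<kappa>\<^sup>2 * u\<^sup>2))"
    proof (intro mult_left_mono)
      have "1 + (\<kappa> / 4) * u \<le> (1 + u) powr (\<kappa> / 4)"
        using Bernoulli_powr[of u "\<kappa> / 4"] u assms by (simp add: algebra_simps)
      then have "(\<kappa> / 4 * u)\<^sup>2 \<le> ((1 + u) powr (\<kappa> / 4))\<^sup>2"
        using u assms by (intro power_mono) (auto simp: algebra_simps)
      also have "\<dots> = (1 + u) powr (\<kappa> / 2)"
        using u by (simp add: power2_eq_square powr_add[symmetric])
      finally have "inverse ((1 + u) powr (\<kappa> / 2)) \<le> inverse ((\<kappa> / 4 * u)\<^sup>2)"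
        using u assms by (intro le_imp_inverse_le) auto
      then show "(1 + u) powr (- (\<kappa> / 2)) \<le> 16 / (\<kappa>\<^sup>2 * u\<^sup>2)"
        by (simp add: powr_minus field_simps power2_eq_square)
    qed simp
    also have "\<dots> = 16 * c\<^sup>2 * (\<sigma>\<^sup>2 / \<kappa>)\<^sup>2 / (t j)\<^sup>2"
      using t0[of j] assms by (simp add: u_def field_simps power2_eq_square)
    also have "\<dots> \<le> 16 * c\<^sup>2 * (J * \<eta>\<^sup>2)\<^sup>2 / (t j)\<^sup>2"
      using assms by (intro divide_right_mono mult_left_mono power_mono) auto
    also have "\<dots> = 16 * c\<^sup>2 * J\<^sup>2 * \<eta>\<^sup>2 * (1 / (c\<^sup>2) ^ j)"
      using assms by (simp add: t_def field_simps power2_eq_square power_mult_distrib)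
    also have "\<dots> \<le> 16 * c\<^sup>2 * J\<^sup>2 * \<eta>\<^sup>2 * (1 / 2 ^ j)"
    proof (intro mult_left_mono divide_left_mono power_mono)
      have "2 * 1 \<le> c * c" using assms by (intro mult_mono) auto
      then show "2 \<le> c\<^sup>2" by (simp add: power2_eq_square)
    qed (use assms in auto)
    finally show ?thesis by (simp add: power_divide)
  qed
  \<comment> \<open>The net is finite, so finitely many shells cover it and no infinite series is
    needed.\<close>
  define B where "B = Max (T ` G) + 1"
  have B: "T x < B" if "x \<in> G" for x
    unfolding B_def using that \<open>finite G\<close> by (intro le_less_trans[OF Max_ge less_add_one]) auto
  obtain j0 where j0: "B / \<eta> < c ^ j0" using real_arch_pow[of c "B / \<eta>"] assms by auto
  have cover: "{x\<in>G. c * \<eta> \<le> T x} \<subseteq> (\<Union>j\<in>{..<j0}. H j)"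
  proof
    fix x assume x: "x \<in> {x\<in>G. c * \<eta> \<le> T x}"
    \<comment> \<open>The shell is the one just below the first radius exceeding \<open>T x\<close>;
      that index is not 0 because \<open>T x\<close> is at least c \<eta>.\<close>
    define j where "j = (LEAST j. T x < t j)"
    have "T x < t j0" using B x j0 assms by (force simp: t_def field_simps)
    then have j: "T x < t j" "j \<le> j0" unfolding j_def by (auto intro: LeastI Least_le)
    have "j \<noteq> 0" using j x assms by (intro notI) (auto simp: t_def mult_less_cancel_right1 dest!: le_less_trans)
    then obtain i where i: "j = Suc i" by (cases j) auto
    then have "\<not> T x < t i" unfolding j_def using not_less_Least lessI by metis
    then show "x \<in> (\<Union>j\<in>{..<j0}. H j)" using x j i by (intro UN_I[of i]) (auto simp: H_def not_less)
  qed
  have "(\<Sum>x\<in>{x\<in>G. c * \<eta> \<le> T x}. w x) \<le> (\<Sum>x\<in>(\<Union>j\<in>{..<j0}. H j). w x)"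
    using cover assms by (intro sum_mono2) (auto simp: H_def w_def)
  also have "\<dots> \<le> (\<Sum>j<j0. \<Sum>x\<in>H j. w x)"
    using assms by (intro sum_UN_le) (auto simp: H_def w_def)
  also have "\<dots> \<le> (\<Sum>j<j0. 16 * c\<^sup>2 * J\<^sup>2 * \<eta>\<^sup>2 * (1 / 2) ^ j)"
    by (intro sum_mono shell)
  also have "\<dots> = 16 * c\<^sup>2 * J\<^sup>2 * \<eta>\<^sup>2 * (\<Sum>j<j0. (1 / 2) ^ j)"
    by (simp add: sum_distrib_left)
  also have "\<dots> \<le> 16 * c\<^sup>2 * J\<^sup>2 * \<eta>\<^sup>2 * 2"
  proof (intro mult_left_mono)
    have "(\<Sum>j<j0. (1 / 2 :: real) ^ j) = 2 * (1 - (1 / 2) ^ j0)" by (subst sum_gp_strict) simp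
    also have "\<dots> \<le> 2" by simp
    finally show "(\<Sum>j<j0. (1 / 2 :: real) ^ j) \<le> 2" .
  qed simp
  finally show ?thesis by (simp add: w_def T_def)
qed

section \<open>Pairwise tests\<close>

text \<open>Below \<open>20 \<sigma>\<close> the clipped linear score gives the exponent \<open>T\<^sup>2/\<sigma>\<^sup>2\<close>; beyond, only a sign test with
  logarithmically growing weight makes the failure probability decay polynomially in \<open>T\<close>.\<close>

definition score_bound :: "real \<Rightarrow> real \<Rightarrow> real" where
  "score_bound \<sigma> T = (if T < 20 * \<sigma> then 1 else ln (T\<^sup>2 / (16 * \<sigma>\<^sup>2)) / 2)"

definition score :: "real \<Rightarrow> real \<Rightarrow> real \<Rightarrow> real" where
  "score \<sigma> T z = (if T < 20 * \<sigma> then max (- 1) (min 1 (z / (6416 * \<sigma>\<^sup>2))) else score_bound \<sigma> T * sgn z)"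

lemma score_minus: "score \<sigma> T (- z) = - score \<sigma> T z"
  by (auto simp: score_def sgn_minus max_def min_def)

lemma score_measurable [measurable]: "score \<sigma> T \<in> borel_measurable borel"
  unfolding score_def[abs_def] by measurable

lemma far_ratio_ge:
  fixes \<sigma> T :: real
  assumes "0 < \<sigma>" "20 * \<sigma> \<le> T"
  shows "25 \<le> T\<^sup>2 / (16 * \<sigma>\<^sup>2)"
proof -
  have "(20 * \<sigma>)\<^sup>2 \<le> T\<^sup>2" using assms by (intro power_mono) auto
  then show ?thesis using assms by (simp add: field_simps power_mult_distrib)
qed

lemma score_bound_nonneg:
  assumes "0 < \<sigma>"
  shows "0 \<le> score_bound \<sigma> T"
  using far_ratio_ge[OF assms, of T] by (auto simp: score_bound_def not_less)

lemma abs_score_le: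
  assumes "0 < \<sigma>"
  shows "\<bar>score \<sigma> T z\<bar> \<le> score_bound \<sigma> T"
  using score_bound_nonneg[OF assms, of T]
  by (auto simp: score_def score_bound_def abs_mult sgn_if)

text \<open>Bound on the exponential moment of one score. Near, 51328 = 8 * 6416: of the drift
  T^2/(4 L) with L = 6416 \<sigma>^2, half survives the quadratic term. Far, a correct sign and
  Chebyshev's bound for a wrong sign contribute 4 \<sigma> / T each.\<close>

definition mgf_bound :: "real \<Rightarrow> real \<Rightarrow> real" where
  "mgf_bound \<sigma> T = (if T < 20 * \<sigma> then exp (- (T\<^sup>2 / (51328 * \<sigma>\<^sup>2))) else 8 * \<sigma> / T)"

text \<open>The majorants are quadratic in \<open>z\<close>, so second moments suffice to integrate
  them. The far case is Chebyshev in pointwise form: a nonnegative \<open>z\<close> is at least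
  T^2/4 away from \<open>m\<close>. With weight ln w the two errors are 1/w and 16 w \<sigma>^2/T^2,
  balanced at w = T / (4 \<sigma>).\<close>

lemma exp_score_le:
  fixes \<sigma> T z m :: real
  assumes "0 < \<sigma>" "0 < T" "m \<le> - (T\<^sup>2 / 4)"
  shows "exp (score \<sigma> T z) \<le> (if T < 20 * \<sigma> then 1 + z / (6416 * \<sigma>\<^sup>2) + 2 * z\<^sup>2 / (6416 * \<sigma>\<^sup>2)\<^sup>2
    else 4 * \<sigma> / T + 4 / (\<sigma> * T ^ 3) * (z - m)\<^sup>2)"
proof (cases "T < 20 * \<sigma>")
  case True
  define y where "y = z / (6416 * \<sigma>\<^sup>2)"
  define w where "w = max (- 1) (min 1 y)"
  have w1: "exp w \<le> 1 + w + w\<^sup>2" by (rule exp_le_quadratic) (auto simp: w_def)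
  \<comment> \<open>Clipping from below raises the value; a second y^2 pays for that, whence the
    factor 2 in the majorant.\<close>
  have w2: "w \<le> y + y\<^sup>2"
  proof (cases "y < - 1")
    case True
    have "0 \<le> (y + 1)\<^sup>2" "w = - 1" using True by (auto simp: w_def)
    then show ?thesis using True unfolding power2_sum by simp
  qed (auto simp: w_def min_def max_def intro: add_increasing2)
  have "w\<^sup>2 \<le> y\<^sup>2" by (simp add: w_def abs_le_square_iff[symmetric])
  then have "exp w \<le> 1 + y + 2 * y\<^sup>2" using w1 w2 by simp
  then show ?thesis using True by (simp add: score_def w_def y_def power_divide)
next
  case False
  then have "20 * \<sigma> \<le> T" by simp
  note far = far_ratio_ge[OF assms(1) this]
  have "T\<^sup>2 / (16 * \<sigma>\<^sup>2) = (T / (4 * \<sigma>))\<^sup>2" by (simp add: power_divide power_mult_distrib)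
  then have a: "score_bound \<sigma> T = ln (T / (4 * \<sigma>))"
    using False assms by (simp add: score_bound_def ln_realpow)
  have pos: "0 < T / (4 * \<sigma>)" using assms by simp
  have "1 \<le> T / (4 * \<sigma>)" using \<open>20 * \<sigma> \<le> T\<close> assms by (simp add: field_simps)
  show ?thesis
  proof (cases "z < 0")
    case True
    then have "exp (score \<sigma> T z) = 4 * \<sigma> / T"
      using False assms pos by (simp add: score_def a exp_minus)
    then show ?thesis using False assms by simp
  next
    case z: False
    have "exp (score \<sigma> T z) \<le> exp (ln (T / (4 * \<sigma>)))"
      using abs_score_le[OF assms(1), of T z] by (simp add: a)
    also have "\<dots> = T / (4 * \<sigma>)" using pos by simp
    also have "\<dots> = 4 / (\<sigma> * T ^ 3) * (T\<^sup>2 / 4)\<^sup>2"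
      using assms by (simp add: field_simps power2_eq_square power3_eq_cube)
    also have "\<dots> \<le> 4 / (\<sigma> * T ^ 3) * (z - m)\<^sup>2"
      using z assms by (intro mult_left_mono power_mono) auto
    also have "\<dots> \<le> 4 * \<sigma> / T + \<dots>" using assms by simp
    finally show ?thesis using False by simp
  qed
qed

lemma (in prob_space) nn_integral_exp_score_le:
  fixes \<sigma> T m :: real
  assumes "0 < \<sigma>" "0 < T" "m \<le> - (T\<^sup>2 / 4)" "- (T\<^sup>2) \<le> m"
    and int: "integrable M Y" "integrable M (\<lambda>x. (Y x)\<^sup>2)"
    and mean: "(\<integral>x. Y x \<partial>M) = 0" and var: "(\<integral>x. (Y x)\<^sup>2 \<partial>M) \<le> \<sigma>\<^sup>2 * T\<^sup>2"
  shows "(\<integral>\<^sup>+x. ennreal (exp (score \<sigma> T (Y x + m))) \<partial>M) \<le> ennreal (mgf_bound \<sigma> T)"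
proof -
  define q where "q y = (if T < 20 * \<sigma> then 1 + (y + m) / (6416 * \<sigma>\<^sup>2) + 2 * (y + m)\<^sup>2 / (6416 * \<sigma>\<^sup>2)\<^sup>2
    else 4 * \<sigma> / T + 4 / (\<sigma> * T ^ 3) * y\<^sup>2)" for y
  have le: "exp (score \<sigma> T (y + m)) \<le> q y" for y
    using exp_score_le[OF assms(1-3), of "y + m"] unfolding q_def add_diff_cancel_right' .
  have sq: "integrable M (\<lambda>x. (Y x + m)\<^sup>2)"
    using int by (simp add: power2_sum)
  have "(\<integral>x. (Y x + m)\<^sup>2 \<partial>M) = (\<integral>x. (Y x)\<^sup>2 \<partial>M) + m\<^sup>2"
    using int mean by (simp add: power2_sum prob_space)
  also have "m\<^sup>2 \<le> (T\<^sup>2)\<^sup>2" using assms by (intro power2_le_iff_abs_le[THEN iffD2]) auto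
  finally have sq_le: "(\<integral>x. (Y x + m)\<^sup>2 \<partial>M) \<le> \<sigma>\<^sup>2 * T\<^sup>2 + (T\<^sup>2)\<^sup>2" using var by simp
  have intq: "integrable M (\<lambda>x. q (Y x))"
    unfolding q_def using int sq by (cases "T < 20 * \<sigma>") auto
  have "(\<integral>\<^sup>+x. ennreal (exp (score \<sigma> T (Y x + m))) \<partial>M) \<le> (\<integral>\<^sup>+x. ennreal (q (Y x)) \<partial>M)"
    using le by (intro nn_integral_mono ennreal_leI)
  also have "\<dots> = ennreal (\<integral>x. q (Y x) \<partial>M)"
    using intq le by (intro nn_integral_eq_integral AE_I2) (auto intro: order_trans[OF exp_ge_zero])
  also have "\<dots> \<le> ennreal (mgf_bound \<sigma> T)"
  proof (intro ennreal_leI)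
    show "(\<integral>x. q (Y x) \<partial>M) \<le> mgf_bound \<sigma> T"
    proof (cases "T < 20 * \<sigma>")
      case True
      \<comment> \<open>The second moment is at most \<sigma>^2 T^2 + T^4, hence at most 401
        \<sigma>^2 T^2 when T < 20 \<sigma>. The scale L solves 802 \<sigma>^2 / L = 1/8, which
        makes the quadratic term half the size of the drift.\<close>
      define L where "L = 6416 * \<sigma>\<^sup>2"
      have L: "0 < L" using assms by (simp add: L_def)
      have "T\<^sup>2 \<le> (20 * \<sigma>)\<^sup>2" using True assms by (intro power_mono) auto
      then have "T\<^sup>2 * T\<^sup>2 \<le> (400 * \<sigma>\<^sup>2) * T\<^sup>2" by (intro mult_right_mono) (auto simp: power_mult_distrib)
      then have sq_le': "(\<integral>x. (Y x + m)\<^sup>2 \<partial>M) \<le> 401 * \<sigma>\<^sup>2 * T\<^sup>2"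
        using sq_le by (simp add: power2_eq_square)
      have "(\<integral>x. q (Y x) \<partial>M) = 1 + m / L + 2 * (\<integral>x. (Y x + m)\<^sup>2 \<partial>M) / L\<^sup>2"
        using True int sq mean by (simp add: q_def L_def prob_space add_divide_distrib)
      also have "\<dots> \<le> 1 + (- (T\<^sup>2 / 4)) / L + 2 * (401 * \<sigma>\<^sup>2 * T\<^sup>2) / L\<^sup>2"
        using sq_le' assms L by (intro add_mono divide_right_mono mult_left_mono) auto
      also have "2 * (401 * \<sigma>\<^sup>2 * T\<^sup>2) / L\<^sup>2 = T\<^sup>2 / (8 * L)"
        using assms by (simp add: L_def field_simps power2_eq_square)
      also have "1 + (- (T\<^sup>2 / 4)) / L + T\<^sup>2 / (8 * L) = 1 + (- (T\<^sup>2 / (8 * L)))"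
        using L by (simp add: field_simps)
      also have "\<dots> \<le> exp (- (T\<^sup>2 / (8 * L)))" by (rule exp_ge_add_one_self)
      finally show ?thesis using True by (simp add: mgf_bound_def L_def)
    next
      case False
      have "(\<integral>x. q (Y x) \<partial>M) = 4 * \<sigma> / T + 4 / (\<sigma> * T ^ 3) * (\<integral>x. (Y x)\<^sup>2 \<partial>M)"
        using False int by (simp add: q_def prob_space)
      also have "\<dots> \<le> 4 * \<sigma> / T + 4 / (\<sigma> * T ^ 3) * (\<sigma>\<^sup>2 * T\<^sup>2)"
        using var assms by (intro add_mono mult_left_mono) auto
      also have "\<dots> = 8 * \<sigma> / T"
        using assms by (simp add: field_simps power2_eq_square power3_eq_cube)
      finally show ?thesis using False by (simp add: mgf_bound_def)
    qed
  qed
  finally show ?thesis .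
qed

text \<open>Half of the near exponent 1/51328; the other half absorbs the corruption.\<close>

definition test_rate :: real where "test_rate = 1 / 102656"

text \<open>The first factor is the damage per observation by the adversary, the second the
  exponential moment. The level hypothesis is what lets the near regime, whose exponent vanishes
  with T, absorb the damage; in the far regime \<epsilon> \<le> 1/32 suffices.\<close>

lemma test_failure_rate:
  fixes \<sigma> T \<epsilon> :: real
  assumes "0 < \<sigma>" "0 < T" "0 \<le> \<epsilon>" "\<epsilon> \<le> 1 / 32" "2 * \<epsilon> * \<sigma>\<^sup>2 \<le> test_rate * T\<^sup>2"
  shows "exp (2 * \<epsilon> * score_bound \<sigma> T) * mgf_bound \<sigma> T \<le> (1 + T\<^sup>2 / \<sigma>\<^sup>2) powr (- test_rate)"
proof (cases "T < 20 * \<sigma>")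
  case True
  define x where "x = T\<^sup>2 / \<sigma>\<^sup>2"
  have x: "0 < x" using assms by (simp add: x_def)
  have e: "2 * \<epsilon> \<le> test_rate * x" using assms by (simp add: x_def field_simps)
  have "exp (2 * \<epsilon> * score_bound \<sigma> T) * mgf_bound \<sigma> T = exp (2 * \<epsilon> - 2 * test_rate * x)"
    using True by (simp add: score_bound_def mgf_bound_def exp_add[symmetric] test_rate_def x_def)
  also have "\<dots> \<le> exp (- test_rate * ln (1 + x))"
  proof -
    have "test_rate * ln (1 + x) \<le> test_rate * x"
      using x by (intro mult_left_mono ln_add_one_self_le_self) (auto simp: test_rate_def)
    then show ?thesis using e by simp
  qed
  finally show ?thesis using x by (simp add: powr_def x_def)
next
  case False
  define y where "y = T\<^sup>2 / (16 * \<sigma>\<^sup>2)"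
  have y: "25 \<le> y" unfolding y_def using False assms by (intro far_ratio_ge) auto
  have "y = (T / (4 * \<sigma>))\<^sup>2" by (simp add: y_def power_divide power_mult_distrib)
  then have "ln y = 2 * ln (T / (4 * \<sigma>))" using assms by (simp add: ln_realpow)
  then have "exp (- (ln y / 2)) = 4 * \<sigma> / T"
    using assms by (simp add: exp_minus)
  moreover have "exp (ln 2 - ln y / 2) = 2 * exp (- (ln y / 2))"
    using exp_add[of "ln 2" "- (ln y / 2)"] by simp
  ultimately have T: "8 * \<sigma> / T = exp (ln 2 - ln y / 2)"
    by simp
  \<comment> \<open>This comparison and the next fix the threshold 20 \<sigma>: it gives y \<ge> 25,
    enough for 2^4 \<le> y and for 1 + 16 y \<le> y^2.\<close>
  have "4 * ln 2 = ln (2 ^ 4 :: real)" by (subst ln_realpow) auto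
  also have "\<dots> \<le> ln y" using y by (subst ln_le_cancel_iff) auto
  finally have ln2: "ln 2 \<le> ln y / 4" by simp
  have "ln (1 + 16 * y) \<le> ln (y\<^sup>2)"
  proof (subst ln_le_cancel_iff)
    have "y * 25 \<le> y * y" using y by (intro mult_left_mono) auto
    then show "1 + 16 * y \<le> y\<^sup>2" using y unfolding power2_eq_square by linarith
  qed (use y in auto)
  then have ln1: "ln (1 + 16 * y) \<le> 2 * ln y" using y by (simp add: ln_realpow)
  have lny: "0 \<le> ln y" using y by simp
  \<comment> \<open>In units of ln y: 1/32 for corruption, 1/4 for the factor 2 and 1/8 for the
    target rate stay below the gain 1/2.\<close>
  have "\<epsilon> * ln y \<le> 1 / 32 * ln y" using assms lny by (intro mult_right_mono)
  moreover have "test_rate * ln (1 + 16 * y) \<le> 1 / 16 * (2 * ln y)"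
    using ln1 y by (intro mult_mono) (auto simp: test_rate_def)
  ultimately have "\<epsilon> * ln y + (ln 2 - ln y / 2) \<le> - test_rate * ln (1 + 16 * y)"
    using ln2 lny by simp
  then have "exp (\<epsilon> * ln y + (ln 2 - ln y / 2)) \<le> exp (- test_rate * ln (1 + 16 * y))"
    by (subst exp_le_cancel_iff)
  then show ?thesis
    using False y assms T by (simp add: score_bound_def mgf_bound_def exp_add powr_def y_def)
qed

text \<open>Positive exactly when \<open>x\<close> lies on the side of \<open>v\<close> of the bisecting hyperplane of \<open>u\<close> and \<open>v\<close>.\<close>

definition midpoint_stat :: "nat \<Rightarrow> (nat \<Rightarrow> real) \<Rightarrow> (nat \<Rightarrow> real) \<Rightarrow> (nat \<Rightarrow> real) \<Rightarrow> real" where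
  "midpoint_stat n u v x = (\<Sum>i<n. (v i - u i) * (x i - (u i + v i) / 2))"

lemma midpoint_stat_swap: "midpoint_stat n v u x = - midpoint_stat n u v x"
  unfolding midpoint_stat_def sum_negf[symmetric] by (intro sum.cong) (auto simp: field_simps)

lemma component_measurable [measurable]: "i < n \<Longrightarrow> (\<lambda>x. x i) \<in> borel_measurable (Rn n)"
  unfolding Rn_def by measurable

lemma midpoint_stat_measurable [measurable]: "midpoint_stat n u v \<in> borel_measurable (Rn n)"
  unfolding midpoint_stat_def[abs_def] by measurable

lemma vadd_measurable [measurable]: "vadd n \<mu> \<in> measurable (Rn n) (Rn n)"
proof -
  have "(\<lambda>x. \<lambda>i\<in>{..<n}. \<mu> i + x i) \<in> measurable (Rn n) (Pi\<^sub>M {..<n} (\<lambda>_. borel))"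
    by (intro measurable_restrict) measurable
  then show ?thesis by (simp add: Rn_def vadd_def[abs_def])
qed

lemma midpoint_stat_vadd: "midpoint_stat n u v (vadd n \<mu> x) = vinner n (\<lambda>i. v i - u i) x + midpoint_stat n u v \<mu>"
  unfolding midpoint_stat_def vinner_def sum.distrib[symmetric]
  by (intro sum.cong) (auto simp: vadd_def algebra_simps)

lemma midpoint_stat_eq:
  "midpoint_stat n u v \<mu> = vinner n (\<lambda>i. v i - u i) (\<lambda>i. \<mu> i - u i) - (vdist n v u)\<^sup>2 / 2"
  unfolding midpoint_stat_def vinner_def vdist_square sum_divide_distrib sum_subtractf[symmetric]
  by (intro sum.cong) (auto simp: algebra_simps power2_eq_square field_simps)

text \<open>By Cauchy-Schwarz, a mean within T/4 of \<open>u\<close> shifts the statistic by at most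
  T^2/4 from its value - T^2/2 at \<open>u\<close>.\<close>

lemma midpoint_stat_bounds:
  assumes "vdist n \<mu> u \<le> \<eta>" "4 * \<eta> \<le> vdist n v u"
  shows "midpoint_stat n u v \<mu> \<le> - ((vdist n v u)\<^sup>2 / 4)" "- ((vdist n v u)\<^sup>2) \<le> midpoint_stat n u v \<mu>"
proof -
  let ?T = "vdist n v u"
  have "\<bar>vinner n (\<lambda>i. v i - u i) (\<lambda>i. \<mu> i - u i)\<bar> \<le> ?T * vdist n \<mu> u"
    using vinner_vnorm_le by (simp add: vdist_def)
  also have "\<dots> \<le> ?T * (?T / 4)" using assms by (intro mult_left_mono) auto
  finally have "\<bar>vinner n (\<lambda>i. v i - u i) (\<lambda>i. \<mu> i - u i)\<bar> \<le> ?T\<^sup>2 / 4" by (simp add: power2_eq_square)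
  then show "midpoint_stat n u v \<mu> \<le> - (?T\<^sup>2 / 4)" "- (?T\<^sup>2) \<le> midpoint_stat n u v \<mu>"
    unfolding midpoint_stat_eq by linarith+
qed

text \<open>The covariance condition compares Bochner integrals, which default to 0 for
  non-integrable functions; integrability of the quadratic form is therefore derived from that of
  the squared coordinates.\<close>

lemma noise_classD:
  assumes "D \<in> noise_class n s"
  shows "prob_space D" "sets D = sets (Rn n)" "space D = space (Rn n)"
    "integrable D (vinner n v)" "integrable D (\<lambda>x. (vinner n v x)\<^sup>2)"
    "(\<integral>x. vinner n v x \<partial>D) = 0" "(\<integral>x. (vinner n v x)\<^sup>2 \<partial>D) \<le> s * vinner n v v"
proof -
  show "prob_space D" and sets [measurable_cong]: "sets D = sets (Rn n)"
    using assms by (auto simp: noise_class_def)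
  then show "space D = space (Rn n)" by (intro sets_eq_imp_space_eq)
  have int: "integrable D (\<lambda>x. x i)" "integrable D (\<lambda>x. (x i)\<^sup>2)" "(\<integral>x. x i \<partial>D) = 0" if "i < n" for i
    using assms that by (auto simp: noise_class_def)
  show "integrable D (vinner n v)" unfolding vinner_def[abs_def]
    using int by (intro Bochner_Integration.integrable_sum integrable_mult_right) auto
  show "(\<integral>x. vinner n v x \<partial>D) = 0" unfolding vinner_def
    using int by (subst Bochner_Integration.integral_sum) auto
  have "integrable D (\<lambda>x. x i * x j)" if "i < n" "j < n" for i j
  proof (rule Bochner_Integration.integrable_bound)
    show "integrable D (\<lambda>x. (x i)\<^sup>2 + (x j)\<^sup>2)" using int that by auto
    show "(\<lambda>x. x i * x j) \<in> borel_measurable D" using that by measurable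
    have "\<bar>a * b\<bar> \<le> a\<^sup>2 + b\<^sup>2" for a b :: real
      using sum_squares_bound[of "\<bar>a\<bar>" "\<bar>b\<bar>"] mult_nonneg_nonneg[of "\<bar>a\<bar>" "\<bar>b\<bar>"]
      unfolding abs_mult power2_abs by linarith
    then show "AE x in D. norm (x i * x j) \<le> norm ((x i)\<^sup>2 + (x j)\<^sup>2)" by simp
  qed
  then have "integrable D (\<lambda>x. \<Sum>i<n. \<Sum>j<n. (v i * v j) * (x i * x j))"
    by (intro Bochner_Integration.integrable_sum integrable_mult_right) auto
  then show "integrable D (\<lambda>x. (vinner n v x)\<^sup>2)"
    by (simp add: vinner_def power2_eq_square sum_product mult_ac)
  show "(\<integral>x. (vinner n v x)\<^sup>2 \<partial>D) \<le> s * vinner n v v"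
    using assms by (simp add: noise_class_def)
qed

section \<open>Tests on a corrupted sample\<close>

definition pair_stat :: "nat \<Rightarrow> nat \<Rightarrow> real \<Rightarrow> (nat \<Rightarrow> real) \<Rightarrow> (nat \<Rightarrow> real) \<Rightarrow> (nat \<Rightarrow> nat \<Rightarrow> real) \<Rightarrow> real" where
  "pair_stat n N \<sigma> u v X = (\<Sum>j<N. score \<sigma> (vdist n v u) (midpoint_stat n u v (X j)))"

lemma pair_stat_swap: "pair_stat n N \<sigma> v u X = - pair_stat n N \<sigma> u v X"
  by (simp add: pair_stat_def midpoint_stat_swap[of n v u] score_minus vdist_commute[of n u v] sum_negf)

lemma sample_component_measurable [measurable]: "j < N \<Longrightarrow> (\<lambda>X. X j) \<in> measurable (sample_space n N) (Rn n)"
  unfolding sample_space_def by measurable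

lemma pair_stat_measurable [measurable]: "pair_stat n N \<sigma> u v \<in> borel_measurable (sample_space n N)"
  unfolding pair_stat_def[abs_def] by measurable

lemma pair_stat_corrupted_le:
  assumes "C \<in> adversaries n N \<epsilon>" "X \<in> space (sample_space n N)" "0 < \<sigma>"
  shows "pair_stat n N \<sigma> u v (C X) \<le> pair_stat n N \<sigma> u v X + 2 * score_bound \<sigma> (vdist n v u) * (\<epsilon> * N)"
proof -
  define b where "b = score_bound \<sigma> (vdist n v u)"
  define f where "f x = score \<sigma> (vdist n v u) (midpoint_stat n u v x)" for x
  have b: "0 \<le> b" "\<bar>f x\<bar> \<le> b" for x
    using abs_score_le[OF assms(3)] score_bound_nonneg[OF assms(3)] by (auto simp: b_def f_def)
  have "(\<Sum>j<N. f (C X j) - f (X j)) \<le> (\<Sum>j<N. if C X j \<noteq> X j then 2 * b else 0)"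
  proof (intro sum_mono)
    fix j
    show "f (C X j) - f (X j) \<le> (if C X j \<noteq> X j then 2 * b else 0)"
      using b(2)[of "C X j"] b(2)[of "X j"] by (auto simp: abs_le_iff)
  qed
  also have "\<dots> = 2 * b * real (card {i\<in>{..<N}. C X i \<noteq> X i})"
    by (simp add: sum.If_cases Int_def)
  also have "\<dots> \<le> 2 * b * (\<epsilon> * N)"
    using assms b by (intro mult_left_mono) (auto simp: adversaries_def)
  finally show ?thesis by (simp add: pair_stat_def f_def b_def sum_subtractf)
qed

abbreviation shifted :: "nat \<Rightarrow> nat \<Rightarrow> (nat \<Rightarrow> real) \<Rightarrow> (nat \<Rightarrow> nat \<Rightarrow> real) \<Rightarrow> (nat \<Rightarrow> nat \<Rightarrow> real)" where
  "shifted n N \<mu> \<xi> \<equiv> (\<lambda>j\<in>{..<N}. vadd n \<mu> (\<xi> j))"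

lemma sets_noise_product:
  assumes "D \<in> noise_class n s"
  shows "sets (PiM {..<N} (\<lambda>_. D)) = sets (sample_space n N)"
  unfolding sample_space_def using noise_classD(2)[OF assms] by (intro sets_PiM_cong) auto

lemma shifted_measurable [measurable]: "shifted n N \<mu> \<in> measurable (sample_space n N) (sample_space n N)"
proof -
  have "(\<lambda>X. \<lambda>j\<in>{..<N}. vadd n \<mu> (X j)) \<in> measurable (sample_space n N) (PiM {..<N} (\<lambda>_. Rn n))"
    by (intro measurable_restrict) measurable
  then show ?thesis by (simp add: sample_space_def)
qed

text \<open>The event is widened by the largest possible damage, so it refers to the clean
  independent sample only and serves all adversaries at once, even those that inspect the whole
  sample. The bound is the exponential Markov inequality.\<close>

lemma pair_test_failure:
  fixes \<sigma> \<eta> \<epsilon> :: real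
  assumes D: "D \<in> noise_class n (\<sigma>\<^sup>2)" and "0 < \<sigma>" "0 \<le> \<epsilon>" "\<epsilon> \<le> 1 / 32" "0 < \<eta>"
    and near: "vdist n \<mu> u \<le> \<eta>" and far: "4 * \<eta> \<le> vdist n v u"
    and level: "2 * \<epsilon> * \<sigma>\<^sup>2 \<le> test_rate * (vdist n v u)\<^sup>2"
  shows "(\<integral>\<^sup>+\<xi>. indicator {X. 0 \<le> pair_stat n N \<sigma> u v X + 2 * score_bound \<sigma> (vdist n v u) * (\<epsilon> * N)}
      (shifted n N \<mu> \<xi>) \<partial>PiM {..<N} (\<lambda>_. D))
    \<le> ennreal ((1 + (vdist n v u)\<^sup>2 / \<sigma>\<^sup>2) powr (- (test_rate * N)))"
proof -
  interpret D: prob_space D by (rule noise_classD[OF D])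
  interpret P: product_prob_space "\<lambda>_::nat. D" by (rule product_prob_spaceI) (rule D.prob_space_axioms)
  note [measurable_cong] = noise_classD(2)[OF D]
  define T where "T = vdist n v u"
  define b where "b = score_bound \<sigma> T"
  define g where "g x = ennreal (exp (score \<sigma> T (midpoint_stat n u v (vadd n \<mu> x))))" for x
  have "(\<lambda>x. score \<sigma> T (midpoint_stat n u v (vadd n \<mu> x))) \<in> borel_measurable (Rn n)"
    by (intro measurable_compose[OF vadd_measurable] measurable_compose[OF midpoint_stat_measurable] score_measurable)
  then have "g \<in> borel_measurable (Rn n)" unfolding g_def[abs_def] by simp
  then have [measurable]: "g \<in> borel_measurable D"
    using noise_classD(2)[OF D] by (simp cong: measurable_cong_sets)
  have T: "0 < T" "0 \<le> T" using assms by (auto simp: T_def)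
  have "integral\<^sup>N D g \<le> ennreal (mgf_bound \<sigma> T)"
    unfolding g_def midpoint_stat_vadd
  proof (rule D.nn_integral_exp_score_le)
    show "midpoint_stat n u v \<mu> \<le> - (T\<^sup>2 / 4)" "- (T\<^sup>2) \<le> midpoint_stat n u v \<mu>"
      unfolding T_def by (rule midpoint_stat_bounds[OF near far])+
    have "vinner n (\<lambda>i. v i - u i) (\<lambda>i. v i - u i) = T\<^sup>2"
      unfolding T_def vdist_square by (simp add: vinner_def power2_eq_square)
    then show "(\<integral>x. (vinner n (\<lambda>i. v i - u i) x)\<^sup>2 \<partial>D) \<le> \<sigma>\<^sup>2 * T\<^sup>2"
      using noise_classD(7)[OF D, of "\<lambda>i. v i - u i"] by simp
  qed (use assms T noise_classD[OF D] in auto)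
  then have mgf: "integral\<^sup>N D g ^ N \<le> ennreal (mgf_bound \<sigma> T) ^ N"
    by (intro power_mono) auto
  have "(\<integral>\<^sup>+\<xi>. indicator {X. 0 \<le> pair_stat n N \<sigma> u v X + 2 * b * (\<epsilon> * N)} (shifted n N \<mu> \<xi>) \<partial>PiM {..<N} (\<lambda>_. D))
    \<le> (\<integral>\<^sup>+\<xi>. ennreal (exp (2 * b * (\<epsilon> * N))) * (\<Prod>j<N. g (\<xi> j)) \<partial>PiM {..<N} (\<lambda>_. D))"
  proof (intro nn_integral_mono)
    fix \<xi>
    have "ennreal (exp (2 * b * (\<epsilon> * N))) * (\<Prod>j<N. g (\<xi> j))
      = ennreal (exp (pair_stat n N \<sigma> u v (shifted n N \<mu> \<xi>) + 2 * b * (\<epsilon> * N)))"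
      by (simp add: g_def prod_ennreal exp_sum pair_stat_def T_def exp_add ennreal_mult' mult.commute)
    then show "indicator {X. 0 \<le> pair_stat n N \<sigma> u v X + 2 * b * (\<epsilon> * N)} (shifted n N \<mu> \<xi>)
      \<le> ennreal (exp (2 * b * (\<epsilon> * N))) * (\<Prod>j<N. g (\<xi> j))"
      by (auto simp: indicator_def)
  qed
  also have "\<dots> = ennreal (exp (2 * b * (\<epsilon> * N))) * (\<integral>\<^sup>+\<xi>. (\<Prod>j<N. g (\<xi> j)) \<partial>PiM {..<N} (\<lambda>_. D))"
    by (rule nn_integral_cmult) measurable
  also have "(\<integral>\<^sup>+\<xi>. (\<Prod>j<N. g (\<xi> j)) \<partial>PiM {..<N} (\<lambda>_. D)) = integral\<^sup>N D g ^ N"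
    by (subst P.product_nn_integral_prod) auto
  also have "ennreal (exp (2 * b * (\<epsilon> * N))) * integral\<^sup>N D g ^ N \<le> ennreal (exp (2 * b * (\<epsilon> * N))) * ennreal (mgf_bound \<sigma> T) ^ N"
    using mgf by (intro mult_left_mono) auto
  also have "\<dots> = ennreal ((exp (2 * \<epsilon> * b) * mgf_bound \<sigma> T) ^ N)"
    using assms T by (simp add: ennreal_power ennreal_mult' power_mult_distrib exp_of_nat_mult[symmetric] mgf_bound_def mult_ac)
  also have "\<dots> \<le> ennreal (((1 + T\<^sup>2 / \<sigma>\<^sup>2) powr (- test_rate)) ^ N)"
    unfolding b_def using assms T level
    by (intro ennreal_leI power_mono test_failure_rate) (auto simp: T_def mgf_bound_def)
  also have "((1 + T\<^sup>2 / \<sigma>\<^sup>2) powr (- test_rate)) ^ N = (1 + T\<^sup>2 / \<sigma>\<^sup>2) powr (- (test_rate * N))"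
  proof -
    have "0 < 1 + T\<^sup>2 / \<sigma>\<^sup>2" by (intro add_pos_nonneg) auto
    then show ?thesis by (simp add: powr_realpow[symmetric] powr_powr)
  qed
  finally show ?thesis unfolding T_def b_def .
qed

section \<open>The tournament estimator\<close>

locale tournament =
  fixes n N :: nat and \<sigma> :: real and G :: "(nat \<Rightarrow> real) set"
  assumes finite_G: "finite G" and G_nonempty: "G \<noteq> {}" and G_space: "G \<subseteq> space (Rn n)"
begin

text \<open>A pair \<open>(u, v)\<close> records that \<open>u\<close> does not beat
  \<open>v\<close>, since a positive \<open>pair_stat n N \<sigma> u v X\<close> favours
  \<open>v\<close>. Ties put both orders in.\<close>

definition undefeated :: "(nat \<Rightarrow> nat \<Rightarrow> real) \<Rightarrow> ((nat \<Rightarrow> real) \<times> (nat \<Rightarrow> real)) set" where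
  "undefeated X = {(u, v) \<in> G \<times> G. 0 \<le> pair_stat n N \<sigma> u v X}"

text \<open>The relation is an argument, rather than the sample, so that the estimator factors
  through finitely many outcomes. Inserting 0 makes \<open>Max\<close> meaningful for every
  \<open>U\<close>.\<close>

definition radius :: "((nat \<Rightarrow> real) \<times> (nat \<Rightarrow> real)) set \<Rightarrow> (nat \<Rightarrow> real) \<Rightarrow> real" where
  "radius U u = Max (insert 0 ((\<lambda>v. vdist n v u) ` {v \<in> G. (u, v) \<in> U}))"

definition winner :: "(nat \<Rightarrow> nat \<Rightarrow> real) \<Rightarrow> (nat \<Rightarrow> real)" where
  "winner X = arg_min_on (radius (undefeated X)) G"

lemma winner_in: "winner X \<in> G"
  and winner_min: "u \<in> G \<Longrightarrow> radius (undefeated X) (winner X) \<le> radius (undefeated X) u"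
  unfolding winner_def
  by (rule arg_min_if_finite(1)[OF finite_G G_nonempty] arg_min_least[OF finite_G G_nonempty])+

lemma radius_ge: "v \<in> G \<Longrightarrow> (u, v) \<in> U \<Longrightarrow> vdist n v u \<le> radius U u"
  unfolding radius_def using finite_G by (intro Max_ge) auto

text \<open>The sample enters only through \<open>undefeated\<close>, which takes finitely many
  values on measurable sets; whatever rule breaks ties in \<open>arg_min_on\<close> is then
  harmless.\<close>

lemma winner_measurable: "winner \<in> measurable (sample_space n N) (Rn n)"
proof -
  have "undefeated \<in> measurable (sample_space n N) (count_space (Pow (G \<times> G)))"
  proof (subst measurable_count_space_eq2)
    show "finite (Pow (G \<times> G))" using finite_G by simp
    have "undefeated -` {U} \<inter> space (sample_space n N) \<in> sets (sample_space n N)" if "U \<subseteq> G \<times> G" for U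
    proof -
      have eq: "undefeated -` {U} \<inter> space (sample_space n N) = {X \<in> space (sample_space n N).
          \<forall>p\<in>G \<times> G. p \<in> U \<longleftrightarrow> 0 \<le> pair_stat n N \<sigma> (fst p) (snd p) X}"
      proof -
        have *: "undefeated X = {p \<in> G \<times> G. 0 \<le> pair_stat n N \<sigma> (fst p) (snd p) X}" for X
          unfolding undefeated_def by (auto simp: case_prod_beta)
        have "undefeated X = U \<longleftrightarrow> (\<forall>p\<in>G \<times> G. p \<in> U \<longleftrightarrow> 0 \<le> pair_stat n N \<sigma> (fst p) (snd p) X)" for X
          unfolding * using that by blast
        then show ?thesis by auto
      qed
      have "{X \<in> space (sample_space n N). p \<in> U \<longleftrightarrow> 0 \<le> pair_stat n N \<sigma> (fst p) (snd p) X} \<in> sets (sample_space n N)" for p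
        by (cases "p \<in> U") (simp_all, measurable)
      then show ?thesis unfolding eq using finite_G by (intro sets.sets_Collect_finite_All) auto
    qed
    then show "undefeated \<in> space (sample_space n N) \<rightarrow> Pow (G \<times> G) \<and>
        (\<forall>U\<in>Pow (G \<times> G). undefeated -` {U} \<inter> space (sample_space n N) \<in> sets (sample_space n N))"
      by (auto simp: undefeated_def)
  qed
  moreover have "arg_min_on (radius U) G \<in> space (Rn n)" for U
    using arg_min_if_finite(1)[OF finite_G G_nonempty, of "radius U"] G_space by blast
  then have "(\<lambda>U. arg_min_on (radius U) G) \<in> measurable (count_space (Pow (G \<times> G))) (Rn n)"
    by simp
  ultimately show ?thesis unfolding winner_def[abs_def] by (rule measurable_compose)
qed

text \<open>Of two net points, at least one is undefeated by the other (antisymmetry of the score).\<close>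

lemma winner_near:
  assumes "u \<in> G"
  shows "vdist n (winner X) u \<le> radius (undefeated X) u"
proof (cases "(u, winner X) \<in> undefeated X")
  case True
  then show ?thesis by (intro radius_ge winner_in)
next
  case False
  then have "(winner X, u) \<in> undefeated X"
    using assms winner_in[of X] pair_stat_swap[of n N \<sigma> "winner X" u X] by (auto simp: undefeated_def)
  then have "vdist n u (winner X) \<le> radius (undefeated X) (winner X)" using assms by (intro radius_ge)
  also have "\<dots> \<le> radius (undefeated X) u" using assms by (rule winner_min)
  finally show ?thesis by (simp add: vdist_commute)
qed

text \<open>A maximum is bounded by a sum, as in a union bound, but weighted by squared distances,
  since an expected square is wanted. Competitors nearer than \<open>L\<close> cost at most L^2 and
  need no test.\<close>

lemma radius_square_le:
  assumes "0 \<le> L"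
  shows "(radius U u)\<^sup>2 \<le> L\<^sup>2 + (\<Sum>v\<in>{v\<in>G. L \<le> vdist n v u}. (vdist n v u)\<^sup>2 * indicator U (u, v))"
proof -
  have nonneg: "0 \<le> (\<Sum>v\<in>{v\<in>G. L \<le> vdist n v u}. (vdist n v u)\<^sup>2 * indicator U (u, v))"
    by (intro sum_nonneg) auto
  have "radius U u \<in> insert 0 ((\<lambda>v. vdist n v u) ` {v \<in> G. (u, v) \<in> U})"
    unfolding radius_def using finite_G by (intro Max_in) auto
  then consider "radius U u = 0" | v where "v \<in> G" "(u, v) \<in> U" "radius U u = vdist n v u" by auto
  then show ?thesis
  proof cases
    case 1
    then show ?thesis using nonneg by simp
  next
    case 2
    show ?thesis
    proof (cases "L \<le> vdist n v u")
      case True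
      then have "(vdist n v u)\<^sup>2 * indicator U (u, v) \<le> (\<Sum>v\<in>{v\<in>G. L \<le> vdist n v u}. (vdist n v u)\<^sup>2 * indicator U (u, v))"
        using 2 finite_G by (intro member_le_sum) auto
      then show ?thesis using 2 by (simp add: add_increasing)
    next
      case False
      then have "(vdist n v u)\<^sup>2 \<le> L\<^sup>2" by (intro power_mono) auto
      then show ?thesis using 2 nonneg by simp
    qed
  qed
qed

text \<open>The net point \<open>u\<close> near the mean stands in for it:
  \<open>winner_near\<close> bounds the error by the radius of \<open>u\<close>, which is large only
  if some far competitor survives against \<open>u\<close>.\<close>

lemma winner_risk:
  fixes \<eta> L \<epsilon> :: real
  assumes D: "D \<in> noise_class n (\<sigma>\<^sup>2)" and C: "C \<in> adversaries n N \<epsilon>"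
    and "0 < \<sigma>" "0 \<le> \<epsilon>" "\<epsilon> \<le> 1 / 32" "0 < \<eta>" "4 * \<eta> \<le> L"
    and level: "2 * \<epsilon> * \<sigma>\<^sup>2 \<le> test_rate * L\<^sup>2"
    and near: "vdist n \<mu> u \<le> \<eta>" and u: "u \<in> G"
  shows "(\<integral>\<^sup>+\<xi>. ennreal ((vdist n (winner (C (shifted n N \<mu> \<xi>))) \<mu>)\<^sup>2) \<partial>PiM {..<N} (\<lambda>_. D))
    \<le> ennreal (2 * \<eta>\<^sup>2 + 2 * L\<^sup>2 + 2 * (\<Sum>v\<in>{v\<in>G. L \<le> vdist n v u}.
        (vdist n v u)\<^sup>2 * (1 + (vdist n v u)\<^sup>2 / \<sigma>\<^sup>2) powr (- (test_rate * N))))"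
proof -
  define P where "P = PiM {..<N} (\<lambda>_. D)"
  define F where "F = {v\<in>G. L \<le> vdist n v u}"
  define A where "A v = {X. 0 \<le> pair_stat n N \<sigma> u v X + 2 * score_bound \<sigma> (vdist n v u) * (\<epsilon> * N)}" for v
  note [measurable_cong] = sets_noise_product[OF D, of N, folded P_def]
  have space_P: "space P = space (sample_space n N)"
    using sets_noise_product[OF D, of N] unfolding P_def by (rule sets_eq_imp_space_eq)
  interpret D: prob_space D by (rule noise_classD[OF D])
  interpret P: prob_space P unfolding P_def by (intro prob_space_PiM D.prob_space_axioms)
  have [measurable]: "(\<lambda>\<xi>. indicator (A v) (shifted n N \<mu> \<xi>) :: ennreal) \<in> borel_measurable P" for v
    unfolding A_def indicator_def mem_Collect_eq by measurable
  have pointwise: "(vdist n (winner (C (shifted n N \<mu> \<xi>))) \<mu>)\<^sup>2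
      \<le> 2 * \<eta>\<^sup>2 + 2 * L\<^sup>2 + 2 * (\<Sum>v\<in>F. (vdist n v u)\<^sup>2 * indicator (A v) (shifted n N \<mu> \<xi>))"
    if "\<xi> \<in> space P" for \<xi>
  proof -
    let ?X = "shifted n N \<mu> \<xi>"
    have X: "?X \<in> space (sample_space n N)"
      using measurable_space[OF shifted_measurable] that space_P by blast
    define w where "w = winner (C ?X)"
    have sub: "indicator (undefeated (C ?X)) (u, v) \<le> (indicator (A v) ?X :: real)" for v
      using pair_stat_corrupted_le[OF C X \<open>0 < \<sigma>\<close>, of u v] by (auto simp: undefeated_def A_def indicator_def)
    have "(vdist n w \<mu>)\<^sup>2 \<le> (vdist n w u + \<eta>)\<^sup>2"
      using vdist_triangle[of n w \<mu> u] near by (intro power_mono) (auto simp: vdist_commute)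
    also have "\<dots> \<le> 2 * (vdist n w u)\<^sup>2 + 2 * \<eta>\<^sup>2"
      using sum_squares_bound[of "vdist n w u" \<eta>] by (simp add: power2_sum)
    also have "(vdist n w u)\<^sup>2 \<le> (radius (undefeated (C ?X)) u)\<^sup>2"
      unfolding w_def by (intro power_mono winner_near u) auto
    also have "\<dots> \<le> L\<^sup>2 + (\<Sum>v\<in>F. (vdist n v u)\<^sup>2 * indicator (undefeated (C ?X)) (u, v))"
      unfolding F_def using assms by (intro radius_square_le) auto
    also have "\<dots> \<le> L\<^sup>2 + (\<Sum>v\<in>F. (vdist n v u)\<^sup>2 * indicator (A v) ?X)"
      by (intro add_left_mono sum_mono mult_left_mono sub) auto
    finally show ?thesis by (simp add: w_def)
  qed
  have "(\<integral>\<^sup>+\<xi>. ennreal ((vdist n (winner (C (shifted n N \<mu> \<xi>))) \<mu>)\<^sup>2) \<partial>P)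
      \<le> (\<integral>\<^sup>+\<xi>. ennreal (2 * \<eta>\<^sup>2 + 2 * L\<^sup>2) +
          (\<Sum>v\<in>F. ennreal (2 * (vdist n v u)\<^sup>2) * indicator (A v) (shifted n N \<mu> \<xi>)) \<partial>P)"
  proof (intro nn_integral_mono)
    fix \<xi> assume "\<xi> \<in> space P"
    have "ennreal ((vdist n (winner (C (shifted n N \<mu> \<xi>))) \<mu>)\<^sup>2) \<le> ennreal (2 * \<eta>\<^sup>2 + 2 * L\<^sup>2 +
        (\<Sum>v\<in>F. 2 * (vdist n v u)\<^sup>2 * indicator (A v) (shifted n N \<mu> \<xi>)))"
      using pointwise[OF \<open>\<xi> \<in> space P\<close>] by (intro ennreal_leI) (simp add: sum_distrib_left mult.assoc)
    also have "\<dots> = ennreal (2 * \<eta>\<^sup>2 + 2 * L\<^sup>2) +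
          (\<Sum>v\<in>F. ennreal (2 * (vdist n v u)\<^sup>2) * indicator (A v) (shifted n N \<mu> \<xi>))"
      by (subst ennreal_plus, simp, intro sum_nonneg, simp, subst sum_ennreal[symmetric], simp)
        (simp add: ennreal_mult' ennreal_indicator)
    finally show "ennreal ((vdist n (winner (C (shifted n N \<mu> \<xi>))) \<mu>)\<^sup>2) \<le> \<dots>" .
  qed
  also have "\<dots> = ennreal (2 * \<eta>\<^sup>2 + 2 * L\<^sup>2) +
      (\<Sum>v\<in>F. ennreal (2 * (vdist n v u)\<^sup>2) * (\<integral>\<^sup>+\<xi>. indicator (A v) (shifted n N \<mu> \<xi>) \<partial>P))"
    by (simp add: nn_integral_add nn_integral_sum nn_integral_cmult P.emeasure_space_1)
  also have "\<dots> \<le> ennreal (2 * \<eta>\<^sup>2 + 2 * L\<^sup>2) + (\<Sum>v\<in>F. ennreal (2 * (vdist n v u)\<^sup>2) *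
      ennreal ((1 + (vdist n v u)\<^sup>2 / \<sigma>\<^sup>2) powr (- (test_rate * N))))"
  proof (intro add_left_mono sum_mono mult_left_mono)
    fix v assume "v \<in> F"
    then have v: "L \<le> vdist n v u" by (simp add: F_def)
    then have "L\<^sup>2 \<le> (vdist n v u)\<^sup>2" using assms by (intro power_mono) auto
    then have "test_rate * L\<^sup>2 \<le> test_rate * (vdist n v u)\<^sup>2" by (intro mult_left_mono) (auto simp: test_rate_def)
    then show "(\<integral>\<^sup>+\<xi>. indicator (A v) (shifted n N \<mu> \<xi>) \<partial>P) \<le> ennreal ((1 + (vdist n v u)\<^sup>2 / \<sigma>\<^sup>2) powr (- (test_rate * N)))"
      unfolding P_def A_def using assms v by (intro pair_test_failure[OF D]) auto
  qed auto
  also have "\<dots> = ennreal (2 * \<eta>\<^sup>2 + 2 * L\<^sup>2 + 2 * (\<Sum>v\<in>F. 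
        (vdist n v u)\<^sup>2 * (1 + (vdist n v u)\<^sup>2 / \<sigma>\<^sup>2) powr (- (test_rate * N))))"
  proof -
    let ?s = "\<Sum>v\<in>F. (vdist n v u)\<^sup>2 * (1 + (vdist n v u)\<^sup>2 / \<sigma>\<^sup>2) powr (- (test_rate * N))"
    have "0 \<le> ?s" by (intro sum_nonneg) auto
    then have "ennreal (2 * \<eta>\<^sup>2 + 2 * L\<^sup>2 + 2 * ?s) = ennreal (2 * \<eta>\<^sup>2 + 2 * L\<^sup>2) + ennreal (2 * ?s)"
      by (intro ennreal_plus) auto
    also have "ennreal (2 * ?s) = (\<Sum>v\<in>F. ennreal (2 * (vdist n v u)\<^sup>2) *
        ennreal ((1 + (vdist n v u)\<^sup>2 / \<sigma>\<^sup>2) powr (- (test_rate * N))))"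
      unfolding sum_distrib_left by (subst sum_ennreal[symmetric]) (auto simp: ennreal_mult'[symmetric] mult.assoc)
    finally show ?thesis by simp
  qed
  finally show ?thesis unfolding P_def F_def .
qed

end

section \<open>Upper bound\<close>

lemma local_entropy_le_of_budget:
  assumes "ereal A * (SUP \<delta>\<in>{0<..}. local_entropy n K \<delta> c) \<le> ereal x" "0 < A" "0 < \<delta>"
  shows "local_entropy n K \<delta> c \<le> ereal (x / A)"
proof -
  have "ereal A * local_entropy n K \<delta> c \<le> ereal A * (SUP \<delta>\<in>{0<..}. local_entropy n K \<delta> c)"
    using assms by (intro ereal_mult_left_mono SUP_upper) auto
  then have *: "ereal A * local_entropy n K \<delta> c \<le> ereal x" using assms(1) by (rule order_trans)
  show ?thesis
  proof (cases "local_entropy n K \<delta> c")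
    case (real r)
    then show ?thesis using * assms by (simp add: field_simps)
  qed (use * assms in auto)
qed

locale entropy_budget = star_set +
  fixes \<sigma> c A :: real and N :: nat
  assumes N_pos: "1 \<le> N" and \<sigma>_pos: "0 < \<sigma>" and c_ge: "4 \<le> c" and A_ge: "1 \<le> A"
    and budget: "\<And>\<delta>. 0 < \<delta> \<Longrightarrow> local_entropy n K \<delta> c \<le> ereal (N / A)"
begin

abbreviation critical :: "real set" where
  "critical \<equiv> {\<delta>. \<delta> \<ge> 0 \<and> ereal (real N * \<delta>\<^sup>2 / \<sigma>\<^sup>2) \<le> local_entropy n K \<delta> c}"

abbreviation dstar :: real where "dstar \<equiv> delta_star n K \<sigma> N c"

lemma zero_critical: "0 \<in> critical"
  using ln_card_le_local_entropy[OF centre, of "{k}" n 0 c] centre by (simp add: separated_def)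

text \<open>The budget gives N \<delta>^2/\<sigma>^2 \<le> N/A \<le> N. This keeps the real supremum
  in \<open>delta_star\<close> meaningful and later keeps the shifts of the coins within
  \<sigma>.\<close>

lemma critical_le: "\<delta> \<in> critical \<Longrightarrow> \<delta> \<le> \<sigma>"
proof (cases "\<delta> = 0")
  case False
  assume "\<delta> \<in> critical"
  then have "0 < \<delta>" "ereal (real N * \<delta>\<^sup>2 / \<sigma>\<^sup>2) \<le> local_entropy n K \<delta> c"
    using False by auto
  note order_trans[OF this(2) budget[OF this(1)]]
  then have "real N * (\<delta>\<^sup>2 / \<sigma>\<^sup>2) \<le> real N * (1 / A)" by simp
  then have "\<delta>\<^sup>2 / \<sigma>\<^sup>2 \<le> 1 / A" by (rule mult_left_le_imp_le) (use N_pos in simp)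
  also have "\<dots> \<le> 1" using A_ge by simp
  finally have "\<delta>\<^sup>2 \<le> \<sigma>\<^sup>2" using \<sigma>_pos by (simp add: field_simps)
  then show ?thesis by (rule power2_le_imp_le) (use \<sigma>_pos in simp)
qed (use \<sigma>_pos in auto)

lemma bdd_critical: "bdd_above critical"
  using critical_le by (intro bdd_aboveI[of _ \<sigma>]) auto

lemma critical_le_dstar: "\<delta> \<in> critical \<Longrightarrow> \<delta> \<le> dstar"
  unfolding delta_star_def by (rule cSup_upper[OF _ bdd_critical])

lemma dstar_nonneg: "0 \<le> dstar"
  using critical_le_dstar[OF zero_critical] .

lemma local_entropy_less:
  assumes "dstar < \<delta>"
  shows "local_entropy n K \<delta> c < ereal (real N * \<delta>\<^sup>2 / \<sigma>\<^sup>2)"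
proof -
  have "\<delta> \<notin> critical" using critical_le_dstar[of \<delta>] assms by auto
  then show ?thesis using assms dstar_nonneg by auto
qed

text \<open>Two points at distance \<delta>/3 are separated at \<delta>/4, hence at \<delta>/c: this
  is where 4 \<le> c comes from. One third keeps the distance below half the diameter, as
  \<open>point_at_distance\<close> requires.\<close>

lemma ln2_le_local_entropy:
  assumes "0 < \<delta>" "\<delta> \<le> diam_Rn n K"
  shows "ereal (ln 2) \<le> local_entropy n K \<delta> c"
proof -
  obtain x where x: "x \<in> K" "vdist n x k = \<delta> / 3"
    using point_at_distance[of "\<delta> / 3"] assms by auto
  have "x \<noteq> k" using x assms by auto
  have "\<delta> / c \<le> \<delta> / 4" using assms c_ge by (intro divide_left_mono) auto
  then have "separated n (\<delta> / c) {k, x}" "{k, x} \<subseteq> {y. vdist n y k \<le> \<delta>} \<inter> K"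
    using x centre assms by (auto simp: separated_def vdist_commute[of n k x])
  then show ?thesis
    using ln_card_le_local_entropy[OF centre, of "{k, x}" n \<delta> c] \<open>x \<noteq> k\<close> by simp
qed

text \<open>Two points always make \<delta> critical up to order \<sigma>/sqrt N, so the parametric
  rate is already contained in \<delta>* unless the diameter is smaller.\<close>

lemma dstar_square_ge: "min (ln 2 * \<sigma>\<^sup>2 / N) ((diam_Rn n K)\<^sup>2) \<le> dstar\<^sup>2"
proof (cases "diam_Rn n K = 0")
  case False
  define \<delta> where "\<delta> = min (sqrt (ln 2 * \<sigma>\<^sup>2 / N)) (diam_Rn n K)"
  have "0 < ln 2 * \<sigma>\<^sup>2 / N" using \<sigma>_pos N_pos by simp
  then have \<delta>: "0 < \<delta>" "\<delta> \<le> diam_Rn n K"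
    using False diam_nonneg by (auto simp: \<delta>_def)
  have eq: "\<delta>\<^sup>2 = min (ln 2 * \<sigma>\<^sup>2 / N) ((diam_Rn n K)\<^sup>2)"
  proof -
    have "sqrt (ln 2 * \<sigma>\<^sup>2 / N) \<le> diam_Rn n K \<longleftrightarrow> ln 2 * \<sigma>\<^sup>2 / N \<le> (diam_Rn n K)\<^sup>2"
      using diam_nonneg by (rule real_sqrt_le_iff'[OF less_imp_le[OF \<open>0 < ln 2 * \<sigma>\<^sup>2 / N\<close>]])
    moreover have "(sqrt (ln 2 * \<sigma>\<^sup>2 / N))\<^sup>2 = ln 2 * \<sigma>\<^sup>2 / N"
      using \<open>0 < ln 2 * \<sigma>\<^sup>2 / N\<close> by (intro real_sqrt_pow2) simp
    ultimately show ?thesis unfolding \<delta>_def by (simp only: min_def split: if_split) simp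
  qed
  then have "\<delta>\<^sup>2 \<le> ln 2 * \<sigma>\<^sup>2 / N" by simp
  then have "real N * \<delta>\<^sup>2 / \<sigma>\<^sup>2 \<le> ln 2" using \<sigma>_pos N_pos by (simp add: field_simps)
  then have "ereal (real N * \<delta>\<^sup>2 / \<sigma>\<^sup>2) \<le> ereal (ln 2)" by simp
  then have "\<delta> \<in> critical"
    using order_trans[OF _ ln2_le_local_entropy[OF \<delta>]] \<delta> by simp
  then have "\<delta> \<le> dstar" by (rule critical_le_dstar)
  then have "\<delta>\<^sup>2 \<le> dstar\<^sup>2" using \<delta> by (intro power_mono) auto
  then show ?thesis using eq by simp
qed simp

lemma minimax_risk_le_diam: "minimax_risk n K \<sigma> \<epsilon> N \<le> ennreal ((diam_Rn n K)\<^sup>2)"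
  unfolding minimax_risk_def
proof (rule INF_lower2)
  show "(\<lambda>_. k) \<in> estimators n N"
    using centre space by (auto simp: estimators_def)
  show "(SUP \<mu>\<in>K. SUP D\<in>noise_class n (\<sigma>\<^sup>2). SUP C\<in>adversaries n N \<epsilon>.
      \<integral>\<^sup>+ \<xi>. ennreal ((vdist n k \<mu>)\<^sup>2) \<partial>PiM {..<N} (\<lambda>_. D)) \<le> ennreal ((diam_Rn n K)\<^sup>2)"
  proof (intro SUP_least)
    fix \<mu> D C assume "\<mu> \<in> K" "D \<in> noise_class n (\<sigma>\<^sup>2)"
    interpret P: prob_space "PiM {..<N} (\<lambda>_. D)"
      using noise_classD(1)[OF \<open>D \<in> _\<close>] by (intro prob_space_PiM)
    show "(\<integral>\<^sup>+ \<xi>. ennreal ((vdist n k \<mu>)\<^sup>2) \<partial>PiM {..<N} (\<lambda>_. D)) \<le> ennreal ((diam_Rn n K)\<^sup>2)"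
      using vdist_le_diam[OF centre \<open>\<mu> \<in> K\<close>]
      by (auto simp: P.emeasure_space_1 intro!: ennreal_leI power_mono)
  qed
qed

lemma minimax_risk_upper:
  assumes A: "16 * c\<^sup>2 / test_rate \<le> A" and \<epsilon>: "0 < \<epsilon>" "\<epsilon> < 1 / 32"
  shows "minimax_risk n K \<sigma> \<epsilon> N \<le> ennreal (17408 * c ^ 4 / test_rate *
    min (max (dstar\<^sup>2) (\<epsilon> * \<sigma>\<^sup>2)) ((diam_Rn n K)\<^sup>2))"
proof (cases "(diam_Rn n K)\<^sup>2 \<le> max (dstar\<^sup>2) (\<epsilon> * \<sigma>\<^sup>2)")
  case True
  have "1 \<le> c ^ 4" using c_ge by (intro one_le_power) auto
  then have "1 * (diam_Rn n K)\<^sup>2 \<le> 17408 * c ^ 4 / test_rate * (diam_Rn n K)\<^sup>2"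
    by (intro mult_right_mono) (auto simp: test_rate_def)
  then have "ennreal ((diam_Rn n K)\<^sup>2) \<le> ennreal (17408 * c ^ 4 / test_rate *
    min (max (dstar\<^sup>2) (\<epsilon> * \<sigma>\<^sup>2)) ((diam_Rn n K)\<^sup>2))"
    using True by (intro ennreal_leI) (simp add: min_absorb2)
  then show ?thesis using minimax_risk_le_diam by (rule order_trans[rotated])
next
  case False
  define \<kappa> where "\<kappa> = test_rate"
  \<comment> \<open>Chosen so that m = 8 \<beta> N satisfies 2 c^2 m = \<kappa> N, the exponent
    condition of \<open>shell_sum_le\<close>; the assumption on \<open>A\<close> says 1/A \<le>
    \<beta>.\<close>
  define \<beta> where "\<beta> = \<kappa> / (16 * c\<^sup>2)"
  define R where "R = max (dstar\<^sup>2) (\<epsilon> * \<sigma>\<^sup>2)"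
  define \<rho> where "\<rho> = sqrt R"
  \<comment> \<open>With this mesh, shrinking any radius above \<eta>/2 by sqrt \<beta> still leaves
    more than 2 \<rho>, hence more than \<delta>*.\<close>
  define \<eta> where "\<eta> = 4 / sqrt \<beta> * \<rho>"
  define m where "m = 8 * \<beta> * N"
  define d where "d = diam_Rn n K"
  have d: "R < d\<^sup>2" "0 \<le> d" using False diam_nonneg by (auto simp: R_def d_def)
  have \<kappa>: "0 < \<kappa>" "\<kappa> \<le> 1" by (auto simp: \<kappa>_def test_rate_def)
  have c2: "16 \<le> c\<^sup>2" using power_mono[OF c_ge, of 2] by simp
  have \<beta>: "0 < \<beta>" "\<beta> \<le> 1" "\<beta> \<le> \<kappa>" "1 / A \<le> \<beta>"
  proof -
    show "0 < \<beta>" unfolding \<beta>_def using \<kappa> c2 by (intro divide_pos_pos) auto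
    have "\<kappa> * 1 \<le> \<kappa> * (16 * c\<^sup>2)" using \<kappa> c2 by (intro mult_left_mono) auto
    then show "\<beta> \<le> \<kappa>" using \<kappa> c2 by (simp add: \<beta>_def divide_le_eq)
    then show "\<beta> \<le> 1" using \<kappa> by simp
    have "0 < 16 * c\<^sup>2 / \<kappa>" using \<kappa> c2 by (intro divide_pos_pos) auto
    then have "1 / A \<le> 1 / (16 * c\<^sup>2 / \<kappa>)"
      using A A_ge unfolding \<kappa>_def by (intro divide_left_mono mult_pos_pos) auto
    then show "1 / A \<le> \<beta>" by (simp add: \<beta>_def)
  qed
  have R: "0 < R" "dstar\<^sup>2 \<le> R" "\<epsilon> * \<sigma>\<^sup>2 \<le> R"
    using \<epsilon> \<sigma>_pos by (auto simp: R_def less_max_iff_disj)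
  have \<rho>: "0 < \<rho>" "dstar \<le> \<rho>" "\<rho>\<^sup>2 = R"
    using R by (auto simp: \<rho>_def real_le_rsqrt)
  have \<eta>: "0 < \<eta>" "\<eta>\<^sup>2 = 16 / \<beta> * R"
    using \<rho> \<beta> by (auto simp: \<eta>_def power_mult_distrib power_divide)
  have m: "0 \<le> m" "2 * c\<^sup>2 * m \<le> \<kappa> * N"
    using \<beta> c2 by (auto simp: m_def \<beta>_def field_simps)
  have "0 < d" using d R by (cases "d = 0") auto
  then have "ereal (ln 2) \<le> ereal (N / A)"
    using order_trans[OF ln2_le_local_entropy budget, of d] unfolding d_def by simp
  then have "ln 2 \<le> N * (1 / A)" by simp
  also have "\<dots> \<le> N * \<beta>" using \<beta> by (intro mult_left_mono) auto
  finally have "ln 2 \<le> N * \<beta>" .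
  \<comment> \<open>Here 256 = 16 * 16 because c^2 \<ge> 16. With ln 2 \<le> N \<beta> this puts
    \<kappa> N far above the required 4.\<close>
  moreover have "N * \<beta> * 256 \<le> N * \<kappa>"
  proof -
    have "\<kappa> * 16 \<le> \<kappa> * c\<^sup>2" using \<kappa> c2 by (intro mult_left_mono) auto
    moreover have "\<beta> * 256 = \<kappa> * 16 / c\<^sup>2" by (simp add: \<beta>_def)
    ultimately have "\<beta> * 256 \<le> \<kappa>" using \<kappa> c2 by (simp add: divide_le_eq)
    then show ?thesis by (simp add: mult.assoc mult_left_mono)
  qed
  moreover have ln2: "1 / 2 \<le> (ln 2 :: real)" using ln_2_less_1 ln2_ge_two_thirds by simp
  ultimately have N4: "4 \<le> \<kappa> * N" by (simp add: mult.commute)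
  \<comment> \<open>As R is below the squared diameter, \<open>dstar_square_ge\<close> bounds
    \<sigma>^2/N by 2 R, which permits J = 1 in the shell sum.\<close>
  have J: "\<sigma>\<^sup>2 / (\<kappa> * N) \<le> 1 * \<eta>\<^sup>2"
  proof -
    have "ln 2 * \<sigma>\<^sup>2 / N \<le> R"
      using dstar_square_ge R d unfolding d_def by linarith
    then have "\<sigma>\<^sup>2 / N * (1 / 2) \<le> R"
      using mult_left_mono[OF ln2, of "\<sigma>\<^sup>2 / N"] by (simp add: mult.commute)
    then have "\<sigma>\<^sup>2 / N \<le> 2 * R" by simp
    then have "\<sigma>\<^sup>2 / N / \<kappa> \<le> 2 * R / \<kappa>" using \<kappa> by (intro divide_right_mono) auto
    also have "\<dots> \<le> 16 * R / \<beta>" using \<beta> \<kappa> R by (intro frac_le) auto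
    finally show ?thesis by (simp add: \<eta> mult.commute)
  qed
  \<comment> \<open>The \<open>min\<close> comes from two bounds: the budget N \<beta> at any
    radius, and N \<beta> t^2/\<sigma>^2 from shrinking the packing by sqrt \<beta> to a radius that
    still exceeds \<delta>*.\<close>
  have entropy: "ln (card S) \<le> m * min (t\<^sup>2 / \<sigma>\<^sup>2) 1 / 8"
    if "\<eta> / 2 < t" "\<nu> \<in> K" "finite S" "S \<noteq> {}" "S \<subseteq> {x. vdist n x \<nu> \<le> t} \<inter> K" "separated n (t / c) S" for t \<nu> S
  proof -
    have t: "0 < t" using that \<eta> by simp
    have "ereal (ln (card S)) \<le> local_entropy n K t c" using that by (intro ln_card_le_local_entropy)
    also have "\<dots> \<le> ereal (N * (1 / A))" using budget[OF t] by simp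
    also have "\<dots> \<le> ereal (N * \<beta>)" using \<beta> by (simp add: mult_left_mono del: times_divide_eq_right)
    finally have le1: "ln (card S) \<le> N * \<beta>" by simp
    define s where "s = sqrt \<beta>"
    have s: "0 < s" "s \<le> 1" "s\<^sup>2 = \<beta>" using \<beta> by (auto simp: s_def)
    have "s * (\<eta> / 2) < s * t" using that s by simp
    moreover have "s * (\<eta> / 2) = 2 * \<rho>" using s by (simp add: \<eta>_def s_def[symmetric])
    ultimately have "dstar < s * t" using \<rho> by simp
    note shrink = shrink_packing[OF s(1,2) that(2,5,6)]
    have "ereal (ln (card S)) \<le> local_entropy n K (s * t) c"
      using ln_card_le_local_entropy[OF shrink(1) _ _ shrink(2), of c] shrink(3,4) that by simp
    also have "\<dots> < ereal (real N * (s * t)\<^sup>2 / \<sigma>\<^sup>2)" by (rule local_entropy_less) fact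
    finally have "ln (card S) \<le> N * \<beta> * (t\<^sup>2 / \<sigma>\<^sup>2)" using s by (simp add: power_mult_distrib mult_ac)
    then show ?thesis using le1 by (auto simp: m_def min_def mult_ac)
  qed
  have count: "real (card S) \<le> (1 + t\<^sup>2 / \<sigma>\<^sup>2) powr m"
    if "\<nu> \<in> K" "finite S" "S \<subseteq> {x. vdist n x \<nu> \<le> t} \<inter> K" "separated n \<eta> S" "0 \<le> t" for \<nu> S t
    by (rule card_separated_le[where K = K and c = c and \<eta> = \<eta> and \<nu> = \<nu> and n = n])
      (use entropy that \<eta> m \<sigma>_pos c_ge in auto)
  \<comment> \<open>The count at radius d bounds every separated subset of \<open>K\<close>, so a
    finite maximal net exists.\<close>
  obtain G where G: "finite G" "G \<subseteq> K" "separated n \<eta> G" "\<And>x. x \<in> K \<Longrightarrow> \<exists>p\<in>G. vdist n x p \<le> \<eta>"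
  proof (rule maximal_separated_exists[of K n \<eta> "nat \<lfloor>(1 + d\<^sup>2 / \<sigma>\<^sup>2) powr m\<rfloor>"])
    fix P assume P: "finite P" "P \<subseteq> K" "separated n \<eta> P"
    then have "real (card P) \<le> (1 + d\<^sup>2 / \<sigma>\<^sup>2) powr m"
      using vdist_le_diam[OF _ centre] \<open>0 < d\<close> by (intro count[OF centre]) (auto simp: d_def)
    then show "card P \<le> nat \<lfloor>(1 + d\<^sup>2 / \<sigma>\<^sup>2) powr m\<rfloor>" by (simp add: le_nat_floor)
  qed (use \<eta> in auto)
  interpret tournament n N \<sigma> G
    using G centre space by unfold_locales auto
  define L where "L = c * \<eta>"
  have L2: "L\<^sup>2 = c\<^sup>2 * \<eta>\<^sup>2" by (simp add: L_def power_mult_distrib)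
  have "minimax_risk n K \<sigma> \<epsilon> N \<le> ennreal (68 * c\<^sup>2 * \<eta>\<^sup>2)"
    unfolding minimax_risk_def
  proof (rule INF_lower2)
    show "winner \<in> estimators n N" unfolding estimators_def by (rule winner_measurable)
    show "(SUP \<mu>\<in>K. SUP D\<in>noise_class n (\<sigma>\<^sup>2). SUP C\<in>adversaries n N \<epsilon>.
      \<integral>\<^sup>+ \<xi>. ennreal ((vdist n (winner (C (shifted n N \<mu> \<xi>))) \<mu>)\<^sup>2) \<partial>PiM {..<N} (\<lambda>_. D))
      \<le> ennreal (68 * c\<^sup>2 * \<eta>\<^sup>2)"
    proof (intro SUP_least)
      fix \<mu> D C assume *: "\<mu> \<in> K" "D \<in> noise_class n (\<sigma>\<^sup>2)" "C \<in> adversaries n N \<epsilon>"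
      obtain u where u: "u \<in> G" "vdist n \<mu> u \<le> \<eta>" using G(4)[OF *(1)] by blast
      have "(\<integral>\<^sup>+ \<xi>. ennreal ((vdist n (winner (C (shifted n N \<mu> \<xi>))) \<mu>)\<^sup>2) \<partial>PiM {..<N} (\<lambda>_. D))
        \<le> ennreal (2 * \<eta>\<^sup>2 + 2 * L\<^sup>2 + 2 * (\<Sum>v\<in>{v\<in>G. L \<le> vdist n v u}.
          (vdist n v u)\<^sup>2 * (1 + (vdist n v u)\<^sup>2 / \<sigma>\<^sup>2) powr (- (test_rate * N))))"
      proof (rule winner_risk[OF *(2,3) \<sigma>_pos _ _ \<eta>(1) _ _ u(2,1)])
        show "4 * \<eta> \<le> L" using c_ge \<eta> by (simp add: L_def)
        have "test_rate * L\<^sup>2 = 256 * (c\<^sup>2 * c\<^sup>2) * R"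
          using \<kappa> c2 by (simp add: L2 \<eta> \<beta>_def \<kappa>_def[symmetric])
        moreover have "1 * 1 \<le> c\<^sup>2 * c\<^sup>2" using c2 by (intro mult_mono) auto
        then have "2 * R \<le> 256 * (c\<^sup>2 * c\<^sup>2) * R" using R by (intro mult_right_mono) auto
        ultimately show "2 * \<epsilon> * \<sigma>\<^sup>2 \<le> test_rate * L\<^sup>2" using R(3) by linarith
      qed (use \<epsilon> in auto)
      also have "\<dots> \<le> ennreal (68 * c\<^sup>2 * \<eta>\<^sup>2)"
      proof (intro ennreal_leI)
        have "(\<Sum>v\<in>{v\<in>G. L \<le> vdist n v u}.
          (vdist n v u)\<^sup>2 * (1 + (vdist n v u)\<^sup>2 / \<sigma>\<^sup>2) powr (- (test_rate * N))) \<le> 32 * c\<^sup>2 * 1\<^sup>2 * \<eta>\<^sup>2"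
          unfolding L_def \<kappa>_def[symmetric]
        proof (rule shell_sum_le[OF \<sigma>_pos \<eta>(1) _ m(1) G(1) u(1) N4 m(2) J])
          fix t :: real assume "0 \<le> t"
          then show "real (card {x \<in> G. vdist n x u \<le> t}) \<le> (1 + t\<^sup>2 / \<sigma>\<^sup>2) powr m"
            using u(1) G by (intro count[of u]) (auto intro: separated_subset)
        qed (use c_ge in simp)
        moreover have "1 * \<eta>\<^sup>2 \<le> c\<^sup>2 * \<eta>\<^sup>2" using c2 by (intro mult_right_mono) auto
        ultimately show "2 * \<eta>\<^sup>2 + 2 * L\<^sup>2 + 2 * (\<Sum>v\<in>{v\<in>G. L \<le> vdist n v u}.
          (vdist n v u)\<^sup>2 * (1 + (vdist n v u)\<^sup>2 / \<sigma>\<^sup>2) powr (- (test_rate * N))) \<le> 68 * c\<^sup>2 * \<eta>\<^sup>2"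
          unfolding L2 one_power2 mult_1_right by linarith
      qed
      finally show "(\<integral>\<^sup>+ \<xi>. ennreal ((vdist n (winner (C (shifted n N \<mu> \<xi>))) \<mu>)\<^sup>2) \<partial>PiM {..<N} (\<lambda>_. D))
        \<le> ennreal (68 * c\<^sup>2 * \<eta>\<^sup>2)" .
    qed
  qed
  \<comment> \<open>68 = 2 + 2 + 2 * 32 collects the mesh, the cutoff L = c \<eta> and the shell
    sum; 17408 = 68 * 16 * 16 after inserting \<eta>^2 = 16 R / \<beta> and \<beta>.\<close>
  also have "68 * c\<^sup>2 * \<eta>\<^sup>2 = 17408 * c ^ 4 / test_rate * R"
  proof -
    have "68 * c\<^sup>2 * \<eta>\<^sup>2 = 17408 * (c\<^sup>2 * c\<^sup>2) / test_rate * R"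
      unfolding \<eta>(2) by (simp add: \<beta>_def \<kappa>_def)
    then show ?thesis by (simp flip: power_add)
  qed
  finally show ?thesis using d by (simp add: R_def d_def min_absorb1)
qed

end

section \<open>Two-point lower bound\<close>

text \<open>The law of one clean observation rather than of the noise: the lower bounds construct
  observation laws directly, and translating by the mean returns to
  \<open>noise_class\<close>.\<close>

definition law_in_model :: "nat \<Rightarrow> real \<Rightarrow> (nat \<Rightarrow> real) \<Rightarrow> (nat \<Rightarrow> real) measure \<Rightarrow> bool" where
  "law_in_model n s \<mu> Q \<longleftrightarrow> prob_space Q \<and> sets Q = sets (Rn n) \<and> \<mu> \<in> space (Rn n) \<and>
    (\<forall>i<n. integrable Q (\<lambda>x. x i) \<and> integrable Q (\<lambda>x. (x i)\<^sup>2) \<and> (\<integral>x. x i \<partial>Q) = \<mu> i) \<and>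
    (\<forall>v. (\<integral>x. (vinner n v (\<lambda>i. x i - \<mu> i))\<^sup>2 \<partial>Q) \<le> s * vinner n v v)"

lemma vdist_measurable:
  assumes "f \<in> measurable M (Rn n)"
  shows "(\<lambda>x. vdist n (f x) \<mu>) \<in> borel_measurable M"
proof -
  have "(\<lambda>y. vdist n y \<mu>) \<in> borel_measurable (Rn n)"
    unfolding vdist_def vnorm_def by measurable
  then show ?thesis by (rule measurable_compose[OF assms])
qed

lemma law_in_model_noise:
  assumes Q: "law_in_model n s \<mu> Q"
  defines "D \<equiv> distr Q (Rn n) (vadd n (\<lambda>i. - \<mu> i))"
  shows "D \<in> noise_class n s"
    and "F \<in> borel_measurable (sample_space n N) \<Longrightarrow>
      (\<integral>\<^sup>+\<xi>. F (shifted n N \<mu> \<xi>) \<partial>PiM {..<N} (\<lambda>_. D)) = (\<integral>\<^sup>+X. F X \<partial>PiM {..<N} (\<lambda>_. Q))"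
proof -
  interpret Q: prob_space Q using Q by (simp add: law_in_model_def)
  have sets_Q: "sets Q = sets (Rn n)" and \<mu>: "\<mu> \<in> space (Rn n)" using Q by (auto simp: law_in_model_def)
  have space_Q: "space Q = space (Rn n)" using sets_Q by (rule sets_eq_imp_space_eq)
  note [measurable_cong] = sets_Q
  have vm [measurable]: "vadd n (\<lambda>i. - \<mu> i) \<in> measurable Q (Rn n)"
    using vadd_measurable sets_Q by (simp cong: measurable_cong_sets)
  interpret D: prob_space D unfolding D_def by (rule Q.prob_space_distr[OF vm])
  have sets_D: "sets D = sets (Rn n)" by (simp add: D_def)
  have coord: "integrable Q (\<lambda>x. x i)" "integrable Q (\<lambda>x. (x i)\<^sup>2)" "(\<integral>x. x i \<partial>Q) = \<mu> i" if "i < n" for i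
    using Q that by (auto simp: law_in_model_def)
  have int: "integrable D (\<lambda>x. x i)" "integrable D (\<lambda>x. (x i)\<^sup>2)" "(\<integral>x. x i \<partial>D) = 0" if "i < n" for i
  proof -
    show "integrable D (\<lambda>x. x i)" unfolding D_def
      using coord[OF that] that by (subst integrable_distr_eq) (auto simp: vadd_def)
    show "integrable D (\<lambda>x. (x i)\<^sup>2)" unfolding D_def
      using coord[OF that] that by (subst integrable_distr_eq) (auto simp: vadd_def power2_diff)
    show "(\<integral>x. x i \<partial>D) = 0" unfolding D_def
      using coord[OF that] that by (subst integral_distr) (auto simp: vadd_def Q.prob_space)
  qed
  have "(\<integral>x. (vinner n v x)\<^sup>2 \<partial>D) \<le> s * vinner n v v" for v
  proof -
    have "(\<integral>x. (vinner n v x)\<^sup>2 \<partial>D) = (\<integral>x. (vinner n v (vadd n (\<lambda>i. - \<mu> i) x))\<^sup>2 \<partial>Q)"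
      unfolding D_def by (rule integral_distr) (auto simp: vinner_def)
    also have "\<dots> = (\<integral>x. (vinner n v (\<lambda>i. x i - \<mu> i))\<^sup>2 \<partial>Q)"
      by (simp add: vinner_def vadd_def)
    finally show ?thesis using Q by (simp add: law_in_model_def)
  qed
  then show "D \<in> noise_class n s"
    using int sets_D D.prob_space_axioms by (simp add: noise_class_def)
  assume F: "F \<in> borel_measurable (sample_space n N)"
  have PQ: "sets (PiM {..<N} (\<lambda>_. Q)) = sets (sample_space n N)"
    unfolding sample_space_def using sets_Q by (intro sets_PiM_cong) auto
  have RN: "sets (PiM {..<N} (\<lambda>_. Rn n)) = sets (sample_space n N)" by (simp add: sample_space_def)
  have "PiM {..<N} (\<lambda>_. D) = distr (PiM {..<N} (\<lambda>_. Q)) (PiM {..<N} (\<lambda>_. D)) (compose {..<N} (vadd n (\<lambda>i. - \<mu> i)))"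
  proof -
    have "distr (PiM {..<N} (\<lambda>_. Q)) (PiM {..<N} (\<lambda>_. D)) (compose {..<N} (vadd n (\<lambda>i. - \<mu> i)))
      = PiM {..<N} (\<lambda>_. distr Q D (vadd n (\<lambda>i. - \<mu> i)))"
      using vm sets_D Q.prob_space_axioms D.prob_space_axioms
      by (intro distr_PiM_finite_prob_space') (auto cong: measurable_cong_sets)
    also have "distr Q D (vadd n (\<lambda>i. - \<mu> i)) = D"
      unfolding D_def by (rule distr_cong) auto
    finally show ?thesis by simp
  qed
  then have "(\<integral>\<^sup>+\<xi>. F (shifted n N \<mu> \<xi>) \<partial>PiM {..<N} (\<lambda>_. D))
    = (\<integral>\<^sup>+\<xi>. F (shifted n N \<mu> \<xi>) \<partial>distr (PiM {..<N} (\<lambda>_. Q)) (PiM {..<N} (\<lambda>_. D)) (compose {..<N} (vadd n (\<lambda>i. - \<mu> i))))"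
    by simp
  also have "\<dots> = (\<integral>\<^sup>+X. F (shifted n N \<mu> (compose {..<N} (vadd n (\<lambda>i. - \<mu> i)) X)) \<partial>PiM {..<N} (\<lambda>_. Q))"
  proof (rule nn_integral_distr[where f = "\<lambda>\<xi>. F (shifted n N \<mu> \<xi>)"])
    have PD: "sets (PiM {..<N} (\<lambda>_. D)) = sets (sample_space n N)"
      unfolding sample_space_def using sets_D by (intro sets_PiM_cong) auto
    show "(\<lambda>\<xi>. F (shifted n N \<mu> \<xi>)) \<in> borel_measurable (distr (PiM {..<N} (\<lambda>_. Q)) (PiM {..<N} (\<lambda>_. D)) (compose {..<N} (vadd n (\<lambda>i. - \<mu> i))))"
      using measurable_compose[OF shifted_measurable F] PD by (simp cong: measurable_cong_sets)
    show "compose {..<N} (vadd n (\<lambda>i. - \<mu> i)) \<in> measurable (PiM {..<N} (\<lambda>_. Q)) (PiM {..<N} (\<lambda>_. D))"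
      using vm sets_D unfolding compose_def
      by (intro measurable_restrict measurable_compose[OF measurable_component_singleton]) (auto cong: measurable_cong_sets)
  qed
  also have "\<dots> = (\<integral>\<^sup>+X. F X \<partial>PiM {..<N} (\<lambda>_. Q))"
  proof (rule nn_integral_cong)
    fix X assume X: "X \<in> space (PiM {..<N} (\<lambda>_. Q))"
    then have Xj: "X j \<in> space (Rn n)" if "j < N" for j
      using that space_Q by (auto simp: space_PiM PiE_def)
    have "vadd n \<mu> (vadd n (\<lambda>i. - \<mu> i) x) = x" if "x \<in> space (Rn n)" for x
      using that by (auto simp: vadd_def Rn_def space_PiM PiE_def extensional_def fun_eq_iff)
    then have "shifted n N \<mu> (compose {..<N} (vadd n (\<lambda>i. - \<mu> i)) X) = X"
      using X Xj by (auto simp: space_PiM PiE_def extensional_def fun_eq_iff compose_def)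
    then show "F (shifted n N \<mu> (compose {..<N} (vadd n (\<lambda>i. - \<mu> i)) X)) = F X" by simp
  qed
  finally show "(\<integral>\<^sup>+\<xi>. F (shifted n N \<mu> \<xi>) \<partial>PiM {..<N} (\<lambda>_. D)) = (\<integral>\<^sup>+X. F X \<partial>PiM {..<N} (\<lambda>_. Q))" .
qed

lemma minimax_risk_geI:
  assumes "\<And>est. est \<in> estimators n N \<Longrightarrow> \<exists>\<mu>\<in>K. \<exists>Q C. law_in_model n (\<sigma>\<^sup>2) \<mu> Q \<and> C \<in> adversaries n N \<epsilon> \<and>
    x \<le> (\<integral>\<^sup>+X. ennreal ((vdist n (est (C X)) \<mu>)\<^sup>2) \<partial>PiM {..<N} (\<lambda>_. Q))"
  shows "x \<le> minimax_risk n K \<sigma> \<epsilon> N"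
  unfolding minimax_risk_def
proof (rule INF_greatest)
  fix est assume est: "est \<in> estimators n N"
  then obtain \<mu> Q C where *: "\<mu> \<in> K" "law_in_model n (\<sigma>\<^sup>2) \<mu> Q" "C \<in> adversaries n N \<epsilon>"
    "x \<le> (\<integral>\<^sup>+X. ennreal ((vdist n (est (C X)) \<mu>)\<^sup>2) \<partial>PiM {..<N} (\<lambda>_. Q))"
    using assms by blast
  define D where "D = distr Q (Rn n) (vadd n (\<lambda>i. - \<mu> i))"
  have "(\<lambda>X. est (C X)) \<in> measurable (sample_space n N) (Rn n)"
    using est *(3) by (auto simp: estimators_def adversaries_def intro: measurable_compose)
  then have F: "(\<lambda>X. ennreal ((vdist n (est (C X)) \<mu>)\<^sup>2)) \<in> borel_measurable (sample_space n N)"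
    using vdist_measurable by measurable
  have "x \<le> (\<integral>\<^sup>+\<xi>. ennreal ((vdist n (est (C (shifted n N \<mu> \<xi>))) \<mu>)\<^sup>2) \<partial>PiM {..<N} (\<lambda>_. D))"
    using *(4) law_in_model_noise(2)[OF *(2) F] by (simp add: D_def)
  also have "\<dots> \<le> (SUP \<mu>\<in>K. SUP D\<in>noise_class n (\<sigma>\<^sup>2). SUP C\<in>adversaries n N \<epsilon>.
    \<integral>\<^sup>+\<xi>. ennreal ((vdist n (est (C (shifted n N \<mu> \<xi>))) \<mu>)\<^sup>2) \<partial>PiM {..<N} (\<lambda>_. D))"
    using * law_in_model_noise(1)[OF *(2)] unfolding D_def
    by (intro SUP_upper2[OF *(1)] SUP_upper2[OF law_in_model_noise(1)[OF *(2)]] SUP_upper)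
  finally show "x \<le> \<dots>" .
qed

section \<open>Deleting the rare atom\<close>

definition reset_adversary :: "nat \<Rightarrow> real \<Rightarrow> (nat \<Rightarrow> real) \<Rightarrow> (nat \<Rightarrow> nat \<Rightarrow> real) \<Rightarrow> (nat \<Rightarrow> nat \<Rightarrow> real)" where
  "reset_adversary N \<epsilon> \<mu>0 X = (if real (card {i\<in>{..<N}. X i \<noteq> \<mu>0}) \<le> \<epsilon> * N then (\<lambda>j\<in>{..<N}. \<mu>0) else X)"

lemma neq_point_sets:
  assumes "\<mu>0 \<in> space (Rn n)"
  shows "{x \<in> space (Rn n). x \<noteq> \<mu>0} \<in> sets (Rn n)"
proof -
  have "x = \<mu>0 \<longleftrightarrow> (\<forall>i\<in>{..<n}. x i = \<mu>0 i)" if "x \<in> space (Rn n)" for x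
    using that assms by (auto simp: Rn_def space_PiM intro: PiE_ext)
  then have eq: "{x \<in> space (Rn n). x \<noteq> \<mu>0} = space (Rn n) - {x \<in> space (Rn n). \<forall>i\<in>{..<n}. x i = \<mu>0 i}" by auto
  have "{x \<in> space (Rn n). x i = \<mu>0 i} \<in> sets (Rn n)" if "i < n" for i
    using component_measurable[OF that] by measurable
  then have "{x \<in> space (Rn n). \<forall>i\<in>{..<n}. x i = \<mu>0 i} \<in> sets (Rn n)"
    by (intro sets.sets_Collect_finite_All) auto
  then show ?thesis unfolding eq by (rule sets.compl_sets)
qed

lemma count_neq_measurable:
  assumes "\<mu>0 \<in> space (Rn n)"
  shows "(\<lambda>X. real (card {i\<in>{..<N}. X i \<noteq> \<mu>0})) \<in> borel_measurable (sample_space n N)"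
proof -
  have "(\<lambda>X. indicator {x \<in> space (Rn n). x \<noteq> \<mu>0} (X i) :: real) \<in> borel_measurable (sample_space n N)" if "i < N" for i
    using neq_point_sets[OF assms] that
    by (intro measurable_compose[OF sample_component_measurable] borel_measurable_indicator)
  then have "(\<lambda>X. \<Sum>i<N. indicator {x \<in> space (Rn n). x \<noteq> \<mu>0} (X i) :: real) \<in> borel_measurable (sample_space n N)"
    by (intro borel_measurable_sum) auto
  moreover have "real (card {i\<in>{..<N}. X i \<noteq> \<mu>0}) = (\<Sum>i<N. indicator {x \<in> space (Rn n). x \<noteq> \<mu>0} (X i))"
    if "X \<in> space (sample_space n N)" for X
  proof -
    have "X i \<in> space (Rn n)" if "i < N" for i
      using \<open>X \<in> _\<close> that by (auto simp: sample_space_def space_PiM PiE_def)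
    then have "(\<Sum>i<N. indicator {x \<in> space (Rn n). x \<noteq> \<mu>0} (X i) :: real) = (\<Sum>i<N. if X i \<noteq> \<mu>0 then 1 else 0)"
      by (intro sum.cong) auto
    then show ?thesis by (simp add: sum.If_cases Int_def)
  qed
  ultimately show ?thesis by (simp cong: measurable_cong)
qed

text \<open>A reset changes exactly the points that were counted, and otherwise nothing is changed,
  so the budget is respected on every sample.\<close>

lemma reset_adversary_in:
  assumes "\<mu>0 \<in> space (Rn n)" "0 \<le> \<epsilon>"
  shows "reset_adversary N \<epsilon> \<mu>0 \<in> adversaries n N \<epsilon>"
proof -
  have "(\<lambda>X. reset_adversary N \<epsilon> \<mu>0 X) \<in> measurable (sample_space n N) (sample_space n N)"
    unfolding reset_adversary_def
  proof (rule measurable_If)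
    show "(\<lambda>X. \<lambda>j\<in>{..<N}. \<mu>0) \<in> measurable (sample_space n N) (sample_space n N)"
      using assms by (intro measurable_const) (auto simp: sample_space_def space_PiM)
    show "{X \<in> space (sample_space n N). real (card {i \<in> {..<N}. X i \<noteq> \<mu>0}) \<le> \<epsilon> * N} \<in> sets (sample_space n N)"
      using count_neq_measurable[OF assms(1)] by measurable
  qed simp
  moreover have "real (card {i\<in>{..<N}. reset_adversary N \<epsilon> \<mu>0 X i \<noteq> X i}) \<le> \<epsilon> * N" for X
  proof (cases "real (card {i\<in>{..<N}. X i \<noteq> \<mu>0}) \<le> \<epsilon> * N")
    case True
    have "{i\<in>{..<N}. reset_adversary N \<epsilon> \<mu>0 X i \<noteq> X i} = {i\<in>{..<N}. X i \<noteq> \<mu>0}"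
      using True by (auto simp: reset_adversary_def)
    then show ?thesis using True by simp
  qed (use assms in \<open>simp add: reset_adversary_def\<close>)
  ultimately show ?thesis by (simp add: adversaries_def)
qed

text \<open>Mass 1 - p sits at \<open>\<mu>0\<close> and mass p at a point pushed out by 1/p, so the
  mean is \<open>\<mu>\<close>. Along v the variance is (1 - p)/p times the squared inner product
  with the shift, at most |v|^2 dist^2 / p.\<close>

lemma two_atom_law:
  fixes p s :: real
  assumes "\<mu>0 \<in> space (Rn n)" "\<mu> \<in> space (Rn n)" "0 < p" "p \<le> 1" "(vdist n \<mu> \<mu>0)\<^sup>2 \<le> s * p"
  obtains Q where "law_in_model n s \<mu> Q" "emeasure Q {x \<in> space (Rn n). x \<noteq> \<mu>0} \<le> ennreal p"
proof -
  define a where "a = (\<lambda>i\<in>{..<n}. \<mu>0 i + (\<mu> i - \<mu>0 i) / p)"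
  define B where "B = measure_pmf (bernoulli_pmf p)"
  define Q where "Q = distr B (Rn n) (\<lambda>b. if b then a else \<mu>0)"
  have a: "a \<in> space (Rn n)" by (simp add: a_def Rn_def space_PiM)
  have meas [measurable]: "(\<lambda>b. if b then a else \<mu>0) \<in> measurable B (Rn n)"
    using a assms by (simp add: B_def)
  interpret B: prob_space B unfolding B_def by (rule prob_space_measure_pmf)
  interpret Q: prob_space Q unfolding Q_def by (rule B.prob_space_distr[OF meas])
  have intB: "integrable B f" for f :: "bool \<Rightarrow> real"
    unfolding B_def by (rule integrable_measure_pmf_finite) simp
  have EB: "(\<integral>b. f b \<partial>B) = f True * p + f False * (1 - p)" for f :: "bool \<Rightarrow> real"
    unfolding B_def using assms by (subst integral_bernoulli_pmf) auto
  have EQ: "(\<integral>x. f x \<partial>Q) = f a * p + f \<mu>0 * (1 - p)" if "f \<in> borel_measurable (Rn n)" for f :: "(nat \<Rightarrow> real) \<Rightarrow> real"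
    unfolding Q_def using that by (subst integral_distr[OF meas]) (auto simp: EB)
  have intQ: "integrable Q f" if "f \<in> borel_measurable (Rn n)" for f :: "(nat \<Rightarrow> real) \<Rightarrow> real"
    unfolding Q_def using that by (subst integrable_distr_eq[OF meas]) (auto intro: intB)
  have "(\<integral>x. x i \<partial>Q) = \<mu> i" if "i < n" for i
    using that assms by (subst EQ) (auto simp: a_def field_simps)
  moreover have "(\<integral>x. (vinner n v (\<lambda>i. x i - \<mu> i))\<^sup>2 \<partial>Q) \<le> s * vinner n v v" for v
  proof -
    let ?w = "vinner n v (\<lambda>i. \<mu> i - \<mu>0 i)"
    have "(\<integral>x. (vinner n v (\<lambda>i. x i - \<mu> i))\<^sup>2 \<partial>Q)
      = (vinner n v (\<lambda>i. a i - \<mu> i))\<^sup>2 * p + (vinner n v (\<lambda>i. \<mu>0 i - \<mu> i))\<^sup>2 * (1 - p)"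
      by (rule EQ) (auto simp: vinner_def)
    also have "vinner n v (\<lambda>i. a i - \<mu> i) = (1 / p - 1) * ?w"
      unfolding vinner_def sum_distrib_left using assms by (intro sum.cong) (auto simp: a_def field_simps)
    also have "vinner n v (\<lambda>i. \<mu>0 i - \<mu> i) = - ?w"
      unfolding vinner_def sum_negf[symmetric] by (intro sum.cong) (auto simp: algebra_simps)
    also have "((1 / p - 1) * ?w)\<^sup>2 * p + (- ?w)\<^sup>2 * (1 - p) = ?w\<^sup>2 * ((1 - p) / p)"
      using assms by (simp add: field_simps power2_eq_square)
    also have "\<dots> \<le> (vnorm n v * vdist n \<mu> \<mu>0)\<^sup>2 * (1 / p)"
    proof (intro mult_mono)
      have "\<bar>?w\<bar> \<le> vnorm n v * vdist n \<mu> \<mu>0" using vinner_vnorm_le by (simp add: vdist_def)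
      then have "\<bar>?w\<bar>\<^sup>2 \<le> (vnorm n v * vdist n \<mu> \<mu>0)\<^sup>2" by (intro power_mono) auto
      then show "?w\<^sup>2 \<le> (vnorm n v * vdist n \<mu> \<mu>0)\<^sup>2" by simp
    qed (use assms in \<open>auto simp: field_simps\<close>)
    also have "\<dots> = (vnorm n v)\<^sup>2 * ((vdist n \<mu> \<mu>0)\<^sup>2 / p)" by (simp add: power_mult_distrib)
    also have "\<dots> \<le> (vnorm n v)\<^sup>2 * s"
      using assms by (intro mult_left_mono) (auto simp: divide_le_eq)
    also have "(vnorm n v)\<^sup>2 = vinner n v v" by (simp add: vnorm_def vinner_def power2_eq_square sum_nonneg)
    finally show ?thesis by (simp add: mult.commute)
  qed
  moreover have "integrable Q (\<lambda>x. x i) \<and> integrable Q (\<lambda>x. (x i)\<^sup>2)" if "i < n" for i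
    using component_measurable[OF that] borel_measurable_power[OF component_measurable[OF that]]
    by (intro conjI intQ)
  moreover have "sets Q = sets (Rn n)" by (simp add: Q_def)
  ultimately have law: "law_in_model n s \<mu> Q"
    using assms Q.prob_space_axioms by (simp add: law_in_model_def)
  have "emeasure Q {x \<in> space (Rn n). x \<noteq> \<mu>0} \<le> emeasure B {True}"
    unfolding Q_def using neq_point_sets[OF assms(1)]
    by (subst emeasure_distr[OF meas]) (auto simp: B_def intro!: emeasure_mono)
  also have "\<dots> = ennreal p"
    using assms by (simp add: B_def emeasure_pmf_single)
  finally show ?thesis using law that by blast
qed

text \<open>The expected number of rare atoms is p N = max 1 (\<epsilon> N) / 2, so by Markov the
  adversary can erase them all with probability at least 1/2. When \<epsilon> N < 1 nothing can be
  changed, and the same event says that no rare atom occurred; this produces \<sigma>^2/N.\<close>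

lemma reset_risk_ge:
  fixes p \<epsilon> s :: real
  assumes "\<mu>0 \<in> space (Rn n)" "\<mu> \<in> space (Rn n)" "(vdist n \<mu> \<mu>0)\<^sup>2 \<le> s * p" "1 \<le> N" "0 < \<epsilon>" "\<epsilon> \<le> 1"
    and p: "p = max (1 / N) \<epsilon> / 2"
  obtains Q where "law_in_model n s \<mu> Q"
    "ennreal ((vdist n (est (\<lambda>j\<in>{..<N}. \<mu>0)) \<mu>)\<^sup>2 / 2)
      \<le> (\<integral>\<^sup>+X. ennreal ((vdist n (est (reset_adversary N \<epsilon> \<mu>0 X)) \<mu>)\<^sup>2) \<partial>PiM {..<N} (\<lambda>_. Q))"
proof -
  have "1 / real N \<le> 1" using assms by simp
  then have "max (1 / real N) \<epsilon> \<le> 1" "0 < max (1 / real N) \<epsilon>"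
    using assms by (auto simp: less_max_iff_disj)
  then have p01: "0 < p" "p \<le> 1" by (auto simp: p)
  obtain Q where Q: "law_in_model n s \<mu> Q" "emeasure Q {x \<in> space (Rn n). x \<noteq> \<mu>0} \<le> ennreal p"
    by (rule two_atom_law[OF assms(1,2) p01 assms(3)])
  define P where "P = PiM {..<N} (\<lambda>_. Q)"
  define E where "E = {x \<in> space (Rn n). x \<noteq> \<mu>0}"
  interpret Q: prob_space Q using Q by (simp add: law_in_model_def)
  interpret P: prob_space P unfolding P_def by (intro prob_space_PiM Q.prob_space_axioms)
  have sets_Q: "sets Q = sets (Rn n)" using Q by (simp add: law_in_model_def)
  have sets_P: "sets P = sets (sample_space n N)"
    unfolding P_def sample_space_def using sets_Q by (intro sets_PiM_cong) auto
  have space_P: "space P = space (sample_space n N)" using sets_P by (rule sets_eq_imp_space_eq)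
  have E: "E \<in> sets Q" using neq_point_sets[OF assms(1)] sets_Q by (simp add: E_def)
  define cnt where "cnt X = real (card {i\<in>{..<N}. X i \<noteq> \<mu>0})" for X :: "nat \<Rightarrow> nat \<Rightarrow> real"
  have cnt: "cnt \<in> borel_measurable P"
    unfolding cnt_def using count_neq_measurable[OF assms(1)] sets_P by (simp cong: measurable_cong_sets)
  define bad where "bad = {X \<in> space P. \<not> cnt X \<le> \<epsilon> * N}"
  have bad: "bad \<in> sets P" unfolding bad_def using cnt by measurable
  have "emeasure P bad = (\<integral>\<^sup>+X. indicator bad X \<partial>P)" using bad by simp
  also have "\<dots> \<le> (\<integral>\<^sup>+X. ennreal (1 / (2 * p * N)) * (\<Sum>j<N. indicator E (X j)) \<partial>P)"
  proof (intro nn_integral_mono)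
    fix X assume X: "X \<in> space P"
    have "X i \<in> space (Rn n)" if "i < N" for i
      using X that by (auto simp: space_P sample_space_def space_PiM PiE_def)
    then have "(\<Sum>i<N. indicator E (X i) :: ennreal) = (\<Sum>i<N. if X i \<noteq> \<mu>0 then 1 else 0)"
      by (intro sum.cong) (auto simp: E_def)
    also have "\<dots> = ennreal (cnt X)"
      by (simp add: sum.If_cases Int_def cnt_def ennreal_of_nat_eq_real_of_nat)
    finally have sum: "(\<Sum>i<N. indicator E (X i) :: ennreal) = ennreal (cnt X)" .
    show "indicator bad X \<le> ennreal (1 / (2 * p * N)) * (\<Sum>j<N. indicator E (X j))"
    proof (cases "X \<in> bad")
      case True
      then have "\<epsilon> * N < cnt X" by (simp add: bad_def)
      \<comment> \<open>Counts are integers, so exceeding \<epsilon> N \<ge> 0 also means reaching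
        1, hence reaching 2 p N in both cases of the maximum.\<close>
      moreover have "1 \<le> cnt X"
      proof -
        have "0 < cnt X" using \<open>\<epsilon> * N < cnt X\<close> assms by (intro le_less_trans[of 0 "\<epsilon> * N"]) auto
        then show ?thesis unfolding cnt_def real_of_nat_ge_one_iff of_nat_0_less_iff by simp
      qed
      ultimately have "2 * p * N \<le> cnt X" using assms by (auto simp: p max_def field_simps)
      then have "1 \<le> 1 / (2 * p * N) * cnt X" using p01 assms by (simp add: field_simps)
      then have "1 \<le> ennreal (1 / (2 * p * N)) * ennreal (cnt X)"
        using p01 by (simp add: ennreal_mult'[symmetric] del: times_divide_eq_left)
      then show ?thesis using True by (simp add: sum)
    qed simp
  qed
  also have "\<dots> = ennreal (1 / (2 * p * N)) * (\<Sum>j<N. \<integral>\<^sup>+X. indicator E (X j) \<partial>P)"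
  proof -
    have m: "(\<lambda>X. indicator E (X j) :: ennreal) \<in> borel_measurable P" if "j \<in> {..<N}" for j
      unfolding P_def using that E
      by (intro measurable_compose[OF measurable_component_singleton] borel_measurable_indicator) auto
    then have "(\<lambda>X. \<Sum>j<N. indicator E (X j) :: ennreal) \<in> borel_measurable P"
      by (rule borel_measurable_sum)
    then have "(\<integral>\<^sup>+X. ennreal (1 / (2 * p * N)) * (\<Sum>j<N. indicator E (X j)) \<partial>P)
      = ennreal (1 / (2 * p * N)) * (\<integral>\<^sup>+X. (\<Sum>j<N. indicator E (X j)) \<partial>P)"
      by (rule nn_integral_cmult)
    moreover have "(\<integral>\<^sup>+X. (\<Sum>j<N. indicator E (X j)) \<partial>P) = (\<Sum>j<N. \<integral>\<^sup>+X. indicator E (X j) \<partial>P)"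
      by (rule nn_integral_sum) (rule m)
    ultimately show ?thesis by simp
  qed
  also have "\<dots> \<le> ennreal (1 / (2 * p * N)) * (\<Sum>j<N. ennreal p)"
  proof (intro mult_left_mono sum_mono)
    fix j assume j: "j \<in> {..<N}"
    have "(\<integral>\<^sup>+X. indicator E (X j) \<partial>P) = (\<integral>\<^sup>+x. indicator E x \<partial>distr P Q (\<lambda>X. X j))"
      unfolding P_def using E j by (subst nn_integral_distr) auto
    also have "distr P Q (\<lambda>X. X j) = Q" unfolding P_def by (rule distr_PiM_component[OF Q.prob_space_axioms j])
    finally show "(\<integral>\<^sup>+X. indicator E (X j) \<partial>P) \<le> ennreal p" using Q(2) E by (simp add: E_def)
  qed simp
  also have "\<dots> = ennreal (1 / 2)"
    using p01 assms by (simp add: ennreal_of_nat_eq_real_of_nat ennreal_mult'[symmetric])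
  finally have "ennreal (P.prob bad) \<le> ennreal (1 / 2)" by (simp only: P.emeasure_eq_measure)
  then have "P.prob bad \<le> 1 / 2" by (subst (asm) ennreal_le_iff) simp
  then have good: "1 / 2 \<le> P.prob (space P - bad)" using bad by (simp add: P.prob_compl)
  let ?r = "(vdist n (est (\<lambda>j\<in>{..<N}. \<mu>0)) \<mu>)\<^sup>2"
  have "ennreal (?r / 2) \<le> ennreal (?r * P.prob (space P - bad))"
    using mult_left_mono[OF good, of ?r] by (intro ennreal_leI) simp
  also have "\<dots> = (\<integral>\<^sup>+X. ennreal ?r * indicator (space P - bad) X \<partial>P)"
    using bad by (simp add: nn_integral_cmult_indicator P.emeasure_eq_measure ennreal_mult')
  also have "\<dots> \<le> (\<integral>\<^sup>+X. ennreal ((vdist n (est (reset_adversary N \<epsilon> \<mu>0 X)) \<mu>)\<^sup>2) \<partial>P)"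
    by (intro nn_integral_mono) (auto simp: bad_def cnt_def reset_adversary_def indicator_def)
  finally show ?thesis using Q(1) that unfolding P_def by blast
qed

context star_set
begin

text \<open>After a reset the estimator sees the same constant sample for both means, and its value
  there is at least r/2 away from one of them. Half of the squared distance survives, which gives
  r^2/8.\<close>

lemma minimax_risk_ge_two_point:
  fixes \<epsilon> \<sigma> :: real
  assumes "1 \<le> N" "0 < \<epsilon>" "\<epsilon> \<le> 1" "0 < \<sigma>"
  shows "ennreal (min (\<sigma>\<^sup>2 * max (1 / N) \<epsilon> / 2) ((diam_Rn n K)\<^sup>2 / 9) / 8) \<le> minimax_risk n K \<sigma> \<epsilon> N"
proof (cases "diam_Rn n K = 0")
  case False
  define p where "p = max (1 / N) \<epsilon> / 2"
  define r where "r = min (\<sigma> * sqrt p) (diam_Rn n K / 3)"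
  have p: "0 < p" using assms by (auto simp: p_def less_max_iff_disj)
  have d: "0 < diam_Rn n K" using False diam_nonneg by simp
  have r: "0 \<le> r" "r < diam_Rn n K / 2" using p d assms by (auto simp: r_def min_def)
  have r2: "min (\<sigma>\<^sup>2 * p) ((diam_Rn n K)\<^sup>2 / 9) \<le> r\<^sup>2" "r\<^sup>2 \<le> \<sigma>\<^sup>2 * p"
  proof -
    have *: "(\<sigma> * sqrt p)\<^sup>2 = \<sigma>\<^sup>2 * p" "(diam_Rn n K / 3)\<^sup>2 = (diam_Rn n K)\<^sup>2 / 9"
      using p by (auto simp: power_mult_distrib power_divide)
    show "min (\<sigma>\<^sup>2 * p) ((diam_Rn n K)\<^sup>2 / 9) \<le> r\<^sup>2"
      unfolding *[symmetric] r_def by (auto simp: min_def)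
    have "r\<^sup>2 \<le> (\<sigma> * sqrt p)\<^sup>2" using r by (intro power_mono) (auto simp: r_def)
    then show "r\<^sup>2 \<le> \<sigma>\<^sup>2 * p" by (simp add: *)
  qed
  obtain \<mu>1 where \<mu>1: "\<mu>1 \<in> K" "vdist n \<mu>1 k = r" using point_at_distance[OF r] by blast
  have kR: "k \<in> space (Rn n)" "\<mu>1 \<in> space (Rn n)" using centre \<mu>1 space by auto
  have "ennreal (r\<^sup>2 / 8) \<le> minimax_risk n K \<sigma> \<epsilon> N"
  proof (rule minimax_risk_geI)
    fix est :: "(nat \<Rightarrow> nat \<Rightarrow> real) \<Rightarrow> (nat \<Rightarrow> real)"
    let ?e = "est (\<lambda>j\<in>{..<N}. k)"
    have ex: "\<exists>\<mu>\<in>K. (vdist n \<mu> k)\<^sup>2 \<le> \<sigma>\<^sup>2 * p \<and> r\<^sup>2 / 8 \<le> (vdist n ?e \<mu>)\<^sup>2 / 2"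
    proof (cases "r / 2 \<le> vdist n ?e k")
      case True
      then have "(r / 2)\<^sup>2 \<le> (vdist n ?e k)\<^sup>2" using r by (intro power_mono) auto
      then show ?thesis using centre p by (intro bexI[of _ k]) (auto simp: power_divide)
    next
      case False
      have "r \<le> vdist n ?e \<mu>1 + vdist n ?e k"
        using vdist_triangle[of n \<mu>1 k ?e] \<mu>1 by (simp add: vdist_commute)
      then have "(r / 2)\<^sup>2 \<le> (vdist n ?e \<mu>1)\<^sup>2" using False r by (intro power_mono) auto
      then show ?thesis using \<mu>1 r2 by (intro bexI[of _ \<mu>1]) (auto simp: power_divide)
    qed
    then obtain \<mu> where \<mu>: "\<mu> \<in> K" "(vdist n \<mu> k)\<^sup>2 \<le> \<sigma>\<^sup>2 * p" "r\<^sup>2 / 8 \<le> (vdist n ?e \<mu>)\<^sup>2 / 2" by blast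
    obtain Q where Q: "law_in_model n (\<sigma>\<^sup>2) \<mu> Q" "ennreal ((vdist n ?e \<mu>)\<^sup>2 / 2)
      \<le> (\<integral>\<^sup>+X. ennreal ((vdist n (est (reset_adversary N \<epsilon> k X)) \<mu>)\<^sup>2) \<partial>PiM {..<N} (\<lambda>_. Q))"
      using reset_risk_ge[OF kR(1) _ \<mu>(2) assms(1-3) p_def, of est] \<mu>(1) space by blast
    show "\<exists>\<mu>\<in>K. \<exists>Q C. law_in_model n (\<sigma>\<^sup>2) \<mu> Q \<and> C \<in> adversaries n N \<epsilon> \<and>
      ennreal (r\<^sup>2 / 8) \<le> (\<integral>\<^sup>+X. ennreal ((vdist n (est (C X)) \<mu>)\<^sup>2) \<partial>PiM {..<N} (\<lambda>_. Q))"
    proof (intro bexI[of _ \<mu>] exI[of _ Q] exI[of _ "reset_adversary N \<epsilon> k"] conjI)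
      show "reset_adversary N \<epsilon> k \<in> adversaries n N \<epsilon>"
        using reset_adversary_in[OF kR(1)] assms by simp
    qed (rule \<mu>(1) Q(1) order_trans[OF ennreal_leI[OF \<mu>(3)] Q(2)])+
  qed
  moreover have "min (\<sigma>\<^sup>2 * max (1 / N) \<epsilon> / 2) ((diam_Rn n K)\<^sup>2 / 9) / 8 \<le> r\<^sup>2 / 8"
    using r2(1) by (simp add: p_def)
  ultimately show ?thesis by (meson ennreal_leI order_trans)
next
  case True
  have "0 \<le> \<sigma>\<^sup>2 * max (1 / N) \<epsilon> / 2" using assms by (simp add: le_max_iff_disj)
  then show ?thesis using True by (simp add: min_absorb2)
qed

end

section \<open>Packing lower bound\<close>

text \<open>Both measures agree on boxes. It is applied twice, over the coordinates of one
  observation and over the sample.\<close>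

lemma PiM_density:
  assumes I: "finite I" and M: "product_prob_space M" and Mf: "product_prob_space (\<lambda>i. density (M i) (f i))"
    and f: "\<And>i. i \<in> I \<Longrightarrow> f i \<in> borel_measurable (M i)"
  shows "PiM I (\<lambda>i. density (M i) (f i)) = density (PiM I M) (\<lambda>x. \<Prod>i\<in>I. f i (x i))"
proof -
  interpret M: product_prob_space M by fact
  interpret Mf: product_prob_space "\<lambda>i. density (M i) (f i)" by fact
  have [measurable]: "(\<lambda>x. f i (x i)) \<in> borel_measurable (PiM I M)" if "i \<in> I" for i
    by (rule measurable_compose[where f = "\<lambda>x. x i" and g = "f i", OF measurable_component_singleton[OF that, of M] f[OF that]])
  have "density (PiM I M) (\<lambda>x. \<Prod>i\<in>I. f i (x i)) = PiM I (\<lambda>i. density (M i) (f i))"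
  proof (rule Mf.PiM_eqI[OF I])
    show "sets (density (PiM I M) (\<lambda>x. \<Prod>i\<in>I. f i (x i))) = sets (PiM I (\<lambda>i. density (M i) (f i)))"
      unfolding sets_density by (intro sets_PiM_cong) auto
    fix A assume "\<And>i. i \<in> I \<Longrightarrow> A i \<in> sets (density (M i) (f i))"
    then have A: "A i \<in> sets (M i)" if "i \<in> I" for i using that by simp
    have ind: "indicator (Pi\<^sub>E I A) x = (\<Prod>i\<in>I. indicator (A i) (x i) :: ennreal)" if x: "x \<in> space (PiM I M)" for x
    proof (cases "x \<in> Pi\<^sub>E I A")
      case False
      then obtain i where "i \<in> I" "x i \<notin> A i" using x by (auto simp: space_PiM PiE_def)
      then have "(\<Prod>i\<in>I. indicator (A i) (x i) :: ennreal) = 0" using I by (auto intro!: prod_zero bexI[of _ i] simp: indicator_def)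
      then show ?thesis using False by simp
    qed (auto simp: PiE_def Pi_def)
    have "emeasure (density (PiM I M) (\<lambda>x. \<Prod>i\<in>I. f i (x i))) (Pi\<^sub>E I A)
      = (\<integral>\<^sup>+x. (\<Prod>i\<in>I. f i (x i)) * indicator (Pi\<^sub>E I A) x \<partial>PiM I M)"
      using I A by (intro emeasure_density sets_PiM_I_finite) auto
    also have "\<dots> = (\<integral>\<^sup>+x. (\<Prod>i\<in>I. f i (x i) * indicator (A i) (x i)) \<partial>PiM I M)"
      by (intro nn_integral_cong) (simp add: ind prod.distrib)
    also have "\<dots> = (\<Prod>i\<in>I. \<integral>\<^sup>+x. f i x * indicator (A i) x \<partial>M i)"
      using I A f by (intro M.product_nn_integral_prod) auto
    also have "\<dots> = (\<Prod>i\<in>I. emeasure (density (M i) (f i)) (A i))"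
      using A f by (intro prod.cong) (auto simp: emeasure_density)
    finally show "emeasure (density (PiM I M) (\<lambda>x. \<Prod>i\<in>I. f i (x i))) (Pi\<^sub>E I A)
      = (\<Prod>i\<in>I. emeasure (density (M i) (f i)) (A i))" .
  qed
  then show ?thesis ..
qed

text \<open>Fano-type bound without divergences: integrate \<open>L 1\<^sub>A \<le> (m/4) 1\<^sub>A + L\<^sup>2/m\<close> over the disjoint
  acceptance regions \<open>A\<close> of the \<open>m\<close> hypotheses.\<close>

lemma second_moment_testing:
  fixes L :: "(nat \<Rightarrow> real) \<Rightarrow> 'a \<Rightarrow> ennreal"
  assumes P0: "prob_space P0" and S: "finite S" "S \<noteq> {}" "separated n \<eta> S" "0 \<le> \<eta>"
    and L: "\<And>s. s \<in> S \<Longrightarrow> L s \<in> borel_measurable P0" "\<And>s x. s \<in> S \<Longrightarrow> L s x < \<infinity>"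
    and prob: "\<And>s. s \<in> S \<Longrightarrow> prob_space (density P0 (L s))"
    and second: "\<And>s. s \<in> S \<Longrightarrow> (\<integral>\<^sup>+x. (L s x)\<^sup>2 \<partial>P0) \<le> ennreal (card S / 4)"
    and g: "g \<in> measurable P0 (Rn n)"
  shows "\<exists>s\<in>S. ennreal (\<eta>\<^sup>2 / 8) \<le> (\<integral>\<^sup>+x. ennreal ((vdist n (g x) s)\<^sup>2) \<partial>density P0 (L s))"
proof -
  interpret P0: prob_space P0 by fact
  define m where "m = real (card S)"
  have m: "0 < m" using S by (simp add: m_def card_gt_0_iff)
  \<comment> \<open>Acceptance regions are balls of half the separation, hence disjoint.\<close>
  define A where "A s = {x \<in> space P0. vdist n (g x) s < \<eta> / 2}" for s
  have A [measurable]: "A s \<in> sets P0" for s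
    unfolding A_def using vdist_measurable[OF g, of s] by measurable
  have disj: "disjoint_family_on A S"
    unfolding disjoint_family_on_def
  proof (intro ballI impI)
    fix s t assume st: "s \<in> S" "t \<in> S" "s \<noteq> t"
    have "\<not> (vdist n (g x) s < \<eta> / 2 \<and> vdist n (g x) t < \<eta> / 2)" for x
      using vdist_triangle[of n s t "g x"] S(3) st vdist_commute[of n s "g x"] unfolding separated_def by force
    then show "A s \<inter> A t = {}" by (auto simp: A_def)
  qed
  \<comment> \<open>This is (l - m/2)^2 \<ge> 0 divided by m, restricted to the region by the
    indicator value \<open>i\<close>.\<close>
  have quad: "l * i \<le> ennreal (m / 4) * i + ennreal (1 / m) * l\<^sup>2" if "l < \<infinity>" "i = 0 \<or> i = 1" for l i :: ennreal
  proof -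
    obtain r where r: "l = ennreal r" "0 \<le> r" using \<open>l < \<infinity>\<close> by (cases l) auto
    have "0 \<le> (r - m / 2)\<^sup>2 / m" using m by simp
    also have "(r - m / 2)\<^sup>2 / m = m / 4 + 1 / m * r\<^sup>2 - r"
      using m by (simp add: power2_diff field_simps power2_eq_square)
    finally have "ennreal r \<le> ennreal (m / 4 + 1 / m * r\<^sup>2)" by (intro ennreal_leI) simp
    also have "\<dots> = ennreal (m / 4) + ennreal (1 / m) * (ennreal r)\<^sup>2"
      using m r by (simp add: ennreal_power ennreal_mult'[symmetric] flip: ennreal_plus)
    finally show ?thesis using that(2) r by auto
  qed
  have in_A: "emeasure (density P0 (L s)) (A s) \<le> ennreal (m / 4) * emeasure P0 (A s) + ennreal (1 / 4)" if "s \<in> S" for s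
  proof -
    have "emeasure (density P0 (L s)) (A s) = (\<integral>\<^sup>+x. L s x * indicator (A s) x \<partial>P0)"
      using L that by (intro emeasure_density) auto
    also have "\<dots> \<le> (\<integral>\<^sup>+x. ennreal (m / 4) * indicator (A s) x + ennreal (1 / m) * (L s x)\<^sup>2 \<partial>P0)"
      using L that by (intro nn_integral_mono quad) (auto simp: indicator_def)
    also have "\<dots> = ennreal (m / 4) * emeasure P0 (A s) + ennreal (1 / m) * (\<integral>\<^sup>+x. (L s x)\<^sup>2 \<partial>P0)"
      using L(1)[OF that] by (simp add: nn_integral_add nn_integral_cmult)
    also have "\<dots> \<le> ennreal (m / 4) * emeasure P0 (A s) + ennreal (1 / m) * ennreal (m / 4)"
      using second[OF that] by (intro add_left_mono mult_left_mono) (auto simp: m_def)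
    also have "ennreal (1 / m) * ennreal (m / 4) = ennreal (1 / 4)"
      using m by (simp add: ennreal_mult'[symmetric])
    finally show ?thesis .
  qed
  have "(\<Sum>s\<in>S. emeasure P0 (A s)) = emeasure P0 (\<Union>s\<in>S. A s)"
    using S disj by (intro sum_emeasure) auto
  also have "\<dots> \<le> 1" by (rule P0.emeasure_le_1)
  finally have sumA: "(\<Sum>s\<in>S. emeasure P0 (A s)) \<le> 1" .
  \<comment> \<open>Disjointness bounds the sum over all hypotheses by m/4 + m/4, so the average
    acceptance probability is at most 1/2.\<close>
  have "\<exists>s\<in>S. emeasure (density P0 (L s)) (A s) \<le> ennreal (1 / 2)"
  proof (rule ccontr)
    assume "\<not> ?thesis"
    then have big: "ennreal (1 / 2) < emeasure (density P0 (L s)) (A s)" if "s \<in> S" for s using that by (auto simp: not_le)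
    have real: "emeasure (density P0 (L s)) (A s) = ennreal (measure (density P0 (L s)) (A s))" if "s \<in> S" for s
    proof -
      interpret prob_space "density P0 (L s)" by (rule prob[OF that])
      show ?thesis by (rule emeasure_eq_measure)
    qed
    have "(\<Sum>s\<in>S. 1 / 2) < (\<Sum>s\<in>S. measure (density P0 (L s)) (A s))"
    proof (rule sum_strict_mono)
      fix s assume "s \<in> S"
      then have "ennreal (1 / 2) < ennreal (measure (density P0 (L s)) (A s))" using big[of s] by (simp only: real)
      then show "1 / 2 < measure (density P0 (L s)) (A s)" by (subst (asm) ennreal_less_iff) auto
    qed (use S in auto)
    moreover have "ennreal (\<Sum>s\<in>S. measure (density P0 (L s)) (A s)) \<le> ennreal (m / 2)"
    proof -
      have "ennreal (\<Sum>s\<in>S. measure (density P0 (L s)) (A s)) = (\<Sum>s\<in>S. emeasure (density P0 (L s)) (A s))"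
        by (subst sum_ennreal[symmetric]) (auto simp: real)
      also have "\<dots> \<le> (\<Sum>s\<in>S. ennreal (m / 4) * emeasure P0 (A s) + ennreal (1 / 4))"
        by (intro sum_mono in_A)
      also have "\<dots> = ennreal (m / 4) * (\<Sum>s\<in>S. emeasure P0 (A s)) + ennreal (m / 4)"
        by (simp add: sum.distrib sum_distrib_left m_def ennreal_of_nat_eq_real_of_nat ennreal_mult'[symmetric])
      also have "\<dots> \<le> ennreal (m / 4) * 1 + ennreal (m / 4)"
        by (intro add_right_mono mult_left_mono sumA) auto
      also have "\<dots> = ennreal (m / 2)" using m by (simp flip: ennreal_plus)
      finally show ?thesis .
    qed
    then have "(\<Sum>s\<in>S. measure (density P0 (L s)) (A s)) \<le> m / 2" using m by simp
    ultimately show False by (simp add: m_def)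
  qed
  then obtain s where s: "s \<in> S" "emeasure (density P0 (L s)) (A s) \<le> ennreal (1 / 2)" by blast
  interpret Ps: prob_space "density P0 (L s)" by (rule prob[OF s(1)])
  have "ennreal (Ps.prob (A s)) \<le> ennreal (1 / 2)" using s(2) by (simp only: Ps.emeasure_eq_measure)
  then have "Ps.prob (A s) \<le> 1 / 2" by (subst (asm) ennreal_le_iff) simp
  then have far: "1 / 2 \<le> Ps.prob (space P0 - A s)" using Ps.prob_compl[of "A s"] by simp
  have "ennreal (\<eta>\<^sup>2 / 8) \<le> ennreal ((\<eta> / 2)\<^sup>2 * Ps.prob (space P0 - A s))"
    using mult_left_mono[OF far, of "(\<eta> / 2)\<^sup>2"] by (intro ennreal_leI) (simp add: power_divide)
  also have "\<dots> = (\<integral>\<^sup>+x. ennreal ((\<eta> / 2)\<^sup>2) * indicator (space P0 - A s) x \<partial>density P0 (L s))"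
    by (subst nn_integral_cmult_indicator) (auto simp: Ps.emeasure_eq_measure ennreal_mult')
  also have "\<dots> \<le> (\<integral>\<^sup>+x. ennreal ((vdist n (g x) s)\<^sup>2) \<partial>density P0 (L s))"
  proof (intro nn_integral_mono)
    fix x
    have "(\<eta> / 2)\<^sup>2 \<le> (vdist n (g x) s)\<^sup>2" if "x \<in> space P0 - A s"
      using that S(4) by (intro power_mono) (auto simp: A_def)
    then show "ennreal ((\<eta> / 2)\<^sup>2) * indicator (space P0 - A s) x \<le> ennreal ((vdist n (g x) s)\<^sup>2)"
      by (auto simp: indicator_def intro: ennreal_leI)
  qed
  finally show ?thesis using s(1) by blast
qed

section \<open>Biased two-point coins\<close>

definition coin :: "real \<Rightarrow> real \<Rightarrow> real measure" where
  "coin \<sigma> y = distr (measure_pmf (bernoulli_pmf (1 / 2))) borel (\<lambda>b. if b then y + \<sigma> else y - \<sigma>)"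

text \<open>Likelihood ratio of the biased coin with mean y + \<theta> against the fair one: linear,
  with values 1 + \<theta>/\<sigma> and 1 - \<theta>/\<sigma> at the atoms. Biasing only lowers the
  variance, to \<sigma>^2 - \<theta>^2, so the law stays in the model.\<close>

definition tilt :: "real \<Rightarrow> real \<Rightarrow> real \<Rightarrow> real \<Rightarrow> real" where
  "tilt \<sigma> y \<theta> x = 1 + \<theta> * (x - y) / \<sigma>\<^sup>2"

abbreviation biased :: "real \<Rightarrow> real \<Rightarrow> real \<Rightarrow> real measure" where
  "biased \<sigma> y \<theta> \<equiv> density (coin \<sigma> y) (\<lambda>x. ennreal (tilt \<sigma> y \<theta> x))"

lemma tilt_measurable [measurable]: "tilt \<sigma> y \<theta> \<in> borel_measurable borel"
  unfolding tilt_def[abs_def] by measurable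

lemma sets_coin [simp, measurable_cong]: "sets (coin \<sigma> y) = sets borel"
  by (simp add: coin_def)

lemma space_coin [simp]: "space (coin \<sigma> y) = UNIV"
  by (simp add: coin_def)

lemma measurable_coin [simp]: "measurable (coin \<sigma> y) M = measurable borel M"
  by (rule measurable_cong_sets) simp_all

lemma prob_space_coin: "prob_space (coin \<sigma> y)"
  unfolding coin_def by (rule prob_space.prob_space_distr[OF prob_space_measure_pmf]) simp

lemma nn_integral_coin:
  assumes "f \<in> borel_measurable borel"
  shows "(\<integral>\<^sup>+x. f x \<partial>coin \<sigma> y) = f (y + \<sigma>) * ennreal (1 / 2) + f (y - \<sigma>) * ennreal (1 / 2)"
  unfolding coin_def using assms
  by (subst nn_integral_distr) (auto simp: nn_integral_bernoulli_pmf)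

lemma tilt_atoms:
  assumes "0 < \<sigma>"
  shows "tilt \<sigma> y \<theta> (y + \<sigma>) = 1 + \<theta> / \<sigma>" "tilt \<sigma> y \<theta> (y - \<sigma>) = 1 - \<theta> / \<sigma>"
  using assms by (auto simp: tilt_def power2_eq_square)

lemma ratio_bounds:
  fixes \<theta> \<sigma> :: real
  assumes "0 < \<sigma>" "\<bar>\<theta>\<bar> \<le> \<sigma>"
  shows "- 1 \<le> \<theta> / \<sigma>" "\<theta> / \<sigma> \<le> 1"
  using assms by (auto simp: field_simps abs_le_iff)

lemma prob_space_biased:
  assumes "0 < \<sigma>" "\<bar>\<theta>\<bar> \<le> \<sigma>"
  shows "prob_space (biased \<sigma> y \<theta>)"
proof (rule prob_spaceI)
  have half: "0 \<le> (1 / 2 :: real)" by simp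
  have "emeasure (biased \<sigma> y \<theta>) (space (biased \<sigma> y \<theta>)) = (\<integral>\<^sup>+x. ennreal (tilt \<sigma> y \<theta> x) \<partial>coin \<sigma> y)"
    by (subst emeasure_density) auto
  also have "\<dots> = ennreal ((1 + \<theta> / \<sigma>) * (1 / 2)) + ennreal ((1 - \<theta> / \<sigma>) * (1 / 2))"
    by (subst nn_integral_coin) (measurable, simp only: tilt_atoms[OF assms(1)] ennreal_mult''[OF half])
  also have "\<dots> = ennreal ((1 + \<theta> / \<sigma>) * (1 / 2) + (1 - \<theta> / \<sigma>) * (1 / 2))"
    using ratio_bounds[OF assms] by (intro ennreal_plus[symmetric]) auto
  also have "\<dots> = 1" by (simp add: field_simps)
  finally show "emeasure (biased \<sigma> y \<theta>) (space (biased \<sigma> y \<theta>)) = 1" .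
qed

lemma integral_biased:
  fixes f :: "real \<Rightarrow> real"
  assumes "0 < \<sigma>" "\<bar>\<theta>\<bar> \<le> \<sigma>" and f: "f \<in> borel_measurable borel"
  shows "integrable (biased \<sigma> y \<theta>) f"
    and "(\<integral>x. f x \<partial>biased \<sigma> y \<theta>) = (1 + \<theta> / \<sigma>) / 2 * f (y + \<sigma>) + (1 - \<theta> / \<sigma>) / 2 * f (y - \<sigma>)"
proof -
  have meas: "(\<lambda>b. if b then y + \<sigma> else y - \<sigma>) \<in> measurable (measure_pmf (bernoulli_pmf (1 / 2))) borel" by simp
  \<comment> \<open>Away from the atoms \<open>tilt\<close> may be negative, where
    \<open>ennreal\<close> truncates it; under the coin this happens with probability 0.\<close>
  have AE: "AE x in coin \<sigma> y. 0 \<le> tilt \<sigma> y \<theta> x"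
    unfolding coin_def using tilt_atoms[OF assms(1)] ratio_bounds[OF assms(1,2)]
    by (subst AE_distr_iff[OF meas]) auto
  have "integrable (coin \<sigma> y) (\<lambda>x. tilt \<sigma> y \<theta> x * f x)"
    unfolding coin_def using f
    by (subst integrable_distr_eq[OF meas]) (auto intro: integrable_measure_pmf_finite)
  then show "integrable (biased \<sigma> y \<theta>) f"
    using f AE by (subst integrable_density) auto
  have "(\<integral>x. f x \<partial>biased \<sigma> y \<theta>) = (\<integral>x. tilt \<sigma> y \<theta> x * f x \<partial>coin \<sigma> y)"
    using f AE by (subst integral_density) auto
  also have "\<dots> = (\<integral>b. (\<lambda>x. tilt \<sigma> y \<theta> x * f x) (if b then y + \<sigma> else y - \<sigma>) \<partial>measure_pmf (bernoulli_pmf (1 / 2)))"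
    unfolding coin_def using f by (subst integral_distr[OF meas]) auto
  also have "\<dots> = (1 + \<theta> / \<sigma>) / 2 * f (y + \<sigma>) + (1 - \<theta> / \<sigma>) / 2 * f (y - \<sigma>)"
    by (subst integral_bernoulli_pmf) (auto simp: tilt_atoms[OF assms(1)])
  finally show "(\<integral>x. f x \<partial>biased \<sigma> y \<theta>) = (1 + \<theta> / \<sigma>) / 2 * f (y + \<sigma>) + (1 - \<theta> / \<sigma>) / 2 * f (y - \<sigma>)" .
qed

lemma biased_moments:
  assumes "0 < \<sigma>" "\<bar>\<theta>\<bar> \<le> \<sigma>"
  shows "(\<integral>x. x \<partial>biased \<sigma> y \<theta>) = y + \<theta>" "(\<integral>x. x - (y + \<theta>) \<partial>biased \<sigma> y \<theta>) = 0"
    "(\<integral>x. (x - (y + \<theta>))\<^sup>2 \<partial>biased \<sigma> y \<theta>) \<le> \<sigma>\<^sup>2"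
proof -
  show "(\<integral>x. x \<partial>biased \<sigma> y \<theta>) = y + \<theta>"
    using assms by (subst integral_biased) (auto simp: field_simps)
  show "(\<integral>x. x - (y + \<theta>) \<partial>biased \<sigma> y \<theta>) = 0"
    using assms by (subst integral_biased) (auto simp: field_simps)
  have "(\<integral>x. (x - (y + \<theta>))\<^sup>2 \<partial>biased \<sigma> y \<theta>) = \<sigma>\<^sup>2 - \<theta>\<^sup>2"
    using assms by (subst integral_biased) (auto simp: field_simps power2_eq_square)
  then show "(\<integral>x. (x - (y + \<theta>))\<^sup>2 \<partial>biased \<sigma> y \<theta>) \<le> \<sigma>\<^sup>2" by simp
qed

lemma nn_integral_tilt_square:
  assumes "0 < \<sigma>" "\<bar>\<theta>\<bar> \<le> \<sigma>"
  shows "(\<integral>\<^sup>+x. (ennreal (tilt \<sigma> y \<theta> x))\<^sup>2 \<partial>coin \<sigma> y) = ennreal (1 + \<theta>\<^sup>2 / \<sigma>\<^sup>2)"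
proof -
  have half: "0 \<le> (1 / 2 :: real)" by simp
  have sq: "(ennreal (1 + \<theta> / \<sigma>))\<^sup>2 = ennreal ((1 + \<theta> / \<sigma>)\<^sup>2)" "(ennreal (1 - \<theta> / \<sigma>))\<^sup>2 = ennreal ((1 - \<theta> / \<sigma>)\<^sup>2)"
    using ratio_bounds[OF assms] by (auto intro!: ennreal_power)
  have "(\<integral>\<^sup>+x. (ennreal (tilt \<sigma> y \<theta> x))\<^sup>2 \<partial>coin \<sigma> y)
    = ennreal ((1 + \<theta> / \<sigma>)\<^sup>2 * (1 / 2)) + ennreal ((1 - \<theta> / \<sigma>)\<^sup>2 * (1 / 2))"
    by (subst nn_integral_coin) (measurable, simp only: tilt_atoms[OF assms(1)] ennreal_mult''[OF half] sq)
  also have "\<dots> = ennreal ((1 + \<theta> / \<sigma>)\<^sup>2 * (1 / 2) + (1 - \<theta> / \<sigma>)\<^sup>2 * (1 / 2))"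
    by (intro ennreal_plus[symmetric]) auto
  also have "(1 + \<theta> / \<sigma>)\<^sup>2 * (1 / 2) + (1 - \<theta> / \<sigma>)\<^sup>2 * (1 / 2) = 1 + \<theta>\<^sup>2 / \<sigma>\<^sup>2"
  proof -
    have "(1 + t)\<^sup>2 * (1 / 2) + (1 - t)\<^sup>2 * (1 / 2) = 1 + t\<^sup>2" for t :: real
      by (simp add: power2_eq_square field_simps)
    then show ?thesis by (simp only: power_divide)
  qed
  finally show ?thesis .
qed

text \<open>Independence makes the covariance diagonal with entries at most \<sigma>^2, so the bound
  holds in every direction without a dimension factor.\<close>

lemma biased_product_law:
  fixes \<sigma> :: real
  assumes "0 < \<sigma>" and \<theta>: "\<And>i. \<bar>\<theta> i\<bar> \<le> \<sigma>" and \<mu>: "\<mu> \<in> space (Rn n)" "\<And>i. i < n \<Longrightarrow> \<mu> i = y i + \<theta> i"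
  shows "law_in_model n (\<sigma>\<^sup>2) \<mu> (PiM {..<n} (\<lambda>i. biased \<sigma> (y i) (\<theta> i)))"
proof -
  define B where "B i = biased \<sigma> (y i) (\<theta> i)" for i
  define Q where "Q = PiM {..<n} B"
  interpret B: product_prob_space B
    unfolding B_def by (intro product_prob_spaceI prob_space_biased assms)
  interpret Q: prob_space Q unfolding Q_def by (intro prob_space_PiM B.prob_space)
  have sets_B [measurable_cong]: "sets (B i) = sets borel" for i by (simp add: B_def)
  have sets_Q: "sets Q = sets (Rn n)"
    unfolding Q_def Rn_def by (intro sets_PiM_cong) (auto simp: sets_B)
  have comp: "(\<lambda>x. x i) \<in> measurable Q (B i)" if "i < n" for i
    unfolding Q_def using that by (intro measurable_component_singleton) simp
  have dist: "distr Q (B i) (\<lambda>x. x i) = B i" if "i < n" for i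
    unfolding Q_def using that by (intro distr_PiM_component B.prob_space) simp
  have intB: "integrable (B i) f" if "f \<in> borel_measurable borel" for i and f :: "real \<Rightarrow> real"
    unfolding B_def using that assms by (intro integral_biased) auto
  have intQ: "integrable Q (\<lambda>x. f (x i))" if "i < n" "f \<in> borel_measurable borel" for i and f :: "real \<Rightarrow> real"
    using intB[OF that(2), of i] that dist[OF that(1)] integrable_distr_eq[OF comp[OF that(1)], of f] sets_B
    by (simp cong: measurable_cong_sets)
  have mean: "(\<integral>x. x i \<partial>Q) = \<mu> i" if "i < n" for i
  proof -
    have "(\<integral>x. x i \<partial>Q) = (\<integral>x. x \<partial>distr Q (B i) (\<lambda>x. x i))"
      using measurable_ident_sets[OF sets_B] by (subst integral_distr[OF comp[OF that]]) auto
    then show ?thesis using dist[OF that] biased_moments(1)[OF assms(1) \<theta>] \<mu>(2)[OF that] by (simp add: B_def)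
  qed
  define z where "z i x = x - \<mu> i" for i and x :: real
  have zm [measurable]: "z i \<in> borel_measurable borel" for i unfolding z_def[abs_def] by measurable
  have cross: "integrable Q (\<lambda>x. z i (x i) * z j (x j))"
    "(\<integral>x. z i (x i) * z j (x j) \<partial>Q) = (if i = j then \<integral>x. (z i x)\<^sup>2 \<partial>B i else 0)" if "i < n" "j < n" for i j
  proof -
    \<comment> \<open>The product of two coordinates is written as a product over all coordinates
      with trivial factors 1, so that integrals factorise and i = j needs no separate
      set-up.\<close>
    define f where "f l x = (if l = i then z l x else 1) * (if l = j then z l x else 1)" for l x
    have f: "integrable (B l) (f l)" for l by (intro intB) (simp add: f_def[abs_def])
    have eq: "(\<Prod>l<n. f l (x l)) = z i (x i) * z j (x j)" for x
      using that by (simp add: f_def prod.distrib prod.delta)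
    have "integrable Q (\<lambda>x. \<Prod>l<n. f l (x l))"
      unfolding Q_def using f by (intro B.product_integrable_prod) auto
    then show "integrable Q (\<lambda>x. z i (x i) * z j (x j))" by (simp add: eq)
    have "(\<integral>x. z i (x i) * z j (x j) \<partial>Q) = (\<Prod>l<n. integral\<^sup>L (B l) (f l))"
      unfolding eq[symmetric] Q_def using f by (intro B.product_integral_prod) auto
    also have "\<dots> = (if i = j then \<integral>x. (z i x)\<^sup>2 \<partial>B i else 0)"
    proof (cases "i = j")
      case True
      have "integral\<^sup>L (B l) (f l) = (if l = i then \<integral>x. (z i x)\<^sup>2 \<partial>B i else 1)" for l
        using True B.prob_space[of l] prob_space.prob_space[OF B.prob_space] by (simp add: f_def[abs_def] power2_eq_square)
      then show ?thesis using True that by (simp add: prod.delta)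
    next
      case False
      have "integral\<^sup>L (B i) (f i) = (\<integral>x. x - (y i + \<theta> i) \<partial>B i)"
        using False \<mu>(2)[OF that(1)] by (simp add: f_def[abs_def] z_def)
      also have "\<dots> = 0" unfolding B_def by (rule biased_moments(2)[OF assms(1) \<theta>])
      finally have "\<exists>l\<in>{..<n}. integral\<^sup>L (B l) (f l) = 0" using that by auto
      then show ?thesis using False by (simp add: prod_zero_iff)
    qed
    finally show "(\<integral>x. z i (x i) * z j (x j) \<partial>Q) = (if i = j then \<integral>x. (z i x)\<^sup>2 \<partial>B i else 0)" .
  qed
  have "(\<integral>x. (vinner n v (\<lambda>i. x i - \<mu> i))\<^sup>2 \<partial>Q) \<le> \<sigma>\<^sup>2 * vinner n v v" for v
  proof -
    have "(\<integral>x. (vinner n v (\<lambda>i. x i - \<mu> i))\<^sup>2 \<partial>Q) = (\<integral>x. (\<Sum>i<n. \<Sum>j<n. (v i * v j) * (z i (x i) * z j (x j))) \<partial>Q)"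
      by (simp add: vinner_def z_def power2_eq_square sum_product mult_ac)
    also have "\<dots> = (\<Sum>i<n. \<Sum>j<n. (v i * v j) * (\<integral>x. z i (x i) * z j (x j) \<partial>Q))"
      using cross(1) by (subst Bochner_Integration.integral_sum)
        (auto intro!: sum.cong Bochner_Integration.integrable_sum simp: Bochner_Integration.integral_sum)
    also have "\<dots> = (\<Sum>i<n. \<Sum>j<n. if i = j then (v i * v j) * (\<integral>x. (z i x)\<^sup>2 \<partial>B i) else 0)"
      by (intro sum.cong) (auto simp: cross(2))
    also have "\<dots> = (\<Sum>i<n. (v i)\<^sup>2 * (\<integral>x. (z i x)\<^sup>2 \<partial>B i))"
      by (simp add: power2_eq_square)
    also have "\<dots> \<le> (\<Sum>i<n. (v i)\<^sup>2 * \<sigma>\<^sup>2)"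
    proof (intro sum_mono mult_left_mono)
      fix i assume "i \<in> {..<n}"
      then show "(\<integral>x. (z i x)\<^sup>2 \<partial>B i) \<le> \<sigma>\<^sup>2"
        using biased_moments(3)[OF assms(1) \<theta>, of "y i" i] \<mu>(2)[of i] by (simp add: z_def B_def)
    qed simp
    also have "\<dots> = \<sigma>\<^sup>2 * vinner n v v" by (simp add: vinner_def sum_distrib_left power2_eq_square mult_ac)
    finally show ?thesis .
  qed
  then have "law_in_model n (\<sigma>\<^sup>2) \<mu> Q"
    using Q.prob_space_axioms sets_Q \<mu>(1) mean intQ[of _ "\<lambda>x. x"] intQ[of _ "\<lambda>x. x\<^sup>2"] by (simp add: law_in_model_def)
  then show ?thesis by (simp add: Q_def B_def[abs_def])
qed

lemma abs_diff_le_vdist: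
  assumes "i < n"
  shows "\<bar>x i - y i\<bar> \<le> vdist n x y"
proof -
  have "(x i - y i)\<^sup>2 \<le> (vdist n x y)\<^sup>2"
    unfolding vdist_square using assms by (intro member_le_sum) auto
  then show ?thesis by (simp add: abs_le_square_iff[symmetric])
qed

lemma id_adversary: "0 \<le> \<epsilon> \<Longrightarrow> (\<lambda>X. X) \<in> adversaries n N \<epsilon>"
  by (simp add: adversaries_def)

text \<open>The shrunk packing supplies the hypotheses, with the coins centred at the shrunk
  \<open>\<nu>\<close>. Halving divides the exponent of the likelihood second moment by 4, so the
  budget ln (card S) becomes a quarter of it and leaves room for the factor 1/4 demanded by
  \<open>second_moment_testing\<close>. The bound is (\<delta>/(2 c))^2 / 8.\<close>

lemma (in star_set) minimax_risk_ge_packing: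
  fixes \<sigma> \<epsilon> c \<delta> :: real
  assumes "\<nu> \<in> K" "finite S" "S \<subseteq> {x. vdist n x \<nu> \<le> \<delta>} \<inter> K" "separated n (\<delta> / c) S" "16 \<le> card S"
    and budget: "real N * \<delta>\<^sup>2 / \<sigma>\<^sup>2 \<le> ln (card S)" and "0 < \<delta>" "\<delta> \<le> \<sigma>" "0 < c" "0 \<le> \<epsilon>"
  shows "ennreal (\<delta>\<^sup>2 / (32 * c\<^sup>2)) \<le> minimax_risk n K \<sigma> \<epsilon> N"
proof (rule minimax_risk_geI)
  fix est assume est: "est \<in> estimators n N"
  define T where "T = segment_point n k (1 / 2) ` S"
  define y where "y = segment_point n k (1 / 2) \<nu>"
  have half: "0 < (1 / 2 :: real)" "1 / 2 \<le> (1 :: real)" by auto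
  note shrink = shrink_packing[OF half assms(1,3,4), folded T_def y_def]
  have \<sigma>: "0 < \<sigma>" using assms by simp
  \<comment> \<open>The value 0 beyond the dimension keeps every coin admissible, since the product
    laws are families over all naturals.\<close>
  define \<theta> where "\<theta> s i = (if i < n then s i - y i else 0)" for s i
  have \<theta>: "\<bar>\<theta> s i\<bar> \<le> \<sigma>" if "s \<in> T" for s i
  proof (cases "i < n")
    case True
    then have "\<bar>\<theta> s i\<bar> \<le> vdist n s y" using abs_diff_le_vdist by (simp add: \<theta>_def)
    also have "\<dots> \<le> 1 / 2 * \<delta>" using shrink(2) that by auto
    finally show ?thesis using assms by simp
  qed (use \<sigma> in \<open>simp add: \<theta>_def\<close>)
  define B0 where "B0 = PiM {..<n} (\<lambda>i. coin \<sigma> (y i))"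
  define P0 where "P0 = PiM {..<N} (\<lambda>_. B0)"
  define dens where "dens s x = (\<Prod>i<n. ennreal (tilt \<sigma> (y i) (\<theta> s i) (x i)))" for s and x :: "nat \<Rightarrow> real"
  define L where "L s X = (\<Prod>j<N. dens s (X j))" for s and X :: "nat \<Rightarrow> nat \<Rightarrow> real"
  define Q where "Q s = PiM {..<n} (\<lambda>i. biased \<sigma> (y i) (\<theta> s i))" for s
  have coin: "product_prob_space (\<lambda>i. coin \<sigma> (y i))" by (intro product_prob_spaceI prob_space_coin)
  have prob_B0: "prob_space B0" unfolding B0_def by (intro prob_space_PiM prob_space_coin)
  have prod_B0: "product_prob_space (\<lambda>_::nat. B0)" by (intro product_prob_spaceI prob_B0)
  have prob_P0: "prob_space P0" unfolding P0_def by (intro prob_space_PiM prob_B0)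
  have sets_B0: "sets B0 = sets (Rn n)" unfolding B0_def Rn_def by (intro sets_PiM_cong) auto
  have sets_P0: "sets P0 = sets (sample_space n N)"
    unfolding P0_def sample_space_def using sets_B0 by (intro sets_PiM_cong) auto
  have tilt_comp: "(\<lambda>x. ennreal (tilt \<sigma> (y i) (\<theta> s i) (x i))) \<in> borel_measurable B0" if "i \<in> {..<n}" for i s
  proof -
    have "(\<lambda>x. x i) \<in> measurable B0 borel" using component_measurable[of i n] that sets_B0 by (simp cong: measurable_cong_sets)
    then show ?thesis by measurable
  qed
  have dens: "dens s \<in> borel_measurable B0" for s
    unfolding dens_def[abs_def] by (rule borel_measurable_prod_ennreal) (rule tilt_comp)
  have L: "L s \<in> borel_measurable P0" for s
  proof -
    have "(\<lambda>X. dens s (X j)) \<in> borel_measurable (PiM {..<N} (\<lambda>_. B0))" if "j \<in> {..<N}" for j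
      by (rule measurable_compose[OF measurable_component_singleton[OF that, of "\<lambda>_. B0"] dens])
    then show ?thesis unfolding L_def[abs_def] P0_def by (rule borel_measurable_prod_ennreal)
  qed
  have L_finite: "L s X < \<infinity>" for s X
    by (simp add: L_def dens_def prod_ennreal less_top[symmetric] ennreal_prod_eq_top)
  have Q: "prob_space (Q s)" "Q s = density B0 (dens s)" if "s \<in> T" for s
  proof -
    have biased: "prob_space (biased \<sigma> (y i) (\<theta> s i))" for i using \<theta>[OF that] \<sigma> by (intro prob_space_biased)
    show "prob_space (Q s)" unfolding Q_def by (intro prob_space_PiM biased)
    show "Q s = density B0 (dens s)" unfolding Q_def B0_def dens_def[abs_def]
      by (rule PiM_density[OF _ coin]) (auto intro: product_prob_spaceI biased)
  qed
  have PQ: "PiM {..<N} (\<lambda>_. Q s) = density P0 (L s)" if "s \<in> T" for s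
    unfolding P0_def L_def[abs_def] Q(2)[OF that]
    by (rule PiM_density[OF _ prod_B0]) (use dens Q[OF that] in \<open>auto intro: product_prob_spaceI\<close>)
  have second: "(\<integral>\<^sup>+X. (L s X)\<^sup>2 \<partial>P0) \<le> ennreal (card T / 4)" if s: "s \<in> T" for s
  proof -
    interpret coin: product_prob_space "\<lambda>i. coin \<sigma> (y i)" by (rule coin)
    interpret B0: product_prob_space "\<lambda>_::nat. B0" by (rule prod_B0)
    have "(\<integral>\<^sup>+x. (dens s x)\<^sup>2 \<partial>B0) = (\<integral>\<^sup>+x. (\<Prod>i<n. (ennreal (tilt \<sigma> (y i) (\<theta> s i) (x i)))\<^sup>2) \<partial>B0)"
      by (simp add: dens_def prod_power_distrib)
    also have "\<dots> = (\<Prod>i<n. \<integral>\<^sup>+x. (ennreal (tilt \<sigma> (y i) (\<theta> s i) x))\<^sup>2 \<partial>coin \<sigma> (y i))"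
      unfolding B0_def by (rule coin.product_nn_integral_prod) auto
    also have "\<dots> = (\<Prod>i<n. ennreal (1 + (\<theta> s i)\<^sup>2 / \<sigma>\<^sup>2))"
      using \<sigma> \<theta>[OF s] by (intro prod.cong nn_integral_tilt_square) auto
    also have "\<dots> = ennreal (\<Prod>i<n. 1 + (\<theta> s i)\<^sup>2 / \<sigma>\<^sup>2)"
      by (rule prod_ennreal) (auto intro: add_nonneg_nonneg)
    also have "\<dots> \<le> ennreal (\<Prod>i<n. exp ((\<theta> s i)\<^sup>2 / \<sigma>\<^sup>2))"
      by (intro ennreal_leI prod_mono) (auto intro: exp_ge_add_one_self)
    also have "\<dots> = ennreal (exp (\<Sum>i<n. (\<theta> s i)\<^sup>2 / \<sigma>\<^sup>2))"
      by (simp add: exp_sum)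
    also have "(\<Sum>i<n. (\<theta> s i)\<^sup>2 / \<sigma>\<^sup>2) = (vdist n s y)\<^sup>2 / \<sigma>\<^sup>2"
      by (simp add: vdist_square \<theta>_def sum_divide_distrib)
    finally have one: "(\<integral>\<^sup>+x. (dens s x)\<^sup>2 \<partial>B0) \<le> ennreal (exp ((vdist n s y)\<^sup>2 / \<sigma>\<^sup>2))" .
    have "(\<integral>\<^sup>+X. (L s X)\<^sup>2 \<partial>P0) = (\<integral>\<^sup>+X. (\<Prod>j<N. (dens s (X j))\<^sup>2) \<partial>P0)"
      by (simp add: L_def prod_power_distrib)
    also have "\<dots> = (\<integral>\<^sup>+x. (dens s x)\<^sup>2 \<partial>B0) ^ N"
      unfolding P0_def using dens by (subst B0.product_nn_integral_prod) auto
    also have "\<dots> \<le> ennreal (exp ((vdist n s y)\<^sup>2 / \<sigma>\<^sup>2)) ^ N" using one by (intro power_mono) auto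
    also have "\<dots> = ennreal (exp (N * ((vdist n s y)\<^sup>2 / \<sigma>\<^sup>2)))"
      by (simp add: ennreal_power exp_of_nat_mult[symmetric])
    also have "\<dots> \<le> ennreal (card T / 4)"
    proof (intro ennreal_leI)
      have "vdist n s y \<le> 1 / 2 * \<delta>" using shrink(2) s by auto
      then have "(vdist n s y)\<^sup>2 \<le> (1 / 2 * \<delta>)\<^sup>2" by (intro power_mono) auto
      then have "N * ((vdist n s y)\<^sup>2 / \<sigma>\<^sup>2) \<le> N * ((1 / 2 * \<delta>)\<^sup>2 / \<sigma>\<^sup>2)"
        by (intro mult_left_mono divide_right_mono) auto
      also have "\<dots> = real N * \<delta>\<^sup>2 / \<sigma>\<^sup>2 / 4" by (simp add: power_divide)
      also have "\<dots> \<le> ln (card S) / 4" using budget by simp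
      \<comment> \<open>From card S \<ge> 16 follows 2 ln 4 \<le> ln (card S), more than the 4/3 ln
        4 needed.\<close>
      also have "\<dots> \<le> ln (card S) - ln 4"
      proof -
        have "2 * ln 4 = ln ((4 :: real) ^ 2)" by (subst ln_realpow) auto
        also have "\<dots> \<le> ln (card S)" using assms(5) by (subst ln_le_cancel_iff) auto
        finally have "2 * ln 4 \<le> ln (real (card S))" .
        moreover have "0 \<le> ln (4 :: real)" by simp
        ultimately show ?thesis by linarith
      qed
      also have "\<dots> = ln (card S / 4)" using assms(5) by (subst ln_div) auto
      finally have "exp (N * ((vdist n s y)\<^sup>2 / \<sigma>\<^sup>2)) \<le> exp (ln (card S / 4))" by (subst exp_le_cancel_iff)
      then show "exp (N * ((vdist n s y)\<^sup>2 / \<sigma>\<^sup>2)) \<le> card T / 4" using assms(5) shrink(4) by simp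
    qed
    finally show ?thesis .
  qed
  have "\<exists>s\<in>T. ennreal ((1 / 2 * (\<delta> / c))\<^sup>2 / 8) \<le> (\<integral>\<^sup>+X. ennreal ((vdist n (est X) s)\<^sup>2) \<partial>density P0 (L s))"
  proof (rule second_moment_testing[OF prob_P0 _ _ shrink(3)])
    show "prob_space (density P0 (L s))" if "s \<in> T" for s
      using PQ[OF that] Q(1)[OF that] by (metis prob_space_PiM)
    show "est \<in> measurable P0 (Rn n)"
      using est sets_P0 by (simp add: estimators_def cong: measurable_cong_sets)
  qed (use assms L L_finite second in \<open>auto simp: T_def\<close>)
  then obtain s where s: "s \<in> T"
    "ennreal ((1 / 2 * (\<delta> / c))\<^sup>2 / 8) \<le> (\<integral>\<^sup>+X. ennreal ((vdist n (est X) s)\<^sup>2) \<partial>PiM {..<N} (\<lambda>_. Q s))"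
    using PQ by auto
  have "s \<in> K" using s(1) shrink(2) by auto
  moreover have "law_in_model n (\<sigma>\<^sup>2) s (Q s)"
    unfolding Q_def using \<sigma> \<theta>[OF s(1)] \<open>s \<in> K\<close> space by (intro biased_product_law) (auto simp: \<theta>_def)
  moreover have "(1 / 2 * (\<delta> / c))\<^sup>2 / 8 = \<delta>\<^sup>2 / (32 * c\<^sup>2)" by (simp add: power_divide power_mult_distrib)
  ultimately show "\<exists>\<mu>\<in>K. \<exists>Q C. law_in_model n (\<sigma>\<^sup>2) \<mu> Q \<and> C \<in> adversaries n N \<epsilon> \<and>
      ennreal (\<delta>\<^sup>2 / (32 * c\<^sup>2)) \<le> (\<integral>\<^sup>+X. ennreal ((vdist n (est (C X)) \<mu>)\<^sup>2) \<partial>PiM {..<N} (\<lambda>_. Q))"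
    using s(2) id_adversary[OF \<open>0 \<le> \<epsilon>\<close>]
    by (intro bexI[of _ s] exI[of _ "Q s"] exI[of _ "\<lambda>X. X"] conjI) simp_all
qed

text \<open>Transfers the two-point bound to either target, with b = \<sigma>^2 max (1/N)
  \<epsilon>; 72 = 9 * 8 matches the diameter term.\<close>

lemma min_ratio_le:
  fixes a b d q :: real
  assumes "a \<le> 3 * b" "0 \<le> a" "0 \<le> d" "72 \<le> q"
  shows "min a d / q \<le> min (b / 2) (d / 9) / 8"
proof -
  have *: "min a d \<le> a" "min a d \<le> d" "0 \<le> min a d" using assms by auto
  have "min a d / q \<le> min a d / 72" using * assms by (intro divide_left_mono) auto
  also have "\<dots> = min a d / 9 / 8" by simp
  also have "\<dots> \<le> min (b / 2) (d / 9) / 8"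
  proof (intro divide_right_mono min.boundedI)
    show "min a d / 9 \<le> b / 2" using order_trans[OF *(1) assms(1)] order_trans[OF *(3,1)] assms(1) by linarith
  qed (use * in auto)
  finally show ?thesis .
qed

section \<open>Combining the lower bounds\<close>

context entropy_budget
begin

lemma minimax_risk_ge_critical:
  assumes \<epsilon>: "0 < \<epsilon>" "\<epsilon> \<le> 1" and \<delta>: "\<delta> \<in> critical" "0 < \<delta>"
  shows "ennreal (min (\<delta>\<^sup>2) ((diam_Rn n K)\<^sup>2) / (32 * c\<^sup>2)) \<le> minimax_risk n K \<sigma> \<epsilon> N"
proof -
  have c2: "16 \<le> c\<^sup>2" using power_mono[OF c_ge, of 2] by simp
  obtain \<nu> S where S: "\<nu> \<in> K" "finite S" "S \<noteq> {}" "S \<subseteq> {x. vdist n x \<nu> \<le> \<delta>} \<inter> K"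
    "separated n (\<delta> / c) S" "real N * \<delta>\<^sup>2 / \<sigma>\<^sup>2 \<le> ln (card S)"
    using local_entropy_attained[of "real N * \<delta>\<^sup>2 / \<sigma>\<^sup>2" n K \<delta> c] \<delta> centre by blast
  show ?thesis
  proof (cases "16 \<le> card S")
    case True
    have "ennreal (min (\<delta>\<^sup>2) ((diam_Rn n K)\<^sup>2) / (32 * c\<^sup>2)) \<le> ennreal (\<delta>\<^sup>2 / (32 * c\<^sup>2))"
      by (intro ennreal_leI divide_right_mono) auto
    also have "\<dots> \<le> minimax_risk n K \<sigma> \<epsilon> N"
      using minimax_risk_ge_packing[OF S(1,2,4,5) True S(6)] critical_le[OF \<delta>(1)] \<delta> c_ge \<epsilon> by simp
    finally show ?thesis .
  next
    case False
    \<comment> \<open>A small packing forces N \<delta>^2/\<sigma>^2 \<le> 4 ln 2 \<le> 3, so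
      \<delta>^2 is at most 3 \<sigma>^2/N and the two-point bound is enough.\<close>
    have "ln (card S) \<le> ln (2 ^ 4)"
      using False S by (subst ln_le_cancel_iff) (auto simp: card_gt_0_iff)
    also have "\<dots> = 4 * ln 2" by (subst ln_realpow) auto
    also have "\<dots> \<le> 3" using ln2_le_25_over_36 by simp
    finally have "real N * \<delta>\<^sup>2 / \<sigma>\<^sup>2 \<le> 3" using S(6) by simp
    then have "\<delta>\<^sup>2 \<le> 3 * (\<sigma>\<^sup>2 * (1 / N))" using \<sigma>_pos N_pos by (simp add: field_simps)
    also have "\<dots> \<le> 3 * (\<sigma>\<^sup>2 * max (1 / N) \<epsilon>)" by (intro mult_left_mono) auto
    finally have "\<delta>\<^sup>2 \<le> 3 * (\<sigma>\<^sup>2 * max (1 / N) \<epsilon>)" .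
    then have "ennreal (min (\<delta>\<^sup>2) ((diam_Rn n K)\<^sup>2) / (32 * c\<^sup>2))
      \<le> ennreal (min (\<sigma>\<^sup>2 * max (1 / N) \<epsilon> / 2) ((diam_Rn n K)\<^sup>2 / 9) / 8)"
      using c2 by (intro ennreal_leI min_ratio_le) auto
    also have "\<dots> \<le> minimax_risk n K \<sigma> \<epsilon> N"
      by (rule minimax_risk_ge_two_point[OF N_pos \<epsilon> \<sigma>_pos])
    finally show ?thesis .
  qed
qed

lemma minimax_risk_lower:
  assumes \<epsilon>: "0 < \<epsilon>" "\<epsilon> \<le> 1"
  shows "ennreal (1 / (128 * c\<^sup>2) * min (max (dstar\<^sup>2) (\<epsilon> * \<sigma>\<^sup>2)) ((diam_Rn n K)\<^sup>2)) \<le> minimax_risk n K \<sigma> \<epsilon> N"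
proof (cases "\<epsilon> * \<sigma>\<^sup>2 \<le> dstar\<^sup>2")
  case True
  have "0 < \<epsilon> * \<sigma>\<^sup>2" using \<epsilon> \<sigma>_pos by simp
  then have "0 < dstar" using True dstar_nonneg by (cases "dstar = 0") auto
  \<comment> \<open>The supremum need not be critical itself; a critical radius above half of it
    costs a factor 4, hence 128 = 4 * 32.\<close>
  then have "dstar / 2 < Sup critical" by (simp add: delta_star_def[symmetric])
  then obtain \<delta> where \<delta>: "\<delta> \<in> critical" "dstar / 2 < \<delta>"
    using less_cSup_iff[OF _ bdd_critical] zero_critical by blast
  have "(dstar / 2)\<^sup>2 \<le> \<delta>\<^sup>2" using \<delta> \<open>0 < dstar\<close> by (intro power_mono) auto
  then have "dstar\<^sup>2 \<le> 4 * \<delta>\<^sup>2" by (simp add: power_divide)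
  moreover have "min (dstar\<^sup>2) ((diam_Rn n K)\<^sup>2) \<le> dstar\<^sup>2" "min (dstar\<^sup>2) ((diam_Rn n K)\<^sup>2) \<le> (diam_Rn n K)\<^sup>2"
    "0 \<le> (diam_Rn n K)\<^sup>2" by auto
  ultimately have "min (dstar\<^sup>2) ((diam_Rn n K)\<^sup>2) / 4 \<le> min (\<delta>\<^sup>2) ((diam_Rn n K)\<^sup>2)"
    by - (rule min.boundedI; linarith)
  then have "min (dstar\<^sup>2) ((diam_Rn n K)\<^sup>2) / 4 / (32 * c\<^sup>2) \<le> min (\<delta>\<^sup>2) ((diam_Rn n K)\<^sup>2) / (32 * c\<^sup>2)"
    by (intro divide_right_mono) auto
  then have "ennreal (1 / (128 * c\<^sup>2) * min (max (dstar\<^sup>2) (\<epsilon> * \<sigma>\<^sup>2)) ((diam_Rn n K)\<^sup>2))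
    \<le> ennreal (min (\<delta>\<^sup>2) ((diam_Rn n K)\<^sup>2) / (32 * c\<^sup>2))"
    using True by (intro ennreal_leI) (simp add: max_absorb1)
  also have "\<dots> \<le> minimax_risk n K \<sigma> \<epsilon> N"
    using \<delta> \<open>0 < dstar\<close> by (intro minimax_risk_ge_critical[OF \<epsilon>]) auto
  finally show ?thesis .
next
  case False
  have c2: "16 \<le> c\<^sup>2" using power_mono[OF c_ge, of 2] by simp
  have "\<epsilon> * \<sigma>\<^sup>2 = 1 * (\<sigma>\<^sup>2 * \<epsilon>)" by simp
  also have "\<dots> \<le> 3 * (\<sigma>\<^sup>2 * max (1 / N) \<epsilon>)"
    using \<epsilon> by (intro mult_mono mult_left_mono) auto
  finally have "\<epsilon> * \<sigma>\<^sup>2 \<le> 3 * (\<sigma>\<^sup>2 * max (1 / N) \<epsilon>)" .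
  then have "ennreal (min (\<epsilon> * \<sigma>\<^sup>2) ((diam_Rn n K)\<^sup>2) / (128 * c\<^sup>2))
    \<le> ennreal (min (\<sigma>\<^sup>2 * max (1 / N) \<epsilon> / 2) ((diam_Rn n K)\<^sup>2 / 9) / 8)"
    using c2 \<epsilon> by (intro ennreal_leI min_ratio_le) auto
  then have "ennreal (1 / (128 * c\<^sup>2) * min (max (dstar\<^sup>2) (\<epsilon> * \<sigma>\<^sup>2)) ((diam_Rn n K)\<^sup>2))
    \<le> ennreal (min (\<sigma>\<^sup>2 * max (1 / N) \<epsilon> / 2) ((diam_Rn n K)\<^sup>2 / 9) / 8)"
    using False by (simp add: max_absorb2)
  also have "\<dots> \<le> minimax_risk n K \<sigma> \<epsilon> N"
    by (rule minimax_risk_ge_two_point[OF N_pos \<epsilon> \<sigma>_pos])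
  finally show ?thesis .
qed

end

theorem mainTheorem1:
  shows "\<exists>c0>0. \<forall>c\<ge>c0. \<exists>A>0. \<exists>C1>0. \<exists>C2>0.
    \<forall>(n::nat) (K::(nat \<Rightarrow> real) set) (\<sigma>::real) (\<epsilon>::real) (N::nat).
      n \<ge> 1 \<longrightarrow> N \<ge> 1 \<longrightarrow> K \<subseteq> space (Rn n) \<longrightarrow> star_shaped_Rn n K \<longrightarrow> bounded_Rn n K \<longrightarrow>
      \<sigma> > 0 \<longrightarrow> 0 < \<epsilon> \<longrightarrow> \<epsilon> < 1/32 \<longrightarrow>
      ereal (real N) \<ge> ereal A * (SUP \<delta>\<in>{0<..}. local_entropy n K \<delta> c) \<longrightarrow>
      (let R = min (max ((delta_star n K \<sigma> N c)^2) (\<epsilon> * \<sigma>^2)) ((diam_Rn n K)^2) in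
        ennreal (C1 * R) \<le> minimax_risk n K \<sigma> \<epsilon> N \<and>
        minimax_risk n K \<sigma> \<epsilon> N \<le> ennreal (C2 * R))"
proof (rule exI[of _ 4], intro conjI allI impI)
  fix c :: real assume c: "4 \<le> c"
  \<comment> \<open>The reciprocal of the \<beta> in the upper bound. Like both final constants it
    depends on \<open>c\<close> alone.\<close>
  define A where "A = 16 * c\<^sup>2 / test_rate"
  have c2: "16 \<le> c\<^sup>2" using power_mono[OF c, of 2] by simp
  have A: "1 \<le> A" using c2 by (simp add: A_def test_rate_def)
  have main: "ennreal (1 / (128 * c\<^sup>2) * R) \<le> minimax_risk n K \<sigma> \<epsilon> N \<and>
      minimax_risk n K \<sigma> \<epsilon> N \<le> ennreal (17408 * c ^ 4 / test_rate * R)"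
    if *: "N \<ge> 1" "K \<subseteq> space (Rn n)" "star_shaped_Rn n K" "bounded_Rn n K" "\<sigma> > 0" "0 < \<epsilon>" "\<epsilon> < 1/32"
      "ereal (real N) \<ge> ereal A * (SUP \<delta>\<in>{0<..}. local_entropy n K \<delta> c)"
      and R: "R = min (max ((delta_star n K \<sigma> N c)^2) (\<epsilon> * \<sigma>^2)) ((diam_Rn n K)^2)" for n K \<sigma> \<epsilon> N R
  proof -
    obtain k where "star_set n K k" using star_set_exists[OF *(2-4)] .
    then interpret star_set n K k .
    have "local_entropy n K \<delta> c \<le> ereal (N / A)" if "0 < \<delta>" for \<delta>
      using local_entropy_le_of_budget[OF *(8) _ that] A by simp
    then interpret entropy_budget n K k \<sigma> c A N
      using * A c by unfold_locales auto
    show ?thesis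
      using minimax_risk_lower[of \<epsilon>] minimax_risk_upper[of \<epsilon>] * by (simp add: R A_def)
  qed
  show "\<exists>A>0. \<exists>C1>0. \<exists>C2>0. \<forall>(n::nat) (K::(nat \<Rightarrow> real) set) (\<sigma>::real) (\<epsilon>::real) (N::nat).
      n \<ge> 1 \<longrightarrow> N \<ge> 1 \<longrightarrow> K \<subseteq> space (Rn n) \<longrightarrow> star_shaped_Rn n K \<longrightarrow> bounded_Rn n K \<longrightarrow>
      \<sigma> > 0 \<longrightarrow> 0 < \<epsilon> \<longrightarrow> \<epsilon> < 1/32 \<longrightarrow>
      ereal (real N) \<ge> ereal A * (SUP \<delta>\<in>{0<..}. local_entropy n K \<delta> c) \<longrightarrow>
      (let R = min (max ((delta_star n K \<sigma> N c)^2) (\<epsilon> * \<sigma>^2)) ((diam_Rn n K)^2) in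
        ennreal (C1 * R) \<le> minimax_risk n K \<sigma> \<epsilon> N \<and>
        minimax_risk n K \<sigma> \<epsilon> N \<le> ennreal (C2 * R))"
    unfolding Let_def
  proof (rule exI[of _ A], rule conjI)
    show "0 < A" using A by simp
    have C: "0 < 1 / (128 * c\<^sup>2)" "0 < 17408 * c ^ 4 / test_rate" using c by (auto simp: test_rate_def)
    show "\<exists>C1>0. \<exists>C2>0. \<forall>(n::nat) (K::(nat \<Rightarrow> real) set) (\<sigma>::real) (\<epsilon>::real) (N::nat).
      n \<ge> 1 \<longrightarrow> N \<ge> 1 \<longrightarrow> K \<subseteq> space (Rn n) \<longrightarrow> star_shaped_Rn n K \<longrightarrow> bounded_Rn n K \<longrightarrow>
      \<sigma> > 0 \<longrightarrow> 0 < \<epsilon> \<longrightarrow> \<epsilon> < 1/32 \<longrightarrow>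
      ereal (real N) \<ge> ereal A * (SUP \<delta>\<in>{0<..}. local_entropy n K \<delta> c) \<longrightarrow>
      ennreal (C1 * min (max ((delta_star n K \<sigma> N c)^2) (\<epsilon> * \<sigma>^2)) ((diam_Rn n K)^2)) \<le> minimax_risk n K \<sigma> \<epsilon> N \<and>
      minimax_risk n K \<sigma> \<epsilon> N \<le> ennreal (C2 * min (max ((delta_star n K \<sigma> N c)^2) (\<epsilon> * \<sigma>^2)) ((diam_Rn n K)^2))"
      by (rule exI, rule conjI[OF C(1)], rule exI, rule conjI[OF C(2)], intro allI impI, rule main; (assumption | rule refl))
  qed
qed simp

end
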